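(* The matrix of the cell-centered displacement system of the MSMFE-1 method, $$A_{\sigma u}A_{\sigma\sigma}^{-1}A_{\sigma u}^T-A_{\sigma u}A_{\sigma\sigma}^{-1}A_{\sigma\gamma}^T\big(A_{\sigma\gamma}A_{\sigma\sigma}^{-1}A_{\sigma\gamma}^T\big)^{-1}A_{\sigma\gamma}A_{\sigma\sigma}^{-1}A_{\sigma u}^T,$$ is symmetric and positive definite, where $(A_{\sigma\sigma})_{ij}=(A\tau_j,\tau_i)_Q$, $(A_{\sigma u})_{ij}=(\operatorname{div}\tau_j,v_i)$, $(A_{\sigma\gamma})_{ij}=(\tau_j,\xi_i)_Q$, and $\{\tau_j\}$, $\{v_i\}$, $\{\xi_i\}$ are the finite element bases of $\mathbb X_h$, $V_h$, $\mathbb W_h^1$.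
   Context: $d\in\{2,3\}$; $\Omega\subset\mathbb R^d$ is a simply connected bounded polygonal (polyhedral) domain with outward unit normal $n$; $\partial\Omega=\Gamma_D\cup\Gamma_N$ with $\Gamma_D\neq\emptyset$. $\mathbb M,\mathbb S,\mathbb N$ are the real $d\times d$ matrices, symmetric matrices and skew-symmetric matrices. $A=A(x)$, $x\in\Omega$, is at each point a symmetric linear operator $\mathbb M\to\mathbb M$ (mapping $\mathbb S$ to $\mathbb S$), bounded and uniformly positive definite in $x$. The divergence of a matrix field is taken row-wise. $(\cdot,\cdot)$ is the $L^2(\Omega)$ inner product (Frobenius product for matrices). $\mathbb X=\{\tau\in L^2(\Omega,\mathbb M):\operatorname{div}\tau\in L^2(\Omega,\mathbb R^d),\ \tau n=0\text{ on }\Gamma_N\}$, $V=L^2(\Omega,\mathbb R^d)$. $\mathcal T_h$ is a shape-regular, quasi-uniform conforming partition of $\Omega$ into triangles ($d=2$) or tetrahedra ($d=3$) of maximum diameter $h$; each boundary facet is contained in $\overline{\Gamma_D}$ or in $\overline{\Gamma_N}$. $\mathbb X_h=\{\tau\in\mathbb X:\tau|_E\in\mathcal P_1(E)^{d\times d}\ \forall E\in\mathcal T_h\}$, $V_h=\{v\in V: v|_E\in\mathcal P_0(E)^d\ \forall E\}$, $\mathbb W_h^1=\{\xi\in\mathcal C(\Omega,\mathbb N):\xi|_E\text{ has entries in }\mathcal P_1(E)\ \forall E\}$. Vertex quadrature: for an element $E$ with vertices $\mathbf r_1,\dots,\mathbf r_s$, $s=d+1$, $(\varphi,\psi)_{Q,E}=\frac{|E|}{s}\sum_{i=1}^s\varphi(\mathbf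 r_i):\psi(\mathbf r_i)$, with the values at $\mathbf r_i$ taken from within $E$, and $(\varphi,\psi)_Q=\sum_{E\in\mathcal T_h}(\varphi,\psi)_{Q,E}$. The MSMFE-1 method seeks $(\sigma_h,u_h,\gamma_h)\in\mathbb X_h\times V_h\times\mathbb W_h^1$ with $(A\sigma_h,\tau)_Q+(u_h,\operatorname{div}\tau)+(\gamma_h,\tau)_Q=\langle g,\tau n\rangle_{\Gamma_D}$ for all $\tau\in\mathbb X_h$, $(\operatorname{div}\sigma_h,v)=(f,v)$ for all $v\in V_h$, $(\sigma_h,\xi)_Q=0$ for all $\xi\in\mathbb W_h^1$. The displacement system results from eliminating first the stress and then the rotation unknowns; the matrices inverted are invertible. Standing assumption: $\mathcal T_h$ admits a partition into macroelements, each being the union of all simplices of $\mathcal T_h$ that share a given interior vertex, and each belonging to one of finitely many fixed equivalence classes $\mathcal E_{\hat M_1},\dots,\mathcal E_{\hat M_n}$. Here $M\in\mathcal E_{\hat M}$, $\hat M=\cup_{j=1}^m\hat T_j$, means that there is a continuous one-to-one map $F_M$ from $\hat M$ onto $M=\cup_{j=1}^mT_j$, $T_j=F_M(\hat T_j)$, with $F_M|_{\hat T_j}=F_{T_j}\circ F_{\hat T_j}^{-1}$, where $F_{\hat T_j},F_{T_j}$ are the affine maps from the reference simplex onto $\hat T_j,T_j$. *)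

theory Defs
  imports "HOL-Analysis.Analysis"
begin

section \<open>Domain and mesh\<close>

text \<open>The condition \<^prop>\<open>interior (closure \<Omega>) = \<Omega>\<close> excludes slits, so that every boundary facet
  of a mesh of \<open>\<Omega>\<close> has \<open>\<Omega>\<close> on one side only.\<close>

definition polyhedral_domain :: "(real^'d) set \<Rightarrow> bool" where
  "polyhedral_domain \<Omega> \<longleftrightarrow>
     open \<Omega> \<and> connected \<Omega> \<and> \<Omega> \<noteq> {} \<and> bounded \<Omega> \<and> simply_connected \<Omega> \<and>
     interior (closure \<Omega>) = \<Omega> \<and>
     (\<exists>\<P>. finite \<P> \<and> (\<forall>P\<in>\<P>. polytope P) \<and> closure \<Omega> = \<Union>\<P>)"

text \<open>The requirement that the Dirichlet part be nonempty is meant up to surface null sets: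
  \<open>\<Gamma>\<^sub>D\<close> has to contain a nonempty relatively open piece of the boundary.\<close>

definition boundary_partition :: "(real^'d) set \<Rightarrow> (real^'d) set \<Rightarrow> (real^'d) set \<Rightarrow> bool" where
  "boundary_partition \<Omega> \<Gamma>D \<Gamma>N \<longleftrightarrow>
     \<Gamma>D \<union> \<Gamma>N = frontier \<Omega> \<and> \<Gamma>D \<inter> \<Gamma>N = {} \<and>
     (top_of_set (frontier \<Omega>)) interior_of \<Gamma>D \<noteq> {}"

text \<open>\<^const>\<open>triangulation\<close> contains the conformity condition: two elements meet in a common face.\<close>

definition conforming_mesh ::
  "(real^'d) set \<Rightarrow> (real^'d) set \<Rightarrow> (real^'d) set \<Rightarrow> (real^'d) set set \<Rightarrow> bool" where
  "conforming_mesh \<Omega> \<Gamma>D \<Gamma>N \<T> \<longleftrightarrow>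
     triangulation \<T> \<and> (\<forall>E\<in>\<T>. int CARD('d) simplex E) \<and> \<Union>\<T> = closure \<Omega> \<and>
     (\<forall>E\<in>\<T>. \<forall>F. F facet_of E \<and> F \<subseteq> frontier \<Omega> \<longrightarrow> F \<subseteq> closure \<Gamma>D \<or> F \<subseteq> closure \<Gamma>N)"

definition mesh_size :: "(real^'d) set set \<Rightarrow> real" where
  "mesh_size \<T> = Max (diameter ` \<T>)"

definition shape_regular :: "real \<Rightarrow> (real^'d) set set \<Rightarrow> bool" where
  "shape_regular \<kappa> \<T> \<longleftrightarrow> (\<forall>E\<in>\<T>. \<exists>x \<rho>. \<rho> > 0 \<and> ball x \<rho> \<subseteq> E \<and> diameter E \<le> \<kappa> * \<rho>)"

definition quasi_uniform :: "real \<Rightarrow> (real^'d) set set \<Rightarrow> bool" where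
  "quasi_uniform \<kappa> \<T> \<longleftrightarrow> (\<forall>E\<in>\<T>. mesh_size \<T> \<le> \<kappa> * diameter E)"

section \<open>Macroelements\<close>

definition ref_simplex :: "(real^'d) set" where
  "ref_simplex = convex hull (insert 0 Basis)"

definition affine_iso :: "(real^'d \<Rightarrow> real^'d) \<Rightarrow> bool" where
  "affine_iso G \<longleftrightarrow> bij G \<and> (\<exists>c L. linear L \<and> G = (\<lambda>x. c + L x))"

text \<open>A macroelement is given by the set of its simplices.\<close>

definition macro_equiv :: "(real^'d) set set \<Rightarrow> (real^'d) set set \<Rightarrow> bool" where
  "macro_equiv Mhat M \<longleftrightarrow>
     (\<exists>F. continuous_on (\<Union>Mhat) F \<and> inj_on F (\<Union>Mhat) \<and> F ` (\<Union>Mhat) = \<Union>M \<and>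
          bij_betw (\<lambda>T. F ` T) Mhat M \<and>
          (\<forall>T\<in>Mhat. \<exists>GThat GT. affine_iso GThat \<and> affine_iso GT \<and>
             GThat ` ref_simplex = T \<and> GT ` ref_simplex = F ` T \<and>
             (\<forall>x\<in>T. F x = GT (inv GThat x))))"

definition mesh_vertices :: "(real^'d) set set \<Rightarrow> (real^'d) set" where
  "mesh_vertices \<T> = {r. \<exists>E\<in>\<T>. r extreme_point_of E}"

definition vertex_star :: "(real^'d) set set \<Rightarrow> real^'d \<Rightarrow> (real^'d) set set" where
  "vertex_star \<T> r = {E\<in>\<T>. r extreme_point_of E}"

text \<open>\<open>\<M>\<close> is the set of reference macroelements.\<close>

definition macroelement_partition ::
  "(real^'d) set set set \<Rightarrow> (real^'d) set \<Rightarrow> (real^'d) set set \<Rightarrow> bool" where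
  "macroelement_partition \<M> \<Omega> \<T> \<longleftrightarrow>
     (\<exists>R \<subseteq> mesh_vertices \<T> \<inter> \<Omega>. partition_on \<T> (vertex_star \<T> ` R) \<and>
        (\<forall>r\<in>R. \<exists>Mhat\<in>\<M>. macro_equiv Mhat (vertex_star \<T> r)))"

section \<open>Function spaces\<close>

definition L2_on :: "(real^'d) set \<Rightarrow> (real^'d \<Rightarrow> 'b::euclidean_space) \<Rightarrow> bool" where
  "L2_on \<Omega> f \<longleftrightarrow>
     f \<in> borel_measurable (lebesgue_on \<Omega>) \<and> integrable (lebesgue_on \<Omega>) (\<lambda>x. (norm (f x))\<^sup>2)"

text \<open>On matrices, \<^const>\<open>inner\<close> is the Frobenius product.\<close>

definition L2_inner ::
  "(real^'d) set \<Rightarrow> (real^'d \<Rightarrow> 'b::euclidean_space) \<Rightarrow> (real^'d \<Rightarrow> 'b) \<Rightarrow> real" where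
  "L2_inner \<Omega> f g = integral\<^sup>L (lebesgue_on \<Omega>) (\<lambda>x. f x \<bullet> g x)"

text \<open>\<open>\<phi>\<close> is a continuously differentiable function with gradient \<open>D\<phi>\<close>, compactly supported in \<open>U\<close>.\<close>

definition test_function ::
  "(real^'d) set \<Rightarrow> (real^'d \<Rightarrow> real) \<Rightarrow> (real^'d \<Rightarrow> real^'d) \<Rightarrow> bool" where
  "test_function U \<phi> D\<phi> \<longleftrightarrow>
     (\<forall>x. GDERIV \<phi> x :> D\<phi> x) \<and> continuous_on UNIV D\<phi> \<and>
     compact (closure {x. \<phi> x \<noteq> 0}) \<and> closure {x. \<phi> x \<noteq> 0} \<subseteq> U"

definition has_weak_div ::
  "(real^'d) set \<Rightarrow> (real^'d \<Rightarrow> real^'d^'d) \<Rightarrow> (real^'d \<Rightarrow> real^'d) \<Rightarrow> bool" where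
  "has_weak_div \<Omega> \<tau> g \<longleftrightarrow>
     (\<forall>i \<phi> D\<phi>. test_function \<Omega> \<phi> D\<phi> \<longrightarrow>
        L2_inner \<Omega> (\<lambda>x. row i (\<tau> x)) D\<phi> = - L2_inner \<Omega> (\<lambda>x. g x $ i) \<phi>)"

definition weak_div :: "(real^'d) set \<Rightarrow> (real^'d \<Rightarrow> real^'d^'d) \<Rightarrow> real^'d \<Rightarrow> real^'d" where
  "weak_div \<Omega> \<tau> = (SOME g. L2_on \<Omega> g \<and> has_weak_div \<Omega> \<tau> g)"

text \<open>The normal trace of an \<open>H(div)\<close> field is the functional
  \<open>\<phi> \<mapsto> (\<tau>\<^sub>i, \<nabla>\<phi>) + ((div \<tau>)\<^sub>i, \<phi>)\<close> given by Green's formula; it vanishes on \<open>\<Gamma>\<close> if it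
  annihilates all \<open>\<phi>\<close> that vanish near the rest of the boundary.\<close>

definition normal_trace_zero_on ::
  "(real^'d) set \<Rightarrow> (real^'d) set \<Rightarrow> (real^'d \<Rightarrow> real^'d^'d) \<Rightarrow> bool" where
  "normal_trace_zero_on \<Omega> \<Gamma> \<tau> \<longleftrightarrow>
     (\<forall>i \<phi> D\<phi>. test_function (- closure (frontier \<Omega> - \<Gamma>)) \<phi> D\<phi> \<longrightarrow>
        L2_inner \<Omega> (\<lambda>x. row i (\<tau> x)) D\<phi> + L2_inner \<Omega> (\<lambda>x. weak_div \<Omega> \<tau> x $ i) \<phi> = 0)"

definition X_space :: "(real^'d) set \<Rightarrow> (real^'d) set \<Rightarrow> (real^'d \<Rightarrow> real^'d^'d) set" where
  "X_space \<Omega> \<Gamma>N =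
     {\<tau>. L2_on \<Omega> \<tau> \<and> (\<exists>g. L2_on \<Omega> g \<and> has_weak_div \<Omega> \<tau> g) \<and> normal_trace_zero_on \<Omega> \<Gamma>N \<tau>}"

text \<open>Elements of the discrete spaces are represented by functions that agree with their
  polynomials pointwise in the interior of each element; the values on the mesh skeleton, a
  null set, are immaterial. Functions are identified when they agree almost everywhere in \<open>\<Omega>\<close>,
  see \<open>basis_of\<close> below.\<close>

definition P1_on :: "(real^'d) set \<Rightarrow> (real^'d \<Rightarrow> 'b::real_vector) \<Rightarrow> bool" where
  "P1_on E f \<longleftrightarrow> (\<exists>c L. linear L \<and> (\<forall>x\<in>interior E. f x = c + L x))"

definition P0_on :: "(real^'d) set \<Rightarrow> (real^'d \<Rightarrow> 'b::real_vector) \<Rightarrow> bool" where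
  "P0_on E f \<longleftrightarrow> (\<exists>c. \<forall>x\<in>interior E. f x = c)"

definition X_h ::
  "(real^'d) set \<Rightarrow> (real^'d) set \<Rightarrow> (real^'d) set set \<Rightarrow> (real^'d \<Rightarrow> real^'d^'d) set" where
  "X_h \<Omega> \<Gamma>N \<T> = {\<tau> \<in> X_space \<Omega> \<Gamma>N. \<forall>E\<in>\<T>. P1_on E \<tau>}"

definition V_h :: "(real^'d) set \<Rightarrow> (real^'d) set set \<Rightarrow> (real^'d \<Rightarrow> real^'d) set" where
  "V_h \<Omega> \<T> = {v. L2_on \<Omega> v \<and> (\<forall>E\<in>\<T>. P0_on E v)}"

definition W1_h :: "(real^'d) set \<Rightarrow> (real^'d) set set \<Rightarrow> (real^'d \<Rightarrow> real^'d^'d) set" where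
  "W1_h \<Omega> \<T> =
     {\<xi>. continuous_on \<Omega> \<xi> \<and> (\<forall>x\<in>\<Omega>. transpose (\<xi> x) = - \<xi> x) \<and> (\<forall>E\<in>\<T>. P1_on E \<xi>)}"

definition basis_of ::
  "(real^'d) set \<Rightarrow> (real^'d \<Rightarrow> 'b::real_vector) set \<Rightarrow> ('k::finite \<Rightarrow> real^'d \<Rightarrow> 'b) \<Rightarrow> bool" where
  "basis_of \<Omega> S b \<longleftrightarrow>
     (\<forall>k. b k \<in> S) \<and>
     (\<forall>f\<in>S. \<exists>!c :: 'k \<Rightarrow> real. AE x in lebesgue_on \<Omega>. f x = (\<Sum>k\<in>UNIV. c k *\<^sub>R b k x))"

section \<open>Coefficient and vertex quadrature\<close>

definition from_within ::
  "(real^'d) set \<Rightarrow> (real^'d \<Rightarrow> 'b::t2_space) \<Rightarrow> real^'d \<Rightarrow> 'b" where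
  "from_within E \<phi> r = Lim (at r within interior E) \<phi>"

definition quad_elem ::
  "(real^'d) set \<Rightarrow> (real^'d \<Rightarrow> real^'d^'d) \<Rightarrow> (real^'d \<Rightarrow> real^'d^'d) \<Rightarrow> real" where
  "quad_elem E \<phi> \<psi> =
     measure lebesgue E / real (CARD('d) + 1) *
       (\<Sum>r | r extreme_point_of E. from_within E \<phi> r \<bullet> from_within E \<psi> r)"

definition quad ::
  "(real^'d) set set \<Rightarrow> (real^'d \<Rightarrow> real^'d^'d) \<Rightarrow> (real^'d \<Rightarrow> real^'d^'d) \<Rightarrow> real" where
  "quad \<T> \<phi> \<psi> = (\<Sum>E\<in>\<T>. quad_elem E \<phi> \<psi>)"

definition admissible_coefficient ::
  "(real^'d) set \<Rightarrow> (real^'d \<Rightarrow> real^'d^'d \<Rightarrow> real^'d^'d) \<Rightarrow> bool" where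
  "admissible_coefficient \<Omega> A \<longleftrightarrow>
     (\<forall>x\<in>\<Omega>. linear (A x) \<and> (\<forall>\<sigma> \<tau>. A x \<sigma> \<bullet> \<tau> = \<sigma> \<bullet> A x \<tau>) \<and>
        (\<forall>\<tau>. transpose \<tau> = \<tau> \<longrightarrow> transpose (A x \<tau>) = A x \<tau>)) \<and>
     (\<exists>a1. \<forall>x\<in>\<Omega>. \<forall>\<tau>. norm (A x \<tau>) \<le> a1 * norm \<tau>) \<and>
     (\<exists>a0>0. \<forall>x\<in>\<Omega>. \<forall>\<tau>. A x \<tau> \<bullet> \<tau> \<ge> a0 * (\<tau> \<bullet> \<tau>))"

text \<open>The values of \<open>A\<close> at the vertices of an element, taken from within the element, exist;
  without this the quadrature form \<open>(A\<sigma>,\<tau>)\<^sub>Q\<close> is not defined. Jumps of \<open>A\<close> across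
  facets are allowed.\<close>

definition has_vertex_values ::
  "(real^'d) set set \<Rightarrow> (real^'d \<Rightarrow> real^'d^'d \<Rightarrow> real^'d^'d) \<Rightarrow> bool" where
  "has_vertex_values \<T> A \<longleftrightarrow>
     (\<forall>E\<in>\<T>. \<forall>r. r extreme_point_of E \<longrightarrow>
        (\<forall>\<tau>. \<exists>l. ((\<lambda>x. A x \<tau>) \<longlongrightarrow> l) (at r within interior E)))"

section \<open>Matrices of the method\<close>

definition A_sigma_sigma ::
  "(real^'d) set set \<Rightarrow> (real^'d \<Rightarrow> real^'d^'d \<Rightarrow> real^'d^'d) \<Rightarrow>
   ('p::finite \<Rightarrow> real^'d \<Rightarrow> real^'d^'d) \<Rightarrow> real^'p^'p" where
  "A_sigma_sigma \<T> A \<tau> = (\<chi> i j. quad \<T> (\<lambda>x. A x (\<tau> j x)) (\<tau> i))"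

definition A_sigma_u ::
  "(real^'d) set \<Rightarrow> ('p::finite \<Rightarrow> real^'d \<Rightarrow> real^'d^'d) \<Rightarrow>
   ('q::finite \<Rightarrow> real^'d \<Rightarrow> real^'d) \<Rightarrow> real^'p^'q" where
  "A_sigma_u \<Omega> \<tau> v = (\<chi> i j. L2_inner \<Omega> (weak_div \<Omega> (\<tau> j)) (v i))"

definition A_sigma_gamma ::
  "(real^'d) set set \<Rightarrow> ('p::finite \<Rightarrow> real^'d \<Rightarrow> real^'d^'d) \<Rightarrow>
   ('r::finite \<Rightarrow> real^'d \<Rightarrow> real^'d^'d) \<Rightarrow> real^'p^'r" where
  "A_sigma_gamma \<T> \<tau> \<xi> = (\<chi> i j. quad \<T> (\<tau> j) (\<xi> i))"

definition displacement_matrix ::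
  "real^'p::finite^'p \<Rightarrow> real^'p^'q::finite \<Rightarrow> real^'p^'r::finite \<Rightarrow> real^'q^'q" where
  "displacement_matrix Ass Asu Asg =
     Asu ** matrix_inv Ass ** transpose Asu -
     Asu ** matrix_inv Ass ** transpose Asg **
       matrix_inv (Asg ** matrix_inv Ass ** transpose Asg) **
       Asg ** matrix_inv Ass ** transpose Asu"

definition symmetric_positive_definite :: "real^'n^'n \<Rightarrow> bool" where
  "symmetric_positive_definite S \<longleftrightarrow> transpose S = S \<and> (\<forall>x. x \<noteq> 0 \<longrightarrow> x \<bullet> (S *v x) > 0)"

end

theory Submission
  imports Defs
begin

text \<open>
  Write \<open>w = A\<^sub>\<sigma>\<^sub>u\<^sup>T x\<close>. The quadratic form of the displacement matrix at \<open>x\<close> is the minimum over \<open>y\<close>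
  of the \<open>A\<^sub>\<sigma>\<^sub>\<sigma>\<^sup>-\<^sup>1\<close>-energy of \<open>w + A\<^sub>\<sigma>\<^sub>\<gamma>\<^sup>T y\<close>. As \<open>A\<^sub>\<sigma>\<^sub>\<sigma>\<close> is symmetric and positive definite
  (\<open>A_sigma_sigma_spd\<close>), the theorem comes down to the statement that \<open>A\<^sub>\<sigma>\<^sub>u\<^sup>T x + A\<^sub>\<sigma>\<^sub>\<gamma>\<^sup>T y = 0\<close> forces
  \<open>x = 0\<close> and \<open>y = 0\<close> (\<open>displacement_matrix_posdef\<close>): a piecewise constant displacement \<open>u\<close> and a
  continuous piecewise affine skew rotation \<open>\<gamma>\<close> with \<open>(u, div \<psi>) + (\<gamma>, \<psi>)\<^sub>Q = 0\<close> for all discrete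
  stresses \<open>\<psi>\<close> vanish.

  The vertex quadrature makes this condition local. Let \<open>r\<close> be a vertex of a facet that an element
  \<open>E\<close> with opposite vertex \<open>a\<close> shares with an element \<open>E'\<close> with opposite vertex \<open>a'\<close>. The stress whose
  only nonzero row is \<open>\<lambda>\<^sub>r (r - a) / |E|\<close> in \<open>E\<close> and \<open>- \<lambda>\<^sub>r (r - a') / |E'|\<close> in \<open>E'\<close> has a continuous normal
  component, and testing with it gives \<open>u\<^sub>E - u\<^sub>E\<^sub>' = \<gamma>(r) (c\<^sub>E - c\<^sub>E\<^sub>')\<close> with the centroids \<open>c\<^sub>E\<close>,
  \<open>c\<^sub>E\<^sub>'\<close>: the jump is that of a rigid displacement with rotation \<open>\<gamma>(r)\<close>, evaluated at the centroids.
  On a facet in the Dirichlet part the first half of the stress alone is admissible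
  (\<open>test_field_equation\<close>). That the stress on two elements lies in \<open>H(div)\<close> is Green's formula on
  two simplices, which follows from translation invariance of the integral (\<open>integral_flux_zero\<close>, \<open>flux_match\<close>).

  The jump does not depend on the vertex \<open>r\<close> of the facet, so the difference of \<open>\<gamma>\<close> at the two ends
  of an edge annihilates \<open>c\<^sub>E - c\<^sub>E\<^sub>'\<close>, a multiple of \<open>a - a'\<close>, for every facet around that edge.
  Around an edge that starts at an interior vertex of the domain these vectors do not all lie in the
  kernel of one nonzero skew matrix, which in two and three dimensions is at most a line
  (\<open>no_two_level_link\<close>). Hence \<open>\<gamma>\<close> is constant along such an edge. In a mesh that is
  partitioned into vertex macroelements every element has an interior vertex, so \<open>\<gamma>\<close> is constant
  on elements, then on the whole mesh, and \<open>u\<close> samples a rigid displacement at the centroids. The equations on one Dirichlet facet make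
  the rotation and then the displacement vanish (\<open>discrete_rigid_displacement_zero\<close>).
  Passing from an element to any other one through facets rests on segments in general position,
  which avoid the faces of codimension two (\<open>local_connectivity\<close>).
\<close>

section \<open>Schur complements\<close>

lemma posdef_invertible:
  fixes A :: "real^'n^'n"
  assumes "\<And>x. x \<noteq> 0 \<Longrightarrow> x \<bullet> (A *v x) > 0"
  shows "invertible A"
proof -
  have "x = 0" if "A *v x = 0" for x
    using assms[of x] that by auto
  then show ?thesis
    by (metis invertible_left_inverse matrix_left_invertible_ker)
qed

lemma matrix_inv_mult:
  fixes A :: "real^'n^'n"
  assumes "invertible A"
  shows "A ** matrix_inv A = mat 1" "matrix_inv A ** A = mat 1"
  using someI_ex[OF assms[unfolded invertible_def]] by (simp_all add: matrix_inv_def)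

lemma matrix_inv_cancel:
  fixes A :: "real^'n^'n"
  assumes "invertible A"
  shows "A *v (matrix_inv A *v x) = x" "matrix_inv A *v (A *v x) = x"
  using matrix_inv_mult[OF assms] by (simp_all add: matrix_vector_mul_assoc)

lemma transpose_matrix_inv_symmetric:
  fixes A :: "real^'n^'n"
  assumes "invertible A" "transpose A = A"
  shows "transpose (matrix_inv A) = matrix_inv A"
proof -
  have "transpose (matrix_inv A) ** A = mat 1"
    by (metis assms matrix_inv_mult(1) matrix_transpose_mul transpose_mat)
  then show ?thesis
    by (metis assms(1) matrix_inv_mult(1) matrix_mul_assoc matrix_mul_lid matrix_mul_rid)
qed

lemma transpose_diff: "transpose (A - B :: real^'n^'m) = transpose A - transpose B"
  by (simp add: transpose_def vec_eq_iff)

text \<open>The joint injectivity of the transposed coupling blocks is an inf-sup condition without its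
  constant: it makes the inner Schur complement invertible and keeps the energy minimum that
  represents the outer one away from zero.\<close>

lemma displacement_matrix_posdef:
  fixes Ass :: "real^'p::finite^'p" and Asu :: "real^'p^'q::finite" and Asg :: "real^'p^'r::finite"
  assumes sym: "transpose Ass = Ass"
    and pos: "\<And>x. x \<noteq> 0 \<Longrightarrow> x \<bullet> (Ass *v x) > 0"
    and inj: "\<And>x y. transpose Asu *v x + transpose Asg *v y = 0 \<Longrightarrow> x = 0 \<and> y = 0"
  shows "symmetric_positive_definite (displacement_matrix Ass Asu Asg)"
proof -
  note [simp del] = transpose_matrix_vector
  define M where "M = matrix_inv Ass"
  have inv: "invertible Ass" by (rule posdef_invertible[OF pos])
  have symM: "transpose M = M"
    unfolding M_def by (rule transpose_matrix_inv_symmetric[OF inv sym])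
  have adjM: "z \<bullet> (M *v w) = (M *v z) \<bullet> w" for z w
    by (metis dot_lmul_matrix symM transpose_matrix_vector)
  have posM: "z \<bullet> (M *v z) > 0" if "z \<noteq> 0" for z
  proof -
    have z: "Ass *v (M *v z) = z" unfolding M_def by (rule matrix_inv_cancel[OF inv])
    then have "M *v z \<noteq> 0" using that by auto
    from pos[OF this] show ?thesis by (simp add: z inner_commute)
  qed
  define K where "K = Asg ** M ** transpose Asg"
  have K_vec: "K *v y = Asg *v (M *v (transpose Asg *v y))" for y
    by (simp add: K_def flip: matrix_vector_mul_assoc)
  have adjg: "y \<bullet> (Asg *v z) = (transpose Asg *v y) \<bullet> z" for y z
    by (metis dot_lmul_matrix transpose_matrix_vector)
  have adju: "x \<bullet> (Asu *v z) = (transpose Asu *v x) \<bullet> z" for x z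
    by (metis dot_lmul_matrix transpose_matrix_vector)
  have posK: "y \<bullet> (K *v y) > 0" if "y \<noteq> 0" for y
  proof -
    have "transpose Asg *v y \<noteq> 0" using inj[of 0 y] that by auto
    then show ?thesis by (simp add: K_vec adjg posM)
  qed
  have invK: "invertible K" by (rule posdef_invertible[OF posK])
  have symK: "transpose K = K"
    by (simp add: K_def matrix_transpose_mul symM matrix_mul_assoc)
  have symKi: "transpose (matrix_inv K) = matrix_inv K"
    by (rule transpose_matrix_inv_symmetric[OF invK symK])
  define S where "S = displacement_matrix Ass Asu Asg"
  have S: "S = Asu ** M ** transpose Asu -
     Asu ** M ** transpose Asg ** matrix_inv K ** Asg ** M ** transpose Asu"
    by (simp add: S_def displacement_matrix_def M_def K_def)
  have symS: "transpose S = S"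
    by (simp add: S transpose_diff matrix_transpose_mul symM symKi matrix_mul_assoc)
  have minus: "B *v (- w) = - (B *v w)" for B :: "real^'m::finite^'n::finite" and w
    using matrix_vector_mult_diff_distrib[of B 0 w] by simp
  have "x \<bullet> (S *v x) > 0" if "x \<noteq> 0" for x
  proof -
    define w where "w = transpose Asu *v x"
    \<comment> \<open>The minimiser over the multipliers \<open>y\<close> of the \<open>M\<close>-energy of \<open>w + Asg\<^sup>T y\<close>;
      the minimum is the Schur complement.\<close>
    define y where "y = - (matrix_inv K *v (Asg *v (M *v w)))"
    define z where "z = w + transpose Asg *v y"
    have Ky: "K *v y = - (Asg *v (M *v w))"
      unfolding y_def by (simp add: minus matrix_inv_cancel[OF invK])
    have "z \<noteq> 0"
      using inj[of x y] that unfolding z_def w_def by auto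
    then have "0 < z \<bullet> (M *v z)" by (rule posM)
    also have "Asg *v (M *v z) = 0"
      using Ky by (simp add: z_def matrix_vector_right_distrib K_vec)
    then have "z \<bullet> (M *v z) = w \<bullet> (M *v z)"
      by (subst z_def) (simp add: inner_left_distrib flip: adjg)
    also have "\<dots> = w \<bullet> (M *v w) + w \<bullet> (M *v (transpose Asg *v y))"
      by (simp add: z_def matrix_vector_right_distrib inner_right_distrib)
    also have "\<dots> = x \<bullet> (S *v x)"
      by (simp add: S w_def y_def minus adju matrix_vector_mult_diff_rdistrib inner_diff_right
          flip: matrix_vector_mul_assoc)
    finally show ?thesis .
  qed
  with symS show ?thesis
    by (simp add: symmetric_positive_definite_def S_def)
qed

section \<open>Barycentric coordinates\<close>

lemma small_step_in_open:
  fixes x z :: "'a::real_normed_vector"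
  assumes "open W" "x \<in> W"
  obtains t :: real where "0 < t" "t < 1" "x + t *\<^sub>R z \<in> W"
proof -
  have "((\<lambda>t. x + t *\<^sub>R z) \<longlongrightarrow> x + 0 *\<^sub>R z) (at_right 0)" by (intro tendsto_intros)
  then have "\<forall>\<^sub>F t in at_right 0. x + t *\<^sub>R z \<in> W"
    using assms by (intro topological_tendstoD) auto
  moreover have "\<forall>\<^sub>F t in at_right (0::real). t \<in> {0<..<1}"
    by (intro eventually_at_right_real) simp
  ultimately have "\<forall>\<^sub>F t in at_right 0. x + t *\<^sub>R z \<in> W \<and> t \<in> {0<..<1}"
    by (rule eventually_conj)
  from eventually_happens'[OF trivial_limit_at_right_real this] that show ?thesis
    unfolding greaterThanLessThan_iff by blast
qed

text \<open>The gradient of the affine function that is 1 at \<open>a\<close> and 0 at the other points of \<open>C\<close>; it is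
  unique when \<open>C\<close> is the vertex set of a full-dimensional simplex.\<close>

definition bary_grad :: "'a::euclidean_space set \<Rightarrow> 'a \<Rightarrow> 'a" where
  "bary_grad C a = (SOME g. \<forall>c\<in>C - {a}. g \<bullet> (c - a) = -1)"

definition bary :: "'a::euclidean_space set \<Rightarrow> 'a \<Rightarrow> 'a \<Rightarrow> real" where
  "bary C a x = 1 + bary_grad C a \<bullet> (x - a)"

lemma bary_add: "bary C a (x + y) = bary C a x + bary_grad C a \<bullet> y"
  by (simp add: bary_def inner_diff_right inner_add_right)

lemma bary_grad_diff: "bary_grad C a \<bullet> (x - y) = bary C a x - bary C a y"
  by (simp add: bary_def inner_diff_right)

lemma bary_combo: "bary C a ((1 - t) *\<^sub>R x + t *\<^sub>R y) = (1 - t) * bary C a x + t * bary C a y"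
  by (simp add: bary_def inner_diff_right inner_add_right algebra_simps)

lemma continuous_on_bary [continuous_intros]:
  "continuous_on S f \<Longrightarrow> continuous_on S (\<lambda>x. bary C a (f x))"
  unfolding bary_def by (intro continuous_intros)

lemma bary_has_derivative: "(bary C a has_derivative (\<lambda>h. bary_grad C a \<bullet> h)) F"
  unfolding bary_def by (auto intro!: derivative_eq_intros)

locale full_simplex =
  fixes C :: "'a::euclidean_space set"
  assumes indep: "\<not> affine_dependent C" and card_C: "card C = DIM('a) + 1"
begin

lemma finite_C [simp]: "finite C"
  using aff_independent_finite indep by blast

lemma affine_hull_C: "affine hull C = UNIV"
proof -
  have "aff_dim C = int DIM('a)"
    using indep affine_independent_iff_card[of C] card_C by simp
  then show ?thesis
    by (simp add: aff_dim_eq_full)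
qed

lemma bary_grad_vertex:
  assumes a: "a \<in> C" and c: "c \<in> C" "c \<noteq> a"
  shows "bary_grad C a \<bullet> (c - a) = -1"
proof -
  define B where "B = (\<lambda>x. - a + x) ` (C - {a})"
  have "independent B"
    using indep affine_dependent_iff_dependent2[OF a] a
    unfolding B_def by (simp add: insert_absorb affine_dependent_iff_dependent)
  then obtain f :: "'a \<Rightarrow> real" where f: "linear f" "\<And>x. x \<in> B \<Longrightarrow> f x = -1"
    using linear_independent_extend[of B "\<lambda>_. -1"] by blast
  define g where "g = adjoint f 1"
  have "g \<bullet> x = f x" for x
    using adjoint_works[OF f(1), of x 1] by (simp add: g_def inner_commute)
  then have "\<forall>c\<in>C - {a}. g \<bullet> (c - a) = -1"
    using f(2) by (auto simp: B_def)
  then have "\<forall>c\<in>C - {a}. bary_grad C a \<bullet> (c - a) = -1"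
    unfolding bary_grad_def by (rule someI)
  with c show ?thesis by blast
qed

lemma bary_vertex:
  assumes "a \<in> C" "c \<in> C"
  shows "bary C a c = (if c = a then 1 else 0)"
  using bary_grad_vertex[OF assms] by (auto simp: bary_def)

lemma bary_affine_combination:
  assumes a: "a \<in> C" and u: "sum u C = 1"
  shows "bary C a (\<Sum>c\<in>C. u c *\<^sub>R c) = u a"
proof -
  have "(\<Sum>c\<in>C. u c *\<^sub>R c) - a = (\<Sum>c\<in>C. u c *\<^sub>R (c - a))"
    using u by (simp add: scaleR_diff_right sum_subtractf flip: scaleR_left.sum)
  then have "bary C a (\<Sum>c\<in>C. u c *\<^sub>R c) = 1 + (\<Sum>c\<in>C. u c * (bary_grad C a \<bullet> (c - a)))"
    by (simp add: bary_def inner_sum_right)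
  also have "\<dots> = 1 + (\<Sum>c\<in>C. u c * ((if c = a then 1 else 0) - 1))"
    using bary_grad_vertex[OF a] by (intro arg_cong[of _ _ "\<lambda>s. 1 + s"] sum.cong) auto
  also have "\<dots> = 1 + (\<Sum>c\<in>C. (if c = a then u c else 0) - u c)"
    by (intro arg_cong[of _ _ "\<lambda>s. 1 + s"] sum.cong) auto
  also have "\<dots> = u a"
    using u a by (simp add: sum_subtractf sum.delta)
  finally show ?thesis .
qed

lemma affine_combination_ex:
  obtains u where "sum u C = 1" "(\<Sum>c\<in>C. u c *\<^sub>R c) = x"
proof -
  have "x \<in> affine hull C" by (simp add: affine_hull_C)
  with that show ?thesis by (auto simp: affine_hull_finite)
qed

lemma sum_bary: "(\<Sum>a\<in>C. bary C a x) = 1"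
  and sum_bary_scaleR: "(\<Sum>a\<in>C. bary C a x *\<^sub>R a) = x"
proof -
  obtain u where u: "sum u C = 1" "(\<Sum>c\<in>C. u c *\<^sub>R c) = x"
    by (rule affine_combination_ex)
  then have "bary C a x = u a" if "a \<in> C" for a
    using bary_affine_combination[OF that u(1)] by simp
  then show "(\<Sum>a\<in>C. bary C a x) = 1" "(\<Sum>a\<in>C. bary C a x *\<^sub>R a) = x"
    using u by simp_all
qed

lemma bary_eqI:
  assumes "\<And>a. a \<in> C \<Longrightarrow> bary C a x = bary C a y"
  shows "x = y"
proof -
  have "(\<Sum>a\<in>C. bary C a x *\<^sub>R a) = (\<Sum>a\<in>C. bary C a y *\<^sub>R a)"
    using assms by (intro sum.cong) auto
  then show ?thesis by (simp only: sum_bary_scaleR)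
qed

lemma bary_unique:
  assumes "sum u C = 1" "x = (\<Sum>c\<in>C. u c *\<^sub>R c)" "a \<in> C"
  shows "bary C a x = u a"
  using assms bary_affine_combination by blast

lemma convex_hull_bary: "convex hull C = {x. \<forall>a\<in>C. 0 \<le> bary C a x}"
proof -
  have "x \<in> convex hull C \<longleftrightarrow> (\<forall>a\<in>C. 0 \<le> bary C a x)" for x
  proof
    assume "x \<in> convex hull C"
    then obtain u where "\<forall>a\<in>C. 0 \<le> u a" "sum u C = 1" "(\<Sum>c\<in>C. u c *\<^sub>R c) = x"
      by (auto simp: convex_hull_finite)
    then show "\<forall>a\<in>C. 0 \<le> bary C a x"
      using bary_affine_combination[of _ u] by auto
  next
    assume "\<forall>a\<in>C. 0 \<le> bary C a x"
    then show "x \<in> convex hull C"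
      using sum_bary[of x] sum_bary_scaleR[of x]
      by (auto simp: convex_hull_finite intro!: exI[of _ "\<lambda>a. bary C a x"])
  qed
  then show ?thesis by blast
qed

lemma interior_convex_hull_bary: "interior (convex hull C) = {x. \<forall>a\<in>C. 0 < bary C a x}"
proof -
  have "interior (convex hull C) =
      {y. \<exists>u. (\<forall>x\<in>C. 0 < u x) \<and> sum u C = 1 \<and> (\<Sum>x\<in>C. u x *\<^sub>R x) = y}"
    by (rule interior_convex_hull_explicit_minimal[OF indep, THEN trans])
      (use card_C in simp)
  also have "\<dots> = {x. \<forall>a\<in>C. 0 < bary C a x}"
  proof (intro set_eqI iffI CollectI)
    fix x assume "x \<in> {y. \<exists>u. (\<forall>x\<in>C. 0 < u x) \<and> sum u C = 1 \<and> (\<Sum>x\<in>C. u x *\<^sub>R x) = y}"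
    then obtain u where u: "\<forall>x\<in>C. 0 < u x" "sum u C = 1" "(\<Sum>x\<in>C. u x *\<^sub>R x) = x" by blast
    show "\<forall>a\<in>C. 0 < bary C a x"
      using bary_affine_combination[OF _ u(2)] u(1,3) by simp
  next
    fix x assume "x \<in> {x. \<forall>a\<in>C. 0 < bary C a x}" then have "\<forall>a\<in>C. 0 < bary C a x" by blast
    then show "\<exists>u. (\<forall>x\<in>C. 0 < u x) \<and> sum u C = 1 \<and> (\<Sum>x\<in>C. u x *\<^sub>R x) = x"
      using sum_bary[of x] sum_bary_scaleR[of x] by (intro exI[of _ "\<lambda>a. bary C a x"]) auto
  qed
  finally show ?thesis .
qed

text \<open>Faces are cut out by the vanishing of barycentric coordinates; this turns incidence questions
  into sign conditions.\<close>

lemma convex_hull_subset_bary: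
  assumes "D \<subseteq> C"
  shows "convex hull D = {x \<in> convex hull C. \<forall>a\<in>C - D. bary C a x = 0}"
proof (intro set_eqI iffI)
  fix x assume x: "x \<in> convex hull D"
  have fD: "finite D" using assms finite_C finite_subset by blast
  obtain u where u: "\<forall>a\<in>D. 0 \<le> u a" "sum u D = 1" "(\<Sum>c\<in>D. u c *\<^sub>R c) = x"
    using x fD by (auto simp: convex_hull_finite)
  define w where "w c = (if c \<in> D then u c else 0)" for c
  have "sum w C = 1" "(\<Sum>c\<in>C. w c *\<^sub>R c) = x"
    using u assms fD by (simp_all add: w_def if_distrib[of "\<lambda>t. t *\<^sub>R _"] sum.If_cases
        Int_absorb1 cong: if_cong)
  then have "bary C a x = w a" if "a \<in> C" for a
    using bary_affine_combination[OF that] by blast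
  moreover have "x \<in> convex hull C" using x assms hull_mono by blast
  ultimately show "x \<in> {x \<in> convex hull C. \<forall>a\<in>C - D. bary C a x = 0}"
    by (auto simp: w_def)
next
  fix x assume "x \<in> {x \<in> convex hull C. \<forall>a\<in>C - D. bary C a x = 0}"
  then have x: "\<forall>a\<in>C. 0 \<le> bary C a x" "\<forall>a\<in>C - D. bary C a x = 0"
    by (auto simp: convex_hull_bary)
  have fD: "finite D" using assms finite_C finite_subset by blast
  have "(\<Sum>a\<in>D. bary C a x) = 1"
    using sum_bary[of x] x(2) sum.mono_neutral_left[OF finite_C assms, of "\<lambda>a. bary C a x"] by simp
  moreover have "(\<Sum>a\<in>D. bary C a x *\<^sub>R a) = x"
    using sum_bary_scaleR[of x] x(2)
      sum.mono_neutral_left[OF finite_C assms, of "\<lambda>a. bary C a x *\<^sub>R a"] by simp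
  ultimately show "x \<in> convex hull D"
    using x(1) assms fD by (auto simp: convex_hull_finite intro!: exI[of _ "\<lambda>a. bary C a x"])
qed

lemma compact_hull: "compact (convex hull C)"
  by (simp add: compact_convex_hull finite_imp_compact)

lemma closed_hull: "closed (convex hull C)"
  by (simp add: compact_hull compact_imp_closed)

definition centroid :: 'a where
  "centroid = (1 / real (card C)) *\<^sub>R (\<Sum>c\<in>C. c)"

lemma bary_centroid: "a \<in> C \<Longrightarrow> bary C a centroid = 1 / real (card C)"
  using card_C by (intro bary_unique) (auto simp: centroid_def scaleR_right.sum)

lemma centroid_in_interior: "centroid \<in> interior (convex hull C)"
  using card_C by (auto simp: interior_convex_hull_bary bary_centroid)

lemma closure_interior_hull: "closure (interior (convex hull C)) = convex hull C"
proof -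
  have "interior (convex hull C) \<noteq> {}" using centroid_in_interior by blast
  then show ?thesis
    using convex_closure_interior[OF convex_convex_hull] closure_closed[OF closed_hull]
    by (rule_tac trans)
qed

lemma extreme_points: "{r. r extreme_point_of (convex hull C)} = C"
  using extreme_point_of_convex_hull_affine_independent[OF indep] by auto

end

lemma simplex_obtain:
  fixes E :: "(real^'d) set"
  assumes "int CARD('d) simplex E"
  shows "full_simplex {r. r extreme_point_of E}" "E = convex hull {r. r extreme_point_of E}"
proof -
  obtain C where C: "\<not> affine_dependent C" "int (card C) = int CARD('d) + 1" "E = convex hull C"
    using assms by (auto simp: simplex_def)
  then interpret full_simplex C
    by unfold_locales auto
  have "{r. r extreme_point_of E} = C"
    using extreme_points C(3) by simp
  then show "full_simplex {r. r extreme_point_of E}" "E = convex hull {r. r extreme_point_of E}"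
    using full_simplex_axioms C(3) by simp_all
qed

locale facet_pair = S: full_simplex C + S': full_simplex C'
  for C C' :: "'a::euclidean_space set" +
  fixes a a' :: 'a
  assumes a: "a \<in> C" and a': "a' \<in> C'" and facet: "C - {a} = C' - {a'}"
begin

text \<open>The affine map that fixes the common facet pointwise and takes one apex to the other.\<close>

definition transfer :: "'a \<Rightarrow> 'a" where
  "transfer x = x + bary C a x *\<^sub>R (a' - a)"

lemma bary_transfer:
  shows "r \<in> C - {a} \<Longrightarrow> bary C' r (transfer x) = bary C r x"
    and "bary C' a' (transfer x) = bary C a x"
proof -
  have ne: "a \<notin> C' - {a'}" "a' \<notin> C - {a}" using facet by auto
  define u where "u c = (if c = a' then bary C a x else bary C c x)" for c
  have u_c: "u c = bary C c x" if "c \<in> C - {a}" for c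
    using ne(2) that by (auto simp: u_def)
  have s: "(\<Sum>c\<in>C'. u c) = u a' + (\<Sum>c\<in>C - {a}. u c)"
    using sum.remove[OF S'.finite_C a', of u] facet by simp
  also have "\<dots> = bary C a x + (\<Sum>c\<in>C - {a}. bary C c x)"
    using u_c by (simp add: u_def)
  also have "\<dots> = 1"
    using S.sum_bary[of x] a by (simp add: sum.remove[of C a])
  finally have 1: "sum u C' = 1" .
  have "(\<Sum>c\<in>C'. u c *\<^sub>R c) = u a' *\<^sub>R a' + (\<Sum>c\<in>C - {a}. u c *\<^sub>R c)"
    using sum.remove[OF S'.finite_C a', of "\<lambda>c. u c *\<^sub>R c"] facet by simp
  also have "\<dots> = bary C a x *\<^sub>R a' + (\<Sum>c\<in>C - {a}. bary C c x *\<^sub>R c)"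
    using u_c by (simp add: u_def)
  also have "\<dots> = transfer x"
    using S.sum_bary_scaleR[of x] a
    by (simp add: sum.remove[of C a] transfer_def scaleR_diff_right algebra_simps)
  finally have 2: "transfer x = (\<Sum>c\<in>C'. u c *\<^sub>R c)" by simp
  show "bary C' r (transfer x) = bary C r x" if "r \<in> C - {a}"
    using S'.bary_unique[OF 1 2, of r] that facet u_c by auto
  show "bary C' a' (transfer x) = bary C a x"
    using S'.bary_unique[OF 1 2 a'] by (simp add: u_def)
qed

end

section \<open>Uniqueness of weak derivatives\<close>

lemma DERIV_positive_part_square: "((\<lambda>t::real. (max 0 t)\<^sup>2) has_field_derivative 2 * max 0 t) (at t)"
proof -
  have "\<exists>g. (\<forall>z. (max 0 z)\<^sup>2 - (max 0 t)\<^sup>2 = g z * (z - t)) \<and> isCont g t \<and> g t = 2 * max 0 t"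
    if "t = 0"
  proof (intro exI[of _ "max 0"] conjI allI)
    show "isCont (max 0) t" by (intro continuous_intros)
  qed (use that in \<open>auto simp: power2_eq_square max_def\<close>)
  then have zero: ?thesis if "t = 0"
    using that by (simp add: DERIV_caratheodory_within continuous_within)
  consider "t < 0" | "t = 0" | "t > 0" by linarith
  then show ?thesis
  proof cases
    case 1
    have "((\<lambda>t::real. 0) has_field_derivative 2 * max 0 t) (at t)"
      using 1 by (auto intro!: derivative_eq_intros)
    then show ?thesis
      by (rule has_field_derivative_transform_within_open[where S="{..<0}"]) (use 1 in auto)
  next
    case 3
    have "((\<lambda>t::real. t\<^sup>2) has_field_derivative 2 * max 0 t) (at t)"
      using 3 by (auto intro!: derivative_eq_intros)
    then show ?thesis
      by (rule has_field_derivative_transform_within_open[where S="{0<..}"]) (use 3 in auto)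
  qed (rule zero)
qed

lemma GDERIV_inner_self: "GDERIV (\<lambda>x. (x - c) \<bullet> (x - c)) x :> 2 *\<^sub>R (x - c)"
  unfolding gderiv_def by (auto intro!: derivative_eq_intros simp: inner_commute algebra_simps)

lemma GDERIV_imp_continuous_on:
  assumes "\<And>x. GDERIV \<phi> x :> D\<phi> x"
  shows "continuous_on S \<phi>"
proof -
  have "isCont \<phi> x" for x
    using assms[of x] unfolding gderiv_def by (rule has_derivative_continuous)
  then show ?thesis by (simp add: continuous_at_imp_continuous_on)
qed

text \<open>The square makes the positive part continuously differentiable.\<close>

definition ball_bump :: "'a::real_inner \<Rightarrow> real \<Rightarrow> 'a \<Rightarrow> real" where
  "ball_bump c r x = (max 0 (r\<^sup>2 - (x - c) \<bullet> (x - c)))\<^sup>2"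

definition ball_bump_grad :: "'a::real_inner \<Rightarrow> real \<Rightarrow> 'a \<Rightarrow> 'a" where
  "ball_bump_grad c r x = (2 * max 0 (r\<^sup>2 - (x - c) \<bullet> (x - c))) *\<^sub>R (- (2 *\<^sub>R (x - c)))"

lemma ball_bump_nonneg: "0 \<le> ball_bump c r x"
  by (simp add: ball_bump_def)

lemma ball_bump_pos_iff: "r > 0 \<Longrightarrow> 0 < ball_bump c r x \<longleftrightarrow> x \<in> ball c r"
  by (simp add: ball_bump_def dist_norm norm_minus_commute max_def flip: power2_norm_eq_inner)
    (smt (verit) norm_ge_zero power2_less_imp_less power_strict_mono zero_less_numeral)

lemma GDERIV_ball_bump: "GDERIV (ball_bump c r) x :> ball_bump_grad c r x"
proof -
  have "GDERIV (\<lambda>x. r\<^sup>2 - (x - c) \<bullet> (x - c)) x :> - (2 *\<^sub>R (x - c))"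
    using GDERIV_diff[OF GDERIV_const[of "r\<^sup>2"] GDERIV_inner_self] by simp
  from GDERIV_DERIV_compose[OF this DERIV_positive_part_square] show ?thesis
    by (simp add: ball_bump_def[abs_def] ball_bump_grad_def)
qed

lemma continuous_on_ball_bump_grad: "continuous_on S (ball_bump_grad c r)"
  unfolding ball_bump_grad_def[abs_def] by (intro continuous_intros)

lemma GDERIV_sum:
  assumes "finite I" "\<And>i. i \<in> I \<Longrightarrow> GDERIV (f i) x :> df i"
  shows "GDERIV (\<lambda>x. \<Sum>i\<in>I. f i x) x :> (\<Sum>i\<in>I. df i)"
  using assms by (induction I) (auto intro: GDERIV_const GDERIV_add)

text \<open>Countably many closed balls in \<open>U\<close> exhaust it. With the partial sums \<open>S\<^sub>n\<close> of bumps on these balls,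
  \<open>n S\<^sub>n / (1 + n S\<^sub>n)\<close> is compactly supported in \<open>U\<close> and tends to 1 exactly where some bump is positive.\<close>

lemma open_smooth_exhaustion:
  fixes U :: "(real^'d) set"
  assumes "open U"
  obtains \<phi> D\<phi> where "\<And>n::nat. test_function U (\<phi> n) (D\<phi> n)"
    "\<And>n x. 0 \<le> \<phi> n x" "\<And>n x. \<phi> n x \<le> 1" "\<And>x. (\<lambda>n. \<phi> n x) \<longlonglongrightarrow> indicator U x"
proof (cases "U = {}")
  case True
  then show ?thesis
    by (intro that[of "\<lambda>_ _. 0" "\<lambda>_ _. 0"]) (auto simp: test_function_def GDERIV_const)
next
  case False
  define \<B> where "\<B> = {ball c r | c r. r > 0 \<and> cball c r \<subseteq> U}"
  have "\<Union>\<B> = U"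
  proof (intro equalityI subsetI)
    fix x assume "x \<in> U"
    then obtain r where "r > 0" "cball x r \<subseteq> U" using assms open_contains_cball by blast
    then show "x \<in> \<Union>\<B>" by (force simp: \<B>_def)
  qed (force simp: \<B>_def)
  moreover obtain \<B>' where \<B>': "\<B>' \<subseteq> \<B>" "countable \<B>'" "\<Union>\<B>' = \<Union>\<B>"
    using Lindelof[of \<B>] by (auto simp: \<B>_def)
  ultimately have U: "\<Union>\<B>' = U" and "\<B>' \<noteq> {}" using False by auto
  define b where "b = from_nat_into \<B>'"
  have rng: "range b = \<B>'" unfolding b_def using \<open>\<B>' \<noteq> {}\<close> \<B>'(2) by simp
  then have "\<forall>k. \<exists>c r. b k = ball c r \<and> r > 0 \<and> cball c r \<subseteq> U"
    using \<B>'(1) unfolding \<B>_def by blast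
  then obtain c r where b: "\<And>k. b k = ball (c k) (r k)" "\<And>k. r k > 0" "\<And>k. cball (c k) (r k) \<subseteq> U"
    by metis
  define S where "S n x = (\<Sum>k\<le>n. ball_bump (c k) (r k) x)" for n :: nat and x
  define DS where "DS n x = (\<Sum>k\<le>n. ball_bump_grad (c k) (r k) x)" for n :: nat and x
  have S0: "0 \<le> S n x" for n x by (simp add: S_def sum_nonneg ball_bump_nonneg)
  have DS: "GDERIV (S n) x :> DS n x" for n x
    unfolding S_def[abs_def] DS_def by (rule GDERIV_sum) (auto intro: GDERIV_ball_bump)
  have cont_DS: "continuous_on UNIV (DS n)" for n
    unfolding DS_def[abs_def] by (intro continuous_intros continuous_on_ball_bump_grad)
  have cont_S: "continuous_on UNIV (S n)" for n
    unfolding S_def[abs_def] ball_bump_def by (intro continuous_intros)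
  \<comment> \<open>\<open>t \<mapsto> n t / (1 + n t)\<close> is written as \<open>1 - 1 / (1 + n t)\<close>.\<close>
  define \<phi> where "\<phi> n x = 1 - inverse (1 + real n * S n x)" for n :: nat and x
  define D\<phi> where "D\<phi> n x = (real n * (inverse (1 + real n * S n x))\<^sup>2) *\<^sub>R DS n x" for n :: nat and x
  have den: "1 + real n * S n x > 0" for n x
    using S0[of n x] by (simp add: add_pos_nonneg)
  have D\<phi>: "GDERIV (\<phi> n) x :> D\<phi> n x" for n x
  proof -
    have "((\<lambda>t. 1 - inverse (1 + real n * t)) has_field_derivative
        real n * (inverse (1 + real n * S n x))\<^sup>2) (at (S n x))"
      using den[of n x] by (auto intro!: derivative_eq_intros simp: power2_eq_square)
    from GDERIV_DERIV_compose[OF DS this] show ?thesis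
      by (simp add: \<phi>_def[abs_def] D\<phi>_def)
  qed
  have pos_iff: "S n x > 0 \<longleftrightarrow> (\<exists>k\<le>n. x \<in> ball (c k) (r k))" for n x
  proof
    assume "S n x > 0"
    moreover have "S n x \<le> 0" if "\<And>k. k \<le> n \<Longrightarrow> ball_bump (c k) (r k) x \<le> 0"
      unfolding S_def using that by (intro sum_nonpos) auto
    ultimately obtain k where "k \<le> n" "ball_bump (c k) (r k) x > 0"
      by (meson not_less)
    then show "\<exists>k\<le>n. x \<in> ball (c k) (r k)"
      using ball_bump_pos_iff[OF b(2)] by blast
  next
    assume "\<exists>k\<le>n. x \<in> ball (c k) (r k)"
    then obtain k where "k \<le> n" "ball_bump (c k) (r k) x > 0"
      using ball_bump_pos_iff[OF b(2)] by blast
    then show "S n x > 0"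
      unfolding S_def by (intro sum_pos2[of "{..n}" k]) (auto simp: ball_bump_nonneg)
  qed
  show ?thesis
  proof (rule that[of \<phi> D\<phi>])
    show "0 \<le> \<phi> n x" "\<phi> n x \<le> 1" for n x
      using den[of n x] S0[of n x] by (auto simp: \<phi>_def inverse_le_1_iff)
    show "test_function U (\<phi> n) (D\<phi> n)" for n
    proof -
      have supp: "{x. \<phi> n x \<noteq> 0} \<subseteq> (\<Union>k\<le>n. cball (c k) (r k))"
      proof
        fix x assume "x \<in> {x. \<phi> n x \<noteq> 0}"
        then have "S n x \<noteq> 0" by (auto simp: \<phi>_def)
        then have "S n x > 0" using S0[of n x] by linarith
        then show "x \<in> (\<Union>k\<le>n. cball (c k) (r k))"
          unfolding pos_iff using ball_subset_cball by blast
      qed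
      have comp: "compact (\<Union>k\<le>n. cball (c k) (r k))" by (intro compact_UN) auto
      have clos: "closure {x. \<phi> n x \<noteq> 0} \<subseteq> (\<Union>k\<le>n. cball (c k) (r k))"
        using supp comp by (simp add: closure_minimal compact_imp_closed)
      then have "closure {x. \<phi> n x \<noteq> 0} \<subseteq> U" using b(3) by blast
      moreover have "compact (closure {x. \<phi> n x \<noteq> 0})"
        using bounded_subset[OF compact_imp_bounded[OF comp] supp] by (simp only: compact_closure)
      moreover have "continuous_on UNIV (D\<phi> n)"
        unfolding D\<phi>_def[abs_def] using less_imp_neq[OF den]
        by (intro continuous_intros cont_S cont_DS ballI not_sym[of 0]) blast
      ultimately show ?thesis using D\<phi> by (simp add: test_function_def)
    qed
    show "(\<lambda>n. \<phi> n x) \<longlonglongrightarrow> indicator U x" for x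
    proof (cases "x \<in> U")
      case True
      then obtain k where k: "x \<in> ball (c k) (r k)" using U rng b(1) by blast
      define s where "s = S k x"
      have "s > 0" unfolding s_def pos_iff using k by blast
      have mono: "s \<le> S n x" if "k \<le> n" for n
        unfolding s_def S_def using that by (intro sum_mono2) (auto simp: ball_bump_nonneg)
      have "(\<lambda>n. inverse (1 + real n * s)) \<longlonglongrightarrow> 0"
        using \<open>s > 0\<close>
        by (intro tendsto_inverse_0_at_top filterlim_tendsto_add_at_top[OF tendsto_const]
            filterlim_at_top_mult_tendsto_pos[OF tendsto_const] filterlim_real_sequentially)
      moreover have "\<forall>\<^sub>F n in sequentially. norm (inverse (1 + real n * S n x)) \<le> inverse (1 + real n * s)"
        using eventually_ge_at_top[of k]
      proof eventually_elim
        case (elim n)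
        have "1 + real n * s \<le> 1 + real n * S n x"
          using mono[OF elim] by (simp add: mult_left_mono)
        moreover have "0 < 1 + real n * s" using \<open>s > 0\<close> by (simp add: add_pos_nonneg)
        ultimately show ?case using den[of n x] by (simp add: le_imp_inverse_le)
      qed
      ultimately have "(\<lambda>n. inverse (1 + real n * S n x)) \<longlonglongrightarrow> 0"
        by (rule Lim_null_comparison[rotated])
      from tendsto_diff[OF tendsto_const this, of 1] show ?thesis
        using True by (simp add: \<phi>_def)
    next
      case False
      have "S n x = 0" for n
      proof -
        have "x \<notin> ball (c k) (r k)" for k
          using False b(3)[of k] ball_subset_cball by blast
        then show ?thesis using pos_iff[of n x] S0[of n x] by fastforce
      qed
      then show ?thesis using False by (simp add: \<phi>_def)
    qed
  qed
qed

lemma test_function_imp_continuous: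
  assumes "test_function U \<phi> D\<phi>"
  shows "continuous_on S \<phi>" "continuous_on S D\<phi>"
proof -
  have g: "\<And>x. GDERIV \<phi> x :> D\<phi> x" "continuous_on UNIV D\<phi>"
    using assms by (simp_all add: test_function_def)
  show "continuous_on S \<phi>" by (rule GDERIV_imp_continuous_on[OF g(1)])
  show "continuous_on S D\<phi>" by (rule continuous_on_subset[OF g(2) subset_UNIV])
qed

text \<open>The exhaustion shows that \<open>h\<close> has integral zero over open subsets, and outer regularity extends this
  to all measurable ones.\<close>

lemma fundamental_lemma:
  fixes \<Omega> :: "(real^'d) set"
  assumes "open \<Omega>" "bounded \<Omega>" and h: "integrable (lebesgue_on \<Omega>) h"
    and zero: "\<And>\<phi> D\<phi>. test_function \<Omega> \<phi> D\<phi> \<Longrightarrow> integral\<^sup>L (lebesgue_on \<Omega>) (\<lambda>x. h x * \<phi> x) = 0"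
  shows "AE x in lebesgue_on \<Omega>. h x = (0::real)"
proof -
  let ?M = "lebesgue_on \<Omega>"
  have \<Omega>[measurable]: "\<Omega> \<in> sets lebesgue" using assms(1) by auto
  have sp: "space ?M = \<Omega>" by simp
  have hM[measurable]: "h \<in> borel_measurable ?M" using h by auto
  have ind_M: "indicator S \<in> borel_measurable ?M" if "S \<in> sets lebesgue" for S :: "(real^'d) set"
    using that by (intro borel_measurable_indicator') (auto simp: sets_restrict_space vimage_def Int_def)
  have openU: "integral\<^sup>L ?M (\<lambda>x. h x * indicator U x) = 0" if U: "open U" "U \<subseteq> \<Omega>" for U
  proof -
    obtain \<phi> D\<phi> where \<phi>: "\<And>n::nat. test_function U (\<phi> n) (D\<phi> n)"
      "\<And>n x. 0 \<le> \<phi> n x" "\<And>n x. \<phi> n x \<le> 1" "\<And>x. (\<lambda>n. \<phi> n x) \<longlonglongrightarrow> indicator U x"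
      using open_smooth_exhaustion[OF U(1)] by blast
    have meas: "\<phi> n \<in> borel_measurable ?M" for n
      by (intro continuous_imp_measurable_on_sets_lebesgue test_function_imp_continuous[OF \<phi>(1)] \<Omega>)
    have "(\<lambda>n. integral\<^sup>L ?M (\<lambda>x. h x * \<phi> n x)) \<longlonglongrightarrow> integral\<^sup>L ?M (\<lambda>x. h x * indicator U x)"
    proof (rule integral_dominated_convergence[where w="\<lambda>x. norm (h x)"])
      show "(\<lambda>x. h x * indicator U x) \<in> borel_measurable ?M"
        using ind_M[of U] U(1) by (intro borel_measurable_times hM) auto
      show "(\<lambda>x. h x * \<phi> n x) \<in> borel_measurable ?M" for n
        by (intro borel_measurable_times hM meas)
      show "AE x in ?M. (\<lambda>n. h x * \<phi> n x) \<longlonglongrightarrow> h x * indicator U x"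
        by (intro AE_I2 tendsto_mult tendsto_const \<phi>)
      show "AE x in ?M. norm (h x * \<phi> n x) \<le> norm (h x)" for n
        using \<phi>(2,3) by (intro AE_I2) (simp add: abs_mult mult_left_le)
    qed (use h in simp)
    moreover have "integral\<^sup>L ?M (\<lambda>x. h x * \<phi> n x) = 0" for n
      using \<phi>(1)[of n] U(2) by (intro zero) (auto simp: test_function_def)
    ultimately show ?thesis by (simp add: LIMSEQ_const_iff)
  qed
  have "set_lebesgue_integral ?M S h = 0" if "S \<in> sets ?M" for S
  proof -
    have S: "S \<in> sets lebesgue" "S \<subseteq> \<Omega>" using that \<Omega> by (auto simp: sets_restrict_space)
    have "\<exists>T. open T \<and> S \<subseteq> T \<and> emeasure lebesgue (T - S) < ennreal (inverse (Suc n))" for n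
      using sets_lebesgue_outer_open[OF S(1), of "inverse (Suc n)"] by (metis inverse_positive_iff_positive of_nat_0_less_iff zero_less_Suc)
    then obtain T where T: "\<And>n. open (T n)" "\<And>n. S \<subseteq> T n"
        "\<And>n. emeasure lebesgue (T n - S) < ennreal (inverse (Suc n))" by metis
    define V where "V n = (\<Inter>k\<le>n. T k) \<inter> \<Omega>" for n :: nat
    have V: "open (V n)" "V n \<subseteq> \<Omega>" for n
      using T(1) assms(1) by (auto simp: V_def intro!: open_INT)
    define G where "G = (\<Inter>n. V n)"
    have Gm: "G \<in> sets lebesgue"
      unfolding G_def using V(1) by (intro sets.countable_INT) auto
    have lim: "(\<lambda>n. indicator (V n) x) \<longlonglongrightarrow> (indicator G x :: real)" for x
    proof (cases "x \<in> G")
      case True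
      then show ?thesis by (simp add: G_def)
    next
      case False
      then obtain m where m: "x \<notin> V m" by (auto simp: G_def)
      have "\<forall>\<^sub>F n in sequentially. indicator (V n) x = (indicator G x :: real)"
        using eventually_ge_at_top[of m]
      proof eventually_elim
        case (elim n)
        then have "x \<notin> V n" using m by (auto simp: V_def)
        then show ?case using False by simp
      qed
      then show ?thesis by (simp add: tendsto_eventually)
    qed
    have "(\<lambda>n. integral\<^sup>L ?M (\<lambda>x. h x * indicator (V n) x)) \<longlonglongrightarrow> integral\<^sup>L ?M (\<lambda>x. h x * indicator G x)"
    proof (rule integral_dominated_convergence[where w="\<lambda>x. norm (h x)"])
      show "(\<lambda>x. h x * indicator G x) \<in> borel_measurable ?M"
        by (intro borel_measurable_times hM ind_M Gm)
      show "(\<lambda>x. h x * indicator (V n) x) \<in> borel_measurable ?M" for n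
        using V(1)[of n] by (intro borel_measurable_times hM ind_M) auto
      show "AE x in ?M. (\<lambda>n. h x * indicator (V n) x) \<longlonglongrightarrow> h x * indicator G x"
        by (intro AE_I2 tendsto_mult tendsto_const lim)
      show "AE x in ?M. norm (h x * indicator (V n) x) \<le> norm (h x)" for n
        by (intro AE_I2) (simp add: indicator_def)
    qed (use h in simp)
    then have G0: "integral\<^sup>L ?M (\<lambda>x. h x * indicator G x) = 0"
      using openU[OF V] by (simp add: LIMSEQ_const_iff)
    have "S \<subseteq> G" using T(2) S(2) by (auto simp: G_def V_def)
    have le: "emeasure lebesgue (G - S) \<le> ennreal (inverse (Suc n))" for n
    proof -
      have "G - S \<subseteq> T n - S" by (auto simp: G_def V_def)
      then have "emeasure lebesgue (G - S) \<le> emeasure lebesgue (T n - S)"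
        using T(1) S(1) by (intro emeasure_mono) auto
      with T(3)[of n] show ?thesis by simp
    qed
    have "(\<lambda>n. ennreal (inverse (Suc n))) \<longlonglongrightarrow> ennreal 0"
      by (intro tendsto_ennrealI LIMSEQ_inverse_real_of_nat)
    then have "emeasure lebesgue (G - S) \<le> ennreal 0"
      by (rule LIMSEQ_le_const) (use le in blast)
    then have "G - S \<in> null_sets lebesgue"
      using Gm S(1) by (auto simp: null_sets_def)
    then have "G - S \<in> null_sets ?M"
      using V(2)[of 0] by (subst null_sets_restrict_space[OF \<Omega>]) (auto simp: G_def)
    then have "AE x in ?M. x \<notin> G - S" by (rule AE_not_in)
    then have ae: "AE x in ?M. h x * indicator S x = h x * indicator G x"
      by eventually_elim (use \<open>S \<subseteq> G\<close> in \<open>auto simp: indicator_def\<close>)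
    have "integral\<^sup>L ?M (\<lambda>x. h x * indicator S x) = integral\<^sup>L ?M (\<lambda>x. h x * indicator G x)"
      by (intro integral_cong_AE[OF _ _ ae] borel_measurable_times hM ind_M S(1) Gm)
    then show ?thesis
      by (simp add: G0 set_lebesgue_integral_def mult.commute)
  qed
  moreover have "sigma_finite_measure ?M"
    using finite_measure_lebesgue_on[of \<Omega>] assms(1,2)
    by (intro finite_measure.axioms(1)) (simp add: lmeasurable_open)
  ultimately show ?thesis by (intro sigma_finite_measure.density_zero[OF _ h])
qed

section \<open>Fluxes through a facet\<close>

lemma nn_integral_translate:
  fixes f :: "'a::euclidean_space \<Rightarrow> ennreal"
  assumes [measurable]: "f \<in> borel_measurable borel"
  shows "(\<integral>\<^sup>+x. f (c + x) \<partial>lborel) = (\<integral>\<^sup>+x. f x \<partial>lborel)"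
proof -
  have "(\<integral>\<^sup>+x. f x \<partial>lborel) = (\<integral>\<^sup>+x. f x \<partial>distr lborel borel ((+) c))"
    by (simp add: lborel_distr_plus)
  also have "\<dots> = (\<integral>\<^sup>+x. f (c + x) \<partial>lborel)"
    by (subst nn_integral_distr) auto
  finally show ?thesis by simp
qed

lemma nn_integral_reflect:
  fixes f :: "'a::euclidean_space \<Rightarrow> ennreal"
  assumes [measurable]: "f \<in> borel_measurable borel"
  shows "(\<integral>\<^sup>+x. f (c - x) \<partial>lborel) = (\<integral>\<^sup>+x. f x \<partial>lborel)"
proof -
  have "lborel = density (distr lborel borel (\<lambda>x::'a. c + (-1) *\<^sub>R x)) (\<lambda>_. ennreal (\<bar>-1\<bar> ^ DIM('a)))"
    by (rule lborel_affine) simp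
  then have "(\<integral>\<^sup>+x. f x \<partial>lborel) = (\<integral>\<^sup>+x. f x \<partial>distr lborel borel (\<lambda>x::'a. c + (-1) *\<^sub>R x))"
    by (simp add: density_1)
  also have "\<dots> = (\<integral>\<^sup>+x. f (c - x) \<partial>lborel)"
    by (subst nn_integral_distr) auto
  finally show ?thesis by simp
qed

text \<open>Translation invariant measures are unique up to a factor: write one of the two integrals inside the
  other, translate each variable in turn and exchange the order.\<close>

lemma nn_integral_affine_proportional:
  fixes \<Phi> L :: "'a::euclidean_space \<Rightarrow> 'a" and f g :: "'a \<Rightarrow> ennreal"
  assumes [measurable]: "\<Phi> \<in> borel_measurable borel"
    and \<Phi>: "\<And>x z. \<Phi> (x + z) = \<Phi> x + L z" and surj: "surj L"
    and [measurable]: "f \<in> borel_measurable borel" "g \<in> borel_measurable borel"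
  shows "(\<integral>\<^sup>+x. f (\<Phi> x) \<partial>lborel) * (\<integral>\<^sup>+y. g y \<partial>lborel) =
    (\<integral>\<^sup>+x. g (\<Phi> x) \<partial>lborel) * (\<integral>\<^sup>+y. f y \<partial>lborel)"
proof -
  \<comment> \<open>The pushforward under \<open>\<Phi>\<close> does not see translations, since every vector is of the form \<open>L z\<close>.\<close>
  have inv: "(\<integral>\<^sup>+x. k (\<Phi> x + w) \<partial>lborel) = (\<integral>\<^sup>+x. k (\<Phi> x) \<partial>lborel)"
    if [measurable]: "k \<in> borel_measurable borel" for k :: "'a \<Rightarrow> ennreal" and w
  proof -
    obtain z where "w = L z" using surj by blast
    then have "(\<integral>\<^sup>+x. k (\<Phi> x + w) \<partial>lborel) = (\<integral>\<^sup>+x. k (\<Phi> (z + x)) \<partial>lborel)"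
      using \<Phi> by (simp add: add.commute)
    also have "\<dots> = (\<integral>\<^sup>+x. k (\<Phi> x) \<partial>lborel)"
      by (rule nn_integral_translate) measurable
    finally show ?thesis .
  qed
  have "(\<integral>\<^sup>+x. f (\<Phi> x) \<partial>lborel) * (\<integral>\<^sup>+y. g y \<partial>lborel) =
      (\<integral>\<^sup>+x. f (\<Phi> x) * (\<integral>\<^sup>+y. g (\<Phi> x - y) \<partial>lborel) \<partial>lborel)"
    by (simp add: nn_integral_reflect nn_integral_multc)
  also have "\<dots> = (\<integral>\<^sup>+x. (\<integral>\<^sup>+y. f (\<Phi> x) * g (\<Phi> x - y) \<partial>lborel) \<partial>lborel)"
    by (simp add: nn_integral_cmult)
  also have "\<dots> = (\<integral>\<^sup>+y. (\<integral>\<^sup>+x. f (\<Phi> x) * g (\<Phi> x - y) \<partial>lborel) \<partial>lborel)"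
    by (rule lborel_pair.Fubini') measurable
  also have "\<dots> = (\<integral>\<^sup>+y. (\<integral>\<^sup>+x. f (\<Phi> x + y) * g (\<Phi> x) \<partial>lborel) \<partial>lborel)"
  proof (rule nn_integral_cong)
    fix y
    show "(\<integral>\<^sup>+x. f (\<Phi> x) * g (\<Phi> x - y) \<partial>lborel) = (\<integral>\<^sup>+x. f (\<Phi> x + y) * g (\<Phi> x) \<partial>lborel)"
      using inv[of "\<lambda>u. f u * g (u - y)" y] by simp
  qed
  also have "\<dots> = (\<integral>\<^sup>+x. (\<integral>\<^sup>+y. f (\<Phi> x + y) * g (\<Phi> x) \<partial>lborel) \<partial>lborel)"
    by (rule lborel_pair.Fubini') measurable
  also have "\<dots> = (\<integral>\<^sup>+x. g (\<Phi> x) * (\<integral>\<^sup>+y. f y \<partial>lborel) \<partial>lborel)"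
    by (simp add: nn_integral_translate nn_integral_cmult mult.commute)
  also have "\<dots> = (\<integral>\<^sup>+x. g (\<Phi> x) \<partial>lborel) * (\<integral>\<^sup>+y. f y \<partial>lborel)"
    by (simp add: nn_integral_multc)
  finally show ?thesis .
qed

text \<open>The factor is the inverse of the absolute determinant of \<open>L\<close>; where it matters it is read off
  from the measures of two simplices.\<close>

lemma distr_affine_proportional:
  fixes \<Phi> L :: "'a::euclidean_space \<Rightarrow> 'a"
  assumes \<Phi>m[measurable]: "\<Phi> \<in> borel_measurable borel"
    and \<Phi>: "\<And>x z. \<Phi> (x + z) = \<Phi> x + L z" "surj L"
    and B: "B \<in> sets borel" "emeasure lborel B \<noteq> 0" "emeasure lborel B \<noteq> \<infinity>"
      "emeasure lborel (\<Phi> -` B) \<noteq> \<infinity>"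
  obtains k :: real where "k \<ge> 0" "distr lborel borel \<Phi> = density lborel (\<lambda>_. ennreal k)"
proof -
  define k where "k = emeasure lborel (\<Phi> -` B) / emeasure lborel B"
  have ind: "(\<integral>\<^sup>+x. indicator S (\<Phi> x) \<partial>lborel) = emeasure lborel (\<Phi> -` S)" if "S \<in> sets borel" for S
  proof -
    have "(\<integral>\<^sup>+x. indicator S (\<Phi> x) \<partial>lborel) = (\<integral>\<^sup>+x. indicator (\<Phi> -` S) x \<partial>lborel)"
      by (simp add: indicator_def)
    also have "\<dots> = emeasure lborel (\<Phi> -` S)"
      using measurable_sets[OF \<Phi>m that] by (intro nn_integral_indicator) simp
    finally show ?thesis .
  qed
  have "distr lborel borel \<Phi> = density lborel (\<lambda>_. k)"
  proof (rule measure_eqI)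
    fix S assume "S \<in> sets (distr lborel borel \<Phi>)"
    then have S: "S \<in> sets borel" by simp
    have "emeasure lborel (\<Phi> -` S) * emeasure lborel B = emeasure lborel (\<Phi> -` B) * emeasure lborel S"
      using nn_integral_affine_proportional[OF \<Phi>m \<Phi>, of "indicator S" "indicator B"] S B(1)
      by (simp add: ind)
    then have "emeasure lborel (\<Phi> -` S) = k * emeasure lborel S"
      unfolding k_def using B(2,3)
      by (metis (no_types, lifting) ennreal_divide_times ennreal_mult_divide_eq ennreal_times_divide infinity_ennreal_def mult.commute)
    then show "emeasure (distr lborel borel \<Phi>) S = emeasure (density lborel (\<lambda>_. k)) S"
      using S by (simp add: emeasure_distr emeasure_density_const)
  qed simp
  moreover have "k \<noteq> top"
    using B(2,4) by (auto simp: k_def ennreal_divide_eq_top_iff)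
  ultimately show ?thesis
    using that[of "enn2real k"] by (simp add: less_top)
qed

context full_simplex
begin

lemma sets_hull [measurable]: "convex hull C \<in> sets borel"
  by (simp add: closed_hull borel_closed)

lemma emeasure_hull: "emeasure lborel (convex hull C) \<noteq> 0" "emeasure lborel (convex hull C) \<noteq> \<infinity>"
proof -
  obtain e where "e > 0" "ball centroid e \<subseteq> convex hull C"
    using centroid_in_interior mem_interior by blast
  then have "emeasure lborel (ball centroid e) \<le> emeasure lborel (convex hull C)"
    by (intro emeasure_mono) auto
  moreover have "0 < emeasure lborel (ball centroid e)"
    using open_not_negligible[of "ball centroid e"] \<open>e > 0\<close>
    by (simp add: negligible_iff_null_sets null_sets_def emeasure_completion zero_less_iff_neq_zero)
  ultimately show "emeasure lborel (convex hull C) \<noteq> 0" by auto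
  show "emeasure lborel (convex hull C) \<noteq> \<infinity>"
    using emeasure_compact_finite[OF compact_hull] by simp
qed

lemma measure_hull_pos: "measure lborel (convex hull C) > 0"
  using emeasure_hull by (simp add: measure_def enn2real_positive_iff less_top zero_less_iff_neq_zero)

lemma integrable_on_hull:
  fixes f :: "'a \<Rightarrow> real"
  assumes "continuous_on UNIV f"
  shows "integrable lborel (\<lambda>x. indicator (convex hull C) x * f x)"
  using borel_integrable_compact[OF compact_hull continuous_on_subset[OF assms subset_UNIV]]
  by (simp add: set_integrable_def)

lemma AE_off_frontier: "AE x in lborel. x \<notin> frontier (convex hull C)"
proof -
  have "frontier (convex hull C) \<in> null_sets lebesgue"
    using negligible_convex_frontier[of "convex hull C"] by (simp add: negligible_iff_null_sets)
  then have "frontier (convex hull C) \<in> null_sets lborel"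
    by (auto simp: null_sets_def emeasure_completion)
  then show ?thesis by (rule AE_not_in)
qed

lemma bary_shift:
  assumes "a \<in> C" "r \<in> C" "a \<noteq> r" "c \<in> C"
  shows "bary C c (x + h *\<^sub>R (r - a)) =
    bary C c x + (if c = r then h else if c = a then - h else 0)"
proof -
  have "bary_grad C c \<bullet> (r - a) = (if c = r then 1 else if c = a then - 1 else 0)"
    using assms by (simp add: bary_grad_diff bary_vertex)
  then show ?thesis by (simp add: bary_add)
qed

text \<open>Extended by zero, \<open>G\<close> is Lipschitz in the direction \<open>r - a\<close>. The integral of a difference quotient
  vanishes by translation invariance, and the quotients converge boundedly to the derivative off the
  boundary of the simplex.\<close>

lemma integral_directional_derivative_zero:
  assumes ar: "a \<in> C" "r \<in> C" "a \<noteq> r"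
    and G: "\<And>x. GDERIV G x :> DG x" "continuous_on UNIV DG"
    and Ga: "\<And>x. x \<in> convex hull C \<Longrightarrow> bary C a x = 0 \<Longrightarrow> G x = 0"
    and Gr: "\<And>x. x \<in> convex hull C \<Longrightarrow> bary C r x = 0 \<Longrightarrow> G x = 0"
  shows "(\<integral>x. indicator (convex hull C) x * (DG x \<bullet> (r - a)) \<partial>lborel) = 0"
proof -
  let ?E = "convex hull C" and ?d = "r - a"
  define Gt where "Gt x = indicator ?E x * G x" for x
  have E: "x \<in> ?E \<longleftrightarrow> (\<forall>c\<in>C. 0 \<le> bary C c x)" for x
    by (simp add: convex_hull_bary)
  have shift_r: "bary C r (x + h *\<^sub>R ?d) = bary C r x + h"
    and shift_a: "bary C a (x + h *\<^sub>R ?d) = bary C a x - h" for x h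
    using bary_shift[OF ar, of r x h] bary_shift[OF ar, of a x h] ar by auto
  have shift_E: "x + h *\<^sub>R ?d \<in> ?E"
    if "x \<in> ?E" "0 \<le> bary C r x + h" "0 \<le> bary C a x - h" for x h
    using that bary_shift[OF ar, of _ x h] unfolding E by auto
  have cont_G: "continuous_on UNIV G" by (rule GDERIV_imp_continuous_on[OF G(1)])
  have dG: "((\<lambda>t. G (x + t *\<^sub>R ?d)) has_real_derivative DG (x + s *\<^sub>R ?d) \<bullet> ?d) (at s)" for x s
  proof -
    have "((\<lambda>t. x + t *\<^sub>R ?d) has_derivative (\<lambda>t. t *\<^sub>R ?d)) (at s)"
      by (auto intro!: derivative_eq_intros)
    from has_derivative_compose[OF this G(1)[unfolded gderiv_def]]
    have "((\<lambda>t. G (x + t *\<^sub>R ?d)) has_derivative (\<lambda>t. (t *\<^sub>R ?d) \<bullet> DG (x + s *\<^sub>R ?d))) (at s)" .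
    moreover have "(\<lambda>t. (t *\<^sub>R ?d) \<bullet> DG (x + s *\<^sub>R ?d)) = (*) (DG (x + s *\<^sub>R ?d) \<bullet> ?d)"
      by (auto simp: inner_commute mult.commute)
    ultimately show ?thesis by (simp add: has_field_derivative_def)
  qed
  obtain K where K: "\<And>x. x \<in> ?E \<Longrightarrow> \<bar>DG x \<bullet> ?d\<bar> \<le> K"
  proof -
    have "continuous_on ?E (\<lambda>x. DG x \<bullet> ?d)"
      by (intro continuous_intros continuous_on_subset[OF G(2) subset_UNIV])
    then have "bounded ((\<lambda>x. DG x \<bullet> ?d) ` ?E)"
      using compact_hull by (intro compact_imp_bounded compact_continuous_image)
    then show ?thesis using that by (auto simp: bounded_iff)
  qed
  have K0: "K \<ge> 0" using K[OF subsetD[OF interior_subset centroid_in_interior]] by linarith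
  \<comment> \<open>Inside the simplex the mean value theorem applies.\<close>
  have mvt: "\<bar>G (x + h *\<^sub>R ?d) - G x\<bar> \<le> K * h" if h: "0 \<le> h" and x: "x \<in> ?E" "x + h *\<^sub>R ?d \<in> ?E" for x h
  proof (cases "h = 0")
    case False
    then have "0 < h" using h by simp
    then obtain s where s: "0 < s" "s < h"
      "G (x + h *\<^sub>R ?d) - G (x + 0 *\<^sub>R ?d) = (h - 0) * (DG (x + s *\<^sub>R ?d) \<bullet> ?d)"
      using MVT2[of 0 h "\<lambda>t. G (x + t *\<^sub>R ?d)" "\<lambda>t. DG (x + t *\<^sub>R ?d) \<bullet> ?d"] dG by blast
    have "x + s *\<^sub>R ?d \<in> ?E"
      using x s shift_r[of x s] shift_a[of x s] shift_a[of x h] ar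
      by (intro shift_E) (auto simp: E add_nonneg_nonneg intro: order_trans)
    from K[OF this] have "h * \<bar>DG (x + s *\<^sub>R ?d) \<bullet> ?d\<bar> \<le> h * K" using h by (rule mult_left_mono)
    then show ?thesis using s(3) h by (simp add: abs_mult mult.commute)
  qed (use K0 in simp)
  \<comment> \<open>Lines of direction \<open>r - a\<close> enter the simplex through the facet opposite to \<open>r\<close> and leave it
    through the facet opposite to \<open>a\<close>, so that the extension by zero is Lipschitz along them.\<close>
  have lip: "\<bar>Gt (x + h *\<^sub>R ?d) - Gt x\<bar> \<le> K * h" if h: "0 \<le> h" for x h
  proof -
    consider "x \<in> ?E" "x + h *\<^sub>R ?d \<in> ?E" | "x \<in> ?E" "x + h *\<^sub>R ?d \<notin> ?E"
      | "x \<notin> ?E" "x + h *\<^sub>R ?d \<in> ?E" | "x \<notin> ?E" "x + h *\<^sub>R ?d \<notin> ?E" by blast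
    then show ?thesis
    proof cases
      case 1
      then show ?thesis using mvt[OF h] by (simp add: Gt_def)
    next
      case 2
      define s where "s = bary C a x"
      have pos: "0 \<le> s" "0 \<le> bary C r x" using 2(1) ar by (auto simp: E s_def)
      then have sh: "s \<le> h" using shift_E[OF 2(1), of h] 2(2) h s_def by linarith
      have z: "x + s *\<^sub>R ?d \<in> ?E" using pos by (intro shift_E 2) (auto simp: s_def)
      then have "G (x + s *\<^sub>R ?d) = 0" by (intro Ga) (auto simp: shift_a s_def)
      with mvt[OF pos(1) 2(1) z] have "\<bar>G x\<bar> \<le> K * s" by simp
      also have "\<dots> \<le> K * h" using sh K0 by (intro mult_left_mono)
      finally show ?thesis using 2 by (simp add: Gt_def)
    next
      case 3
      let ?y = "x + h *\<^sub>R ?d"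
      define s where "s = bary C r ?y"
      have pos: "0 \<le> s" "0 \<le> bary C a ?y" using 3(2) ar by (auto simp: E s_def)
      have sh: "s \<le> h"
      proof (rule ccontr)
        assume "\<not> s \<le> h"
        then have "?y + (- h) *\<^sub>R ?d \<in> ?E"
          using pos h by (intro shift_E 3(2)) (auto simp: s_def)
        then show False using 3(1) by simp
      qed
      let ?z = "?y + (- s) *\<^sub>R ?d"
      have z: "?z \<in> ?E" using pos by (intro shift_E 3) (auto simp: s_def)
      moreover have "bary C r ?z = 0" by (simp only: shift_r[of ?y "-s"]) (simp add: s_def)
      ultimately have Gz: "G ?z = 0" by (intro Gr)
      have "?z + s *\<^sub>R ?d = ?y" by simp
      with mvt[OF pos(1) z] 3(2) Gz have "\<bar>G ?y\<bar> \<le> K * s" by simp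
      also have "\<dots> \<le> K * h" using sh K0 by (intro mult_left_mono)
      finally show ?thesis using 3 by (simp add: Gt_def)
    next
      case 4
      then show ?thesis using h K0 by (simp add: Gt_def)
    qed
  qed
  have Gt_int: "integrable lborel Gt"
    unfolding Gt_def[abs_def] by (rule integrable_on_hull[OF cont_G])
  then have Gt_meas[measurable]: "Gt \<in> borel_measurable borel" by auto
  have Gt_shift: "integrable lborel (\<lambda>x. Gt (x + c))" "(\<integral>x. Gt (x + c) \<partial>lborel) = (\<integral>x. Gt x \<partial>lborel)" for c
  proof -
    have "integrable (distr lborel borel ((+) c)) Gt" using Gt_int by (simp add: lborel_distr_plus)
    then show "integrable lborel (\<lambda>x. Gt (x + c))"
      by (subst (asm) integrable_distr_eq) (auto simp: add.commute)
    have "(\<integral>x. Gt x \<partial>lborel) = (\<integral>x. Gt x \<partial>distr lborel borel ((+) c))"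
      by (simp add: lborel_distr_plus)
    also have "\<dots> = (\<integral>x. Gt (x + c) \<partial>lborel)"
      by (subst integral_distr) (auto simp: add.commute)
    finally show "(\<integral>x. Gt (x + c) \<partial>lborel) = (\<integral>x. Gt x \<partial>lborel)" by simp
  qed
  define h where "h n = inverse (real (Suc n))" for n
  have h0: "h n > 0" "h n \<le> 1" for n by (auto simp: h_def inverse_le_1_iff)
  define q where "q n x = (Gt (x + h n *\<^sub>R ?d) - Gt x) / h n" for n x
  obtain R where R: "?E \<subseteq> ball 0 R"
    using compact_hull compact_imp_bounded bounded_subset_ballD by blast
  have "(\<lambda>n. \<integral>x. q n x \<partial>lborel) \<longlonglongrightarrow> (\<integral>x. indicator ?E x * (DG x \<bullet> ?d) \<partial>lborel)"
  proof (rule integral_dominated_convergence[where w="\<lambda>x. indicator (cball (0::'a) (R + norm ?d)) x * K"])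
    have [measurable]: "(\<lambda>x. DG x \<bullet> ?d) \<in> borel_measurable borel"
      by (intro borel_measurable_continuous_onI continuous_intros G(2))
    show "(\<lambda>x. indicator ?E x * (DG x \<bullet> ?d)) \<in> borel_measurable lborel" by measurable
    show "q n \<in> borel_measurable lborel" for n unfolding q_def[abs_def] by measurable
    have "set_integrable lborel (cball (0::'a) (R + norm ?d)) (\<lambda>x. K)"
      unfolding set_integrable_def by (rule borel_integrable_compact) auto
    then show "integrable lborel (\<lambda>x. indicator (cball (0::'a) (R + norm ?d)) x * K)"
      by (simp only: set_integrable_def real_scaleR_def)
    show "AE x in lborel. norm (q n x) \<le> indicator (cball (0::'a) (R + norm ?d)) x * K" for n
    proof (rule AE_I2)
      fix x
      have le: "norm (q n x) \<le> K"
        using lip[of "h n" x] h0[of n] by (simp add: q_def divide_le_eq)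
      have "q n x = 0" if "x \<notin> cball 0 (R + norm ?d)"
      proof -
        have "norm x > R + norm ?d" using that by simp
        moreover have "norm x \<le> norm (x + h n *\<^sub>R ?d) + norm (h n *\<^sub>R ?d)"
          using norm_triangle_ineq4[of "x + h n *\<^sub>R ?d" "h n *\<^sub>R ?d"] by simp
        moreover have "norm (h n *\<^sub>R ?d) \<le> norm ?d"
          using h0[of n] by (simp add: mult_left_le_one_le)
        ultimately have "x \<notin> ?E" "x + h n *\<^sub>R ?d \<notin> ?E"
          using subsetD[OF R, of x] subsetD[OF R, of "x + h n *\<^sub>R ?d"] norm_ge_zero[of ?d]
          unfolding mem_ball_0 by linarith+
        then show ?thesis by (simp add: q_def Gt_def)
      qed
      with le show "norm (q n x) \<le> indicator (cball (0::'a) (R + norm ?d)) x * K"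
        by (cases "x \<in> cball 0 (R + norm ?d)") auto
    qed
    show "AE x in lborel. (\<lambda>n. q n x) \<longlonglongrightarrow> indicator ?E x * (DG x \<bullet> ?d)"
      using AE_off_frontier
    proof eventually_elim
      case (elim x)
      have "(\<lambda>n. x + h n *\<^sub>R ?d) \<longlonglongrightarrow> x + 0 *\<^sub>R ?d"
        unfolding h_def by (intro tendsto_intros LIMSEQ_inverse_real_of_nat)
      then have lim: "(\<lambda>n. x + h n *\<^sub>R ?d) \<longlonglongrightarrow> x" by simp
      have "x \<in> interior ?E \<or> x \<in> - ?E"
        using elim closed_hull by (auto simp: frontier_def)
      then show ?case
      proof
        assume x: "x \<in> interior ?E"
        then have "\<forall>\<^sub>F n in sequentially. x + h n *\<^sub>R ?d \<in> interior ?E"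
          using lim by (intro topological_tendstoD) auto
        then have ev: "\<forall>\<^sub>F n in sequentially. (G (x + h n *\<^sub>R ?d) - G (x + 0 *\<^sub>R ?d)) / h n = q n x"
        proof eventually_elim
          case (elim n)
          then have "x \<in> ?E" "x + h n *\<^sub>R ?d \<in> ?E"
            using x interior_subset[of ?E] by blast+
          then show ?case by (simp add: q_def Gt_def)
        qed
        have "((\<lambda>t. (G (x + t *\<^sub>R ?d) - G (x + 0 *\<^sub>R ?d)) / t) \<longlongrightarrow> DG x \<bullet> ?d) (at 0)"
          using dG[of x 0] unfolding DERIV_def by simp
        moreover have "filterlim h (at 0) sequentially"
          unfolding filterlim_at h_def using LIMSEQ_inverse_real_of_nat by auto
        ultimately have "(\<lambda>n. (G (x + h n *\<^sub>R ?d) - G (x + 0 *\<^sub>R ?d)) / h n) \<longlonglongrightarrow> DG x \<bullet> ?d"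
          by (rule filterlim_compose)
        then have "(\<lambda>n. q n x) \<longlonglongrightarrow> DG x \<bullet> ?d"
          by (rule Lim_transform_eventually[OF _ ev])
        then show ?thesis using x interior_subset[of ?E] by auto
      next
        assume x: "x \<in> - ?E"
        then have "\<forall>\<^sub>F n in sequentially. x + h n *\<^sub>R ?d \<in> - ?E"
          using lim closed_hull by (intro topological_tendstoD) auto
        then have "\<forall>\<^sub>F n in sequentially. q n x = 0"
          by eventually_elim (use x in \<open>auto simp: q_def Gt_def\<close>)
        then show ?thesis using x by (simp add: tendsto_eventually)
      qed
    qed
  qed
  moreover have "(\<integral>x. q n x \<partial>lborel) = 0" for n
    unfolding q_def using Gt_shift Gt_int by simp
  ultimately show ?thesis by (simp add: LIMSEQ_const_iff)
qed

end

text \<open>The function \<open>\<lambda>\<^sub>r \<phi>\<close> vanishes on the facet opposite to \<open>r\<close> because of the first factor and on the one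
  opposite to \<open>a\<close> because of the second; its derivative along \<open>r - a\<close> is the integrand.\<close>

lemma (in full_simplex) integral_flux_zero:
  assumes a: "a \<in> C" and r: "r \<in> C - {a}"
    and \<phi>: "\<And>x. GDERIV \<phi> x :> D\<phi> x" "continuous_on UNIV D\<phi>"
    and zero: "\<And>x. x \<in> convex hull (C - {a}) \<Longrightarrow> \<phi> x = 0"
  shows "(\<integral>x. indicator (convex hull C) x * (bary C r x * (D\<phi> x \<bullet> (r - a)) + \<phi> x) \<partial>lborel) = 0"
proof -
  have ar: "a \<in> C" "r \<in> C" "a \<noteq> r" using a r by auto
  define DG where "DG x = bary C r x *\<^sub>R D\<phi> x + \<phi> x *\<^sub>R bary_grad C r" for x
  have cont_\<phi>: "continuous_on UNIV \<phi>" by (rule GDERIV_imp_continuous_on[OF \<phi>(1)])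
  have "(\<integral>x. indicator (convex hull C) x * (DG x \<bullet> (r - a)) \<partial>lborel) = 0"
  proof (rule integral_directional_derivative_zero[OF ar, of "\<lambda>x. bary C r x * \<phi> x"])
    have "GDERIV (bary C r) x :> bary_grad C r" for x
      using bary_has_derivative[of C r] by (simp add: gderiv_def inner_commute)
    from GDERIV_mult[OF this \<phi>(1)] show "GDERIV (\<lambda>x. bary C r x * \<phi> x) x :> DG x" for x
      by (simp add: DG_def)
    show "continuous_on UNIV DG"
      unfolding DG_def[abs_def] by (intro continuous_intros cont_\<phi> \<phi>(2))
    show "bary C r x * \<phi> x = 0" if "x \<in> convex hull C" "bary C a x = 0" for x
      using that a zero[of x] convex_hull_subset_bary[of "C - {a}"] by auto
  qed simp
  moreover have "bary_grad C r \<bullet> (r - a) = 1"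
    using ar by (simp add: bary_grad_diff bary_vertex)
  ultimately show ?thesis by (simp add: DG_def inner_add_left)
qed

context facet_pair
begin

lemma transfer_add: "transfer (x + z) = transfer x + (z + (bary_grad C a \<bullet> z) *\<^sub>R (a' - a))"
  by (simp add: transfer_def bary_add scaleR_add_left)

lemma transfer_in_hull_iff: "transfer x \<in> convex hull C' \<longleftrightarrow> x \<in> convex hull C"
proof -
  have "(\<forall>c\<in>C. 0 \<le> bary C c x) \<longleftrightarrow> 0 \<le> bary C a x \<and> (\<forall>c\<in>C - {a}. 0 \<le> bary C c x)"
    using a by blast
  also have "\<dots> \<longleftrightarrow> 0 \<le> bary C' a' (transfer x) \<and> (\<forall>c\<in>C - {a}. 0 \<le> bary C' c (transfer x))"
    by (simp only: bary_transfer cong: ball_cong)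
  also have "\<dots> \<longleftrightarrow> (\<forall>c\<in>C'. 0 \<le> bary C' c (transfer x))"
    unfolding facet using a' by blast
  finally show ?thesis by (simp add: S.convex_hull_bary S'.convex_hull_bary)
qed

lemma inj_transfer: "inj transfer"
proof (rule injI)
  fix x y assume "transfer x = transfer y"
  then have "bary C c x = bary C c y" if "c \<in> C" for c
    using that bary_transfer(1)[of c x] bary_transfer(1)[of c y] bary_transfer(2)[of x] bary_transfer(2)[of y]
    by (cases "c = a") auto
  then show "x = y" by (rule S.bary_eqI)
qed

lemma continuous_on_transfer: "continuous_on S f \<Longrightarrow> continuous_on S (\<lambda>x. transfer (f x))"
  unfolding transfer_def by (intro continuous_intros)

lemma integral_transfer:
  assumes f: "continuous_on UNIV f"
  shows "measure lborel (convex hull C') * (\<integral>x. indicator (convex hull C) x * f (transfer x) \<partial>lborel) =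
    measure lborel (convex hull C) * (\<integral>x. indicator (convex hull C') x * f x \<partial>lborel)"
proof -
  let ?E = "convex hull C" and ?E' = "convex hull C'"
  define L where "L z = z + (bary_grad C a \<bullet> z) *\<^sub>R (a' - a)" for z
  have \<Phi>m[measurable]: "transfer \<in> borel_measurable borel"
    by (intro borel_measurable_continuous_onI continuous_on_transfer continuous_on_id)
  have "linear L"
    unfolding L_def by (intro linearI) (auto simp: inner_add_right algebra_simps)
  moreover have "inj L"
  proof (rule injI)
    fix u v assume "L u = L v"
    then have "transfer (0 + u) = transfer (0 + v)" by (simp only: transfer_add L_def)
    from injD[OF inj_transfer this] show "u = v" by simp
  qed
  ultimately have "surj L" by (rule linear_injective_imp_surjective) simp
  have fm[measurable]: "f \<in> borel_measurable borel" by (rule borel_measurable_continuous_onI[OF f])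
  have vim: "transfer -` ?E' = ?E" using transfer_in_hull_iff by auto
  then have "emeasure lborel (transfer -` ?E') \<noteq> \<infinity>" using S.emeasure_hull by simp
  then obtain k :: real where k: "k \<ge> 0" "distr lborel borel transfer = density lborel (\<lambda>_. ennreal k)"
    using distr_affine_proportional[OF \<Phi>m _ \<open>surj L\<close>, of ?E'] transfer_add S'.emeasure_hull S'.sets_hull
    unfolding L_def by blast
  have scale: "(\<integral>x. indicator ?E x * g (transfer x) \<partial>lborel) = k * (\<integral>x. indicator ?E' x * g x \<partial>lborel)"
    if g: "continuous_on UNIV g" for g :: "'a \<Rightarrow> real"
  proof -
    have gm[measurable]: "g \<in> borel_measurable borel" by (rule borel_measurable_continuous_onI[OF g])
    have [measurable]: "?E' \<in> sets borel" by (rule S'.sets_hull)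
    have "(\<integral>x. indicator ?E x * g (transfer x) \<partial>lborel) = (\<integral>x. indicator ?E' (transfer x) * g (transfer x) \<partial>lborel)"
      by (simp add: indicator_def transfer_in_hull_iff)
    also have "\<dots> = (\<integral>x. indicator ?E' x * g x \<partial>distr lborel borel transfer)"
      by (subst integral_distr) auto
    also have "\<dots> = (\<integral>x. indicator ?E' x * g x \<partial>density lborel (\<lambda>_. ennreal k))"
      by (simp only: k(2))
    also have "\<dots> = k * (\<integral>x. indicator ?E' x * g x \<partial>lborel)"
      using k(1) by (subst integral_density) auto
    finally show ?thesis .
  qed
  have "measure lborel ?E = k * measure lborel ?E'"
    using scale[of "\<lambda>_. 1"] by simp
  then show ?thesis using scale[OF f] by simp
qed

text \<open>Both sides are the same surface integral of \<open>\<lambda>\<^sub>r \<phi>\<close> over the common facet, up to a common factor.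
  Pulling \<open>\<phi>\<close> back from the second simplex by the transfer map reduces the identity to a function
  that vanishes on the facet.\<close>

lemma flux_match:
  assumes r: "r \<in> C - {a}" and \<phi>: "\<And>x. GDERIV \<phi> x :> D\<phi> x" "continuous_on UNIV D\<phi>"
  shows "measure lborel (convex hull C') *
      (\<integral>x. indicator (convex hull C) x * (bary C r x * (D\<phi> x \<bullet> (r - a)) + \<phi> x) \<partial>lborel) =
    measure lborel (convex hull C) *
      (\<integral>x. indicator (convex hull C') x * (bary C' r x * (D\<phi> x \<bullet> (r - a')) + \<phi> x) \<partial>lborel)"
proof -
  let ?E = "convex hull C"
  define D\<psi> where "D\<psi> x = D\<phi> (transfer x) + (D\<phi> (transfer x) \<bullet> (a' - a)) *\<^sub>R bary_grad C a" for x
  have cont_\<phi>: "continuous_on UNIV \<phi>" by (rule GDERIV_imp_continuous_on[OF \<phi>(1)])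
  have cont_comp: "continuous_on UNIV (\<lambda>x. h (transfer x))" if "continuous_on UNIV h" for h :: "'a \<Rightarrow> 'b::topological_space"
    using continuous_on_compose2[OF that continuous_on_transfer[OF continuous_on_id]] by auto
  have D\<psi>: "GDERIV (\<lambda>x. \<phi> (transfer x)) x :> D\<psi> x" for x
  proof -
    have "(transfer has_derivative (\<lambda>h. h + (bary_grad C a \<bullet> h) *\<^sub>R (a' - a))) (at x)"
      unfolding transfer_def[abs_def] by (auto intro!: derivative_eq_intros bary_has_derivative)
    from has_derivative_compose[OF this \<phi>(1)[unfolded gderiv_def]] show ?thesis
      by (simp add: gderiv_def D\<psi>_def inner_add_left inner_add_right inner_commute mult.commute)
  qed
  have D\<psi>_dir: "D\<psi> x \<bullet> (r - a) = D\<phi> (transfer x) \<bullet> (r - a')" for x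
  proof -
    have "bary_grad C a \<bullet> (r - a) = -1" using r a by (simp add: S.bary_grad_vertex)
    then have "D\<psi> x \<bullet> (r - a) = D\<phi> (transfer x) \<bullet> (r - a) + (D\<phi> (transfer x) \<bullet> (a' - a)) * (-1)"
      by (simp only: D\<psi>_def inner_add_left inner_scaleR_left)
    also have "\<dots> = D\<phi> (transfer x) \<bullet> (r - a')" by (simp add: inner_diff_right)
    finally show ?thesis .
  qed
  have contD\<psi>: "continuous_on UNIV D\<psi>"
    unfolding D\<psi>_def[abs_def] by (intro continuous_intros cont_comp \<phi>(2))
  \<comment> \<open>On the common facet the transfer map is the identity, so that \<open>\<phi> - \<phi> \<circ> transfer\<close> vanishes there.\<close>
  have "(\<integral>x. indicator ?E x * (bary C r x * ((D\<phi> x - D\<psi> x) \<bullet> (r - a)) + (\<phi> x - \<phi> (transfer x))) \<partial>lborel) = 0"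
  proof (rule S.integral_flux_zero[OF a r])
    show "GDERIV (\<lambda>x. \<phi> x - \<phi> (transfer x)) x :> D\<phi> x - D\<psi> x" for x
      by (intro GDERIV_diff \<phi> D\<psi>)
    show "continuous_on UNIV (\<lambda>x. D\<phi> x - D\<psi> x)" by (intro continuous_intros \<phi> contD\<psi>)
    show "\<phi> x - \<phi> (transfer x) = 0" if "x \<in> convex hull (C - {a})" for x
      using that a S.convex_hull_subset_bary[of "C - {a}"] by (auto simp: transfer_def)
  qed
  moreover have "integrable lborel (\<lambda>x. indicator ?E x * (bary C r x * (D\<phi> x \<bullet> (r - a)) + \<phi> x))"
    by (intro S.integrable_on_hull continuous_intros \<phi>(2) cont_\<phi>)
  moreover have "integrable lborel (\<lambda>x. indicator ?E x * (bary C r x * (D\<psi> x \<bullet> (r - a)) + \<phi> (transfer x)))"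
    by (intro S.integrable_on_hull continuous_intros contD\<psi> cont_comp cont_\<phi>)
  moreover have "(\<lambda>x. indicator ?E x * (bary C r x * ((D\<phi> x - D\<psi> x) \<bullet> (r - a)) + (\<phi> x - \<phi> (transfer x)))) =
     (\<lambda>x. indicator ?E x * (bary C r x * (D\<phi> x \<bullet> (r - a)) + \<phi> x) -
       indicator ?E x * (bary C r x * (D\<psi> x \<bullet> (r - a)) + \<phi> (transfer x)))"
    by (auto simp: inner_diff_left algebra_simps)
  ultimately have "(\<integral>x. indicator ?E x * (bary C r x * (D\<phi> x \<bullet> (r - a)) + \<phi> x) \<partial>lborel) =
      (\<integral>x. indicator ?E x * (bary C r x * (D\<psi> x \<bullet> (r - a)) + \<phi> (transfer x)) \<partial>lborel)"
    by simp
  also have "\<dots> = (\<integral>x. indicator ?E x *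
      (bary C' r (transfer x) * (D\<phi> (transfer x) \<bullet> (r - a')) + \<phi> (transfer x)) \<partial>lborel)"
    using bary_transfer(1)[OF r] by (simp add: D\<psi>_dir)
  finally show ?thesis
    using integral_transfer[of "\<lambda>y. bary C' r y * (D\<phi> y \<bullet> (r - a')) + \<phi> y"]
    by (simp add: continuous_intros \<phi>(2) cont_\<phi>)
qed

end

section \<open>Simplicial meshes\<close>

context full_simplex
begin

lemma sum_bary_grad: "(\<Sum>c\<in>C. bary_grad C c \<bullet> z) = 0"
  and sum_bary_grad_scaleR: "(\<Sum>c\<in>C. (bary_grad C c \<bullet> z) *\<^sub>R c) = z"
proof -
  have *: "bary_grad C c \<bullet> z = bary C c (0 + z) - bary C c 0" for c
    unfolding bary_add by simp
  show "(\<Sum>c\<in>C. bary_grad C c \<bullet> z) = 0"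
    unfolding * by (simp add: sum_subtractf sum_bary)
  show "(\<Sum>c\<in>C. (bary_grad C c \<bullet> z) *\<^sub>R c) = z"
    unfolding * by (simp add: scaleR_diff_left sum_subtractf sum_bary_scaleR)
qed

lemma affine_eq_sum_bary:
  assumes "linear f"
  shows "k + f x = (\<Sum>c\<in>C. bary C c x *\<^sub>R (k + f c))"
proof -
  have "f x = f (\<Sum>c\<in>C. bary C c x *\<^sub>R c)" by (simp only: sum_bary_scaleR)
  also have "\<dots> = (\<Sum>c\<in>C. bary C c x *\<^sub>R f c)"
    using assms by (simp add: linear_sum linear_scale)
  finally show ?thesis
    by (simp add: scaleR_add_right sum.distrib sum_bary flip: scaleR_left.sum)
qed

text \<open>In the expansion of \<open>z\<close> with respect to the vertices only the coefficients at \<open>r\<close> and \<open>r'\<close> survive,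
  and they have sum zero.\<close>

lemma parallel_to_edge:
  assumes r: "r \<in> C" "r' \<in> C" "r \<noteq> r'"
    and zero: "\<And>c. c \<in> C - {r, r'} \<Longrightarrow> bary_grad C c \<bullet> z = 0"
  shows "z \<in> span {r' - r}"
proof -
  define k where "k c = bary_grad C c \<bullet> z" for c
  have C: "C = insert r (insert r' (C - {r, r'}))" using r by auto
  have "(\<Sum>c\<in>C. k c) = k r + k r'"
    using r zero by (subst C) (simp add: k_def)
  then have "k r = - k r'" using sum_bary_grad[of z] by (simp add: k_def)
  moreover have "(\<Sum>c\<in>C. k c *\<^sub>R c) = k r *\<^sub>R r + k r' *\<^sub>R r'"
    using r zero by (subst C) (simp add: k_def)
  ultimately have "z = k r' *\<^sub>R (r' - r)"
    using sum_bary_grad_scaleR[of z] by (simp add: k_def scaleR_diff_right)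
  then show ?thesis by (simp add: span_base span_scale)
qed

lemma edge_point:
  assumes r: "r \<in> C" "r' \<in> C" "r \<noteq> r'" and c: "c \<in> C"
  shows "bary C c (r + t *\<^sub>R (r' - r)) = (if c = r then 1 - t else if c = r' then t else 0)"
proof -
  have "bary_grad C c \<bullet> (r' - r) = bary C c r' - bary C c r" by (rule bary_grad_diff)
  then show ?thesis using r c by (auto simp: bary_add bary_vertex)
qed

end

text \<open>The two apexes lie strictly on opposite sides of the facet: otherwise the simplices would meet off
  the facet near \<open>w\<close>. A point near \<open>w\<close> is then in the first or the second simplex according to the
  sign of the coordinate belonging to the apex.\<close>

lemma (in facet_pair) interior_union:
  assumes inter: "convex hull C \<inter> convex hull C' = convex hull (C - {a})"
    and wa: "bary C a w = 0" and w: "\<And>c. c \<in> C - {a} \<Longrightarrow> 0 < bary C c w"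
  shows "w \<in> interior (convex hull C \<union> convex hull C')"
proof -
  have w_tr: "transfer w = w" by (simp add: transfer_def wa)
  have w': "bary C' a' w = 0" "\<And>c. c \<in> C - {a} \<Longrightarrow> bary C' c w = bary C c w"
    using bary_transfer(1)[of _ w] bary_transfer(2)[of w] by (simp_all add: w_tr wa)
  have rel: "bary C a x = bary C' a' x * bary C a a'" for x
  proof -
    have "x = (\<Sum>c\<in>C'. bary C' c x *\<^sub>R c)" by (simp only: S'.sum_bary_scaleR)
    define f where "f y = bary_grad C a \<bullet> y" for y
    have "linear f" unfolding f_def by (intro linearI) (auto simp: inner_add_right)
    have b: "bary C a y = (1 - f a) + f y" for y by (simp add: bary_def f_def inner_diff_right)
    have "bary C a x = (\<Sum>c\<in>C'. bary C' c x *\<^sub>R bary C a c)"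
      unfolding b by (rule S'.affine_eq_sum_bary[OF \<open>linear f\<close>])
    also have "\<dots> = bary C' a' x * bary C a a' + (\<Sum>c\<in>C - {a}. bary C' c x * bary C a c)"
      using sum.remove[OF S'.finite_C a', of "\<lambda>c. bary C' c x *\<^sub>R bary C a c"] facet by simp
    also have "(\<Sum>c\<in>C - {a}. bary C' c x * bary C a c) = 0"
      using S.bary_vertex[OF a] by (intro sum.neutral) auto
    finally show ?thesis by simp
  qed
  \<comment> \<open>Otherwise the two simplices would overlap along the segment from \<open>w\<close> to \<open>a'\<close>.\<close>
  have neg: "bary C a a' < 0"
  proof (rule ccontr)
    assume "\<not> bary C a a' < 0"
    then have ge: "bary C a a' \<ge> 0" by simp
    let ?P = "\<Inter>c\<in>C - {a}. {x. 0 < bary C c x}"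
    have "open ?P" by (intro open_INT ballI open_Collect_less continuous_intros) auto
    moreover have "w \<in> ?P" using w by blast
    ultimately obtain e where "0 < e" "e < 1" "w + e *\<^sub>R (a' - w) \<in> ?P" by (rule small_step_in_open)
    moreover have "w + e *\<^sub>R (a' - w) = (1 - e) *\<^sub>R w + e *\<^sub>R a'" by (simp add: algebra_simps)
    ultimately have e: "\<forall>c\<in>C - {a}. 0 < bary C c ((1 - e) *\<^sub>R w + e *\<^sub>R a')" "0 < e" "e < 1"
      by auto
    let ?z = "(1 - e) *\<^sub>R w + e *\<^sub>R a'"
    have "0 \<le> bary C a ?z" unfolding bary_combo using wa ge e by simp
    then have "0 \<le> bary C c ?z" if "c \<in> C" for c
      using e(1) that by (cases "c = a") (auto intro: less_imp_le)
    then have "?z \<in> convex hull C" by (simp add: S.convex_hull_bary)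
    moreover have z': "bary C' a' ?z = e"
      unfolding bary_combo using w'(1) S'.bary_vertex[OF a' a'] by simp
    have "?z \<in> convex hull C'"
      unfolding S'.convex_hull_bary
    proof (intro CollectI ballI)
      fix c assume c: "c \<in> C'"
      show "0 \<le> bary C' c ?z"
      proof (cases "c = a'")
        case False
        then have "c \<in> C - {a}" using c facet by auto
        then show ?thesis
          unfolding bary_combo using w'(2)[of c] w[of c] e S'.bary_vertex[OF c a'] False by simp
      qed (use z' e in simp)
    qed
    ultimately have "?z \<in> convex hull (C' - {a'})" using inter facet by auto
    then have "bary C' a' ?z = 0"
      using a' S'.convex_hull_subset_bary[of "C' - {a'}"] by auto
    with z' e show False by simp
  qed
  let ?W = "\<Inter>c\<in>C - {a}. {x. 0 < bary C c x} \<inter> {x. 0 < bary C' c x}"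
  have "open ?W"
    by (intro open_INT ballI open_Int open_Collect_less continuous_intros) auto
  moreover have "w \<in> ?W" using w w'(2) by auto
  moreover have "?W \<subseteq> convex hull C \<union> convex hull C'"
  proof
    fix x assume x: "x \<in> ?W"
    show "x \<in> convex hull C \<union> convex hull C'"
    proof (cases "0 \<le> bary C a x")
      case True
      then have "0 \<le> bary C c x" if "c \<in> C" for c
        using x that by (cases "c = a") (auto intro: less_imp_le)
      then have "x \<in> convex hull C" by (simp add: S.convex_hull_bary)
      then show ?thesis by blast
    next
      case False
      then have "0 < bary C' a' x" using rel[of x] neg by (metis less_eq_real_def mult_nonpos_nonpos not_less)
      have "x \<in> convex hull C'"
        unfolding S'.convex_hull_bary
      proof (intro CollectI ballI)
        fix c assume "c \<in> C'"
        then show "0 \<le> bary C' c x"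
          using x facet \<open>0 < bary C' a' x\<close> by (cases "c = a'") (auto simp: less_imp_le)
      qed
      then show ?thesis by blast
    qed
  qed
  ultimately show ?thesis by (meson interiorI)
qed

definition vert :: "'a::real_vector set \<Rightarrow> 'a set" where
  "vert E = {r. r extreme_point_of E}"

locale simplicial_mesh =
  fixes \<T> :: "(real^'d) set set"
  assumes triangulation: "triangulation \<T>"
    and full_dim: "\<And>E. E \<in> \<T> \<Longrightarrow> int CARD('d) simplex E"
begin

lemma finite_mesh [simp]: "finite \<T>"
  using triangulation by (simp add: triangulation_def)

lemma vert_simplex: "E \<in> \<T> \<Longrightarrow> full_simplex (vert E)"
  and hull_vert: "E \<in> \<T> \<Longrightarrow> convex hull (vert E) = E"
  using simplex_obtain[OF full_dim] by (simp_all add: vert_def)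

lemma card_vert: "E \<in> \<T> \<Longrightarrow> card (vert E) = CARD('d) + 1"
  and finite_vert [simp]: "E \<in> \<T> \<Longrightarrow> finite (vert E)"
  using full_simplex.card_C[OF vert_simplex] full_simplex.finite_C[OF vert_simplex] by simp_all

lemma closed_element: "E \<in> \<T> \<Longrightarrow> closed E"
  using full_simplex.closed_hull[OF vert_simplex] by (simp add: hull_vert)

lemma convex_element: "E \<in> \<T> \<Longrightarrow> convex E"
  using convex_convex_hull[of "vert E"] by (simp add: hull_vert)

lemma closure_interior_element: "E \<in> \<T> \<Longrightarrow> closure (interior E) = E"
  using full_simplex.closure_interior_hull[OF vert_simplex] by (simp add: hull_vert)

lemma vert_subset: "E \<in> \<T> \<Longrightarrow> vert E \<subseteq> E"
  using hull_subset[of "vert E" convex] by (simp add: hull_vert)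

lemma vert_eq_imp_eq: "E \<in> \<T> \<Longrightarrow> E' \<in> \<T> \<Longrightarrow> vert E \<subseteq> vert E' \<Longrightarrow> E = E'"
  by (metis card_subset_eq card_vert finite_vert hull_vert)

text \<open>Faces of a simplex are spanned by subsets of its vertices, and the spanning set is recovered as the
  set of extreme points, so the common face is spanned by common vertices.\<close>

lemma Int_elements:
  assumes "E \<in> \<T>" "E' \<in> \<T>"
  shows "E \<inter> E' = convex hull (vert E \<inter> vert E')"
proof -
  have f: "(E \<inter> E') face_of E" "(E \<inter> E') face_of E'"
    using triangulation assms by (auto simp: triangulation_def) (metis Int_commute)
  have *: "\<exists>D. D \<subseteq> vert S \<and> E \<inter> E' = convex hull D \<and> D = vert (E \<inter> E')"
    if "(E \<inter> E') face_of S" "S \<in> \<T>" for S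
  proof -
    interpret full_simplex "vert S" by (rule vert_simplex[OF that(2)])
    have "(E \<inter> E') face_of convex hull (vert S)" using that by (simp add: hull_vert)
    then obtain D where D: "D \<subseteq> vert S" "E \<inter> E' = convex hull D"
      using face_of_convex_hull_affine_independent[OF indep] by blast
    have "\<not> affine_dependent D" using indep D(1) affine_dependent_subset by blast
    then have "vert (E \<inter> E') = D"
      unfolding D(2) vert_def using extreme_point_of_convex_hull_affine_independent by blast
    with D show ?thesis by blast
  qed
  obtain D where D: "D \<subseteq> vert E" "E \<inter> E' = convex hull D" "D = vert (E \<inter> E')"
    using *[OF f(1) assms(1)] by blast
  moreover have "D \<subseteq> vert E'" using *[OF f(2) assms(2)] D(3) by blast
  moreover have "vert E \<inter> vert E' \<subseteq> vert (E \<inter> E')"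
    using vert_subset assms by (auto simp: vert_def extreme_point_of_def)
  ultimately show ?thesis by (metis Int_greatest subset_antisym)
qed

lemma interior_disjoint:
  assumes "E \<in> \<T>" "E' \<in> \<T>" "x \<in> interior E" "x \<in> E'"
  shows "E = E'"
proof -
  interpret full_simplex "vert E" by (rule vert_simplex[OF assms(1)])
  have "x \<in> convex hull (vert E \<inter> vert E')"
    using Int_elements[OF assms(1,2)] assms(3,4) interior_subset by blast
  then have "\<forall>c\<in>vert E - vert E'. bary (vert E) c x = 0"
    using convex_hull_subset_bary[of "vert E \<inter> vert E'"] by blast
  moreover have "\<forall>c\<in>vert E. 0 < bary (vert E) c x"
    using interior_convex_hull_bary assms(3) hull_vert[OF assms(1)] by auto
  ultimately have "vert E \<subseteq> vert E'" by (metis DiffI less_irrefl subsetI)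
  then show ?thesis using assms(1,2) by (rule_tac vert_eq_imp_eq)
qed

text \<open>\<open>a\<close> and \<open>a'\<close> are the vertices opposite to the common facet.\<close>

definition adjacent :: "(real^'d) set \<Rightarrow> real^'d \<Rightarrow> (real^'d) set \<Rightarrow> real^'d \<Rightarrow> bool" where
  "adjacent E a E' a' \<longleftrightarrow> E \<in> \<T> \<and> E' \<in> \<T> \<and> E \<noteq> E' \<and> a \<in> vert E \<and> a' \<in> vert E' \<and>
     vert E - {a} = vert E' - {a'}"

lemma adjacent_facet_pair:
  assumes "adjacent E a E' a'"
  shows "facet_pair (vert E) (vert E') a a'"
proof -
  interpret E: full_simplex "vert E" using assms by (simp add: adjacent_def vert_simplex)
  interpret E': full_simplex "vert E'" using assms by (simp add: adjacent_def vert_simplex)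
  show ?thesis using assms by unfold_locales (auto simp: adjacent_def)
qed

lemma adjacent_apex_notin:
  assumes "adjacent E a E' a'"
  shows "a \<notin> vert E'" "a' \<notin> vert E" "vert E \<inter> vert E' = vert E - {a}"
proof -
  have E: "E \<in> \<T>" "E' \<in> \<T>" "E \<noteq> E'" "a \<in> vert E" "a' \<in> vert E'" "vert E - {a} = vert E' - {a'}"
    using assms by (auto simp: adjacent_def)
  show 1: "a \<notin> vert E'"
    using E vert_eq_imp_eq[of E E'] by blast
  show "a' \<notin> vert E"
    using E vert_eq_imp_eq[of E' E] by blast
  show "vert E \<inter> vert E' = vert E - {a}" using 1 E by blast
qed

lemma adjacentI:
  assumes "E \<in> \<T>" "E' \<in> \<T>" "E \<noteq> E'" "CARD('d) \<le> card (vert E \<inter> vert E')"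
  obtains a a' where "adjacent E a E' a'"
proof -
  have single: "\<exists>b. b \<in> vert S \<and> vert S - {b} = vert E \<inter> vert E'" if S: "S = E \<or> S = E'" for S
  proof -
    have ST: "S \<in> \<T>" using S assms by auto
    have "vert E \<inter> vert E' \<noteq> vert S"
      using S assms vert_eq_imp_eq[of E E'] vert_eq_imp_eq[of E' E] by blast
    then have "card (vert E \<inter> vert E') < card (vert S)"
      using S ST by (intro psubset_card_mono) auto
    then have "card (vert S - (vert E \<inter> vert E')) = 1"
      using S ST assms(4) card_vert[OF ST] by (subst card_Diff_subset) auto
    then obtain b where "vert S - (vert E \<inter> vert E') = {b}" by (auto simp: card_1_singleton_iff)
    then show ?thesis using S by blast
  qed
  from single[of E] single[of E'] show ?thesis
    using that assms by (auto simp: adjacent_def)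
qed

end

section \<open>Connectivity through facets\<close>

text \<open>A segment from \<open>x\<close> that meets the hull of \<open>K\<close> ends in the affine hull of \<open>x\<close> and \<open>K\<close>, which is a null set
  when \<open>K\<close> has fewer points than the dimension.\<close>

lemma generic_segment_endpoint:
  fixes x :: "real^'d"
  assumes "finite \<K>" and \<K>: "\<And>K. K \<in> \<K> \<Longrightarrow> finite K \<and> card K < CARD('d)"
    and x: "\<And>K. K \<in> \<K> \<Longrightarrow> x \<notin> convex hull K"
    and W: "open W" "W \<noteq> {}"
  obtains y where "y \<in> W" "\<And>K. K \<in> \<K> \<Longrightarrow> closed_segment x y \<inter> convex hull K = {}"
proof -
  have "negligible (affine hull (insert x K))" if "K \<in> \<K>" for K
  proof -
    have "aff_dim (affine hull (insert x K)) < int DIM(real^'d)"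
      using aff_dim_le_card[of "insert x K"] card_insert_le_m1[of "CARD('d)" K x] \<K>[OF that]
      by (simp add: card_insert_if split: if_splits)
    then obtain g b where g: "g \<noteq> 0" "affine hull (insert x K) \<subseteq> {y. g \<bullet> y = b}"
      using aff_lowdim_subset_hyperplane by metis
    then show ?thesis
      using negligible_hyperplane[of g b] negligible_subset by blast
  qed
  then have "negligible (\<Union>K\<in>\<K>. affine hull (insert x K))"
    using assms(1) by (intro negligible_Union) auto
  then have "\<not> W \<subseteq> (\<Union>K\<in>\<K>. affine hull (insert x K))"
    using open_not_negligible[OF W] negligible_subset by blast
  then obtain y where y: "y \<in> W" "\<And>K. K \<in> \<K> \<Longrightarrow> y \<notin> affine hull (insert x K)" by blast
  have "closed_segment x y \<inter> convex hull K = {}" if K: "K \<in> \<K>" for K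
  proof (rule ccontr)
    assume "closed_segment x y \<inter> convex hull K \<noteq> {}"
    then obtain z t where z: "z \<in> convex hull K" "z = (1 - t) *\<^sub>R x + t *\<^sub>R y"
      unfolding in_segment(1)[abs_def] by (metis disjoint_iff in_segment(1))
    have "t \<noteq> 0" using z x[OF K] by auto
    define s where "s = 1 / t"
    have "y = (1 - s) *\<^sub>R x + s *\<^sub>R z"
      using \<open>t \<noteq> 0\<close> unfolding z(2) s_def by (simp add: algebra_simps)
    moreover have "x \<in> affine hull (insert x K)" by (simp add: hull_inc)
    moreover have "z \<in> affine hull (insert x K)"
      using z(1) convex_hull_subset_affine_hull[of K] hull_mono[of K "insert x K" affine] by blast
    ultimately have "y \<in> affine hull (insert x K)"
      using mem_affine[OF affine_affine_hull, of x _ z "1 - s" s] by simp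
    with y(2)[OF K] show False by simp
  qed
  with y(1) that show ?thesis by blast
qed

context simplicial_mesh
begin

lemma element_meets_open:
  assumes "E \<in> \<T>" "open B" "E \<inter> B \<noteq> {}"
  shows "interior E \<inter> B \<noteq> {}"
  using open_Int_closure_eq_empty[OF assms(2), of "interior E"] closure_interior_element[OF assms(1)] assms(3)
  by (simp add: Int_commute)

lemma closed_Union_elements: "\<S> \<subseteq> \<T> \<Longrightarrow> closed (\<Union>\<S>)"
  using closed_element finite_subset[OF _ finite_mesh] by (intro closed_Union) auto

text \<open>A segment in general position inside \<open>B\<close> passes from element to element only through facets. If
  \<open>b\<close> took different values at its ends, then two closed sets of elements would disconnect it, because
  a point in both would lie on the intersection of two elements that are not adjacent.\<close>

lemma local_connectivity:
  assumes \<S>: "\<S> \<subseteq> \<T>" and B: "open B" "convex B" "B \<subseteq> \<Union>\<S>"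
    and inv: "\<And>E a E' a'. E \<in> \<S> \<Longrightarrow> E' \<in> \<S> \<Longrightarrow> adjacent E a E' a' \<Longrightarrow> b E = b E'"
    and E: "E \<in> \<S>" "E \<inter> B \<noteq> {}" and E': "E' \<in> \<S>" "E' \<inter> B \<noteq> {}"
  shows "b E = b E'"
proof (rule ccontr)
  assume ne: "b E \<noteq> b E'"
  obtain x where x: "x \<in> interior E" "x \<in> B" using element_meets_open[of E B] E \<S> B(1) by blast
  define \<K> where "\<K> = {vert E1 \<inter> vert E2 | E1 E2. E1 \<in> \<S> \<and> E2 \<in> \<S> \<and> E1 \<noteq> E2 \<and> card (vert E1 \<inter> vert E2) < CARD('d)}"
  have fin\<S>: "finite \<S>" using \<S> finite_mesh finite_subset by blast
  have "\<K> \<subseteq> (\<lambda>(E1, E2). vert E1 \<inter> vert E2) ` (\<S> \<times> \<S>)" unfolding \<K>_def by auto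
  then have fin: "finite \<K>" using fin\<S> by (meson finite_SigmaI finite_imageI finite_subset)
  have W: "open (interior E' \<inter> B)" "interior E' \<inter> B \<noteq> {}"
    using element_meets_open[of E' B] E' \<S> B(1) by auto
  obtain y where y: "y \<in> interior E' \<inter> B" "\<And>K. K \<in> \<K> \<Longrightarrow> closed_segment x y \<inter> convex hull K = {}"
  proof (rule generic_segment_endpoint[OF fin _ _ W])
    show "finite K \<and> card K < CARD('d)" if "K \<in> \<K>" for K
      using that \<S> unfolding \<K>_def by auto
    show "x \<notin> convex hull K" if "K \<in> \<K>" for K
    proof -
      obtain E1 E2 where E12: "E1 \<in> \<S>" "E2 \<in> \<S>" "E1 \<noteq> E2" "K = vert E1 \<inter> vert E2"
        using \<open>K \<in> \<K>\<close> unfolding \<K>_def by auto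
      then have "convex hull K = E1 \<inter> E2" using Int_elements \<S> by blast
      then show ?thesis
        using interior_disjoint[OF _ _ x(1)] E12 E(1) \<S> by blast
    qed
  qed blast
  define S where "S = closed_segment x y"
  have SB: "S \<subseteq> B" unfolding S_def using x(2) y(1) B(2) by (simp add: closed_segment_subset)
  let ?A = "\<Union>{E1 \<in> \<S>. b E1 = b E}" and ?A' = "\<Union>{E1 \<in> \<S>. b E1 \<noteq> b E}"
  have "closed ?A" "closed ?A'" using \<S> by (auto intro!: closed_Union_elements)
  moreover have "S \<subseteq> ?A \<union> ?A'" using SB B(3) by blast
  moreover have "?A \<inter> ?A' \<inter> S = {}"
  proof (rule ccontr)
    assume "?A \<inter> ?A' \<inter> S \<noteq> {}"
    then obtain z where zA: "z \<in> ?A" "z \<in> ?A'" "z \<in> S" by blast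
    from zA(1) obtain E1 where 1: "E1 \<in> \<S>" "z \<in> E1" "b E1 = b E" by blast
    from zA(2) obtain E2 where 2: "E2 \<in> \<S>" "z \<in> E2" "b E2 \<noteq> b E" by blast
    have z: "z \<in> S" "z \<in> E1" "z \<in> E2" "E1 \<in> \<S>" "E2 \<in> \<S>" "b E1 \<noteq> b E2"
      using 1 2 zA(3) by simp_all
    then have "\<not> CARD('d) \<le> card (vert E1 \<inter> vert E2)"
      using adjacentI[of E1 E2] inv[of E1 E2] \<S> by blast
    then have "vert E1 \<inter> vert E2 \<in> \<K>"
      using z(4-6) unfolding \<K>_def by (intro CollectI exI[of _ E1] exI[of _ E2]) auto
    moreover have "z \<in> convex hull (vert E1 \<inter> vert E2)" using Int_elements[of E1 E2] z \<S> by blast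
    ultimately show False using y(2) z(1) unfolding S_def by blast
  qed
  moreover have "?A \<inter> S \<noteq> {}" using E(1) x(1) interior_subset unfolding S_def by auto
  moreover have "?A' \<inter> S \<noteq> {}" using E'(1) y(1) ne interior_subset unfolding S_def by fastforce
  moreover have "connected S" by (simp add: S_def)
  ultimately show False unfolding connected_closed by blast
qed

lemma global_connectivity:
  assumes \<Omega>: "open \<Omega>" "connected \<Omega>" "\<Omega> \<subseteq> \<Union>\<T>"
    and inv: "\<And>E a E' a'. adjacent E a E' a' \<Longrightarrow> b E = b E'"
    and E: "E \<in> \<T>" "E \<inter> \<Omega> \<noteq> {}" and E': "E' \<in> \<T>" "E' \<inter> \<Omega> \<noteq> {}"
  shows "b E = b E'"
proof -
  define R where "R p q \<longleftrightarrow> (\<forall>E\<in>\<T>. \<forall>E'\<in>\<T>. p \<in> E \<longrightarrow> q \<in> E' \<longrightarrow> b E = b E')" for p q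
  obtain x x' where x: "x \<in> E" "x \<in> \<Omega>" "x' \<in> E'" "x' \<in> \<Omega>" using E E' by blast
  have "R x x'"
  proof (rule connected_equivalence_relation[OF \<Omega>(2) x(2,4)])
    show "R p q \<Longrightarrow> R q p" for p q unfolding R_def by metis
    show "R p r" if "R p q" "R q r" "p \<in> \<Omega>" "q \<in> \<Omega>" "r \<in> \<Omega>" for p q r
    proof -
      obtain E'' where "E'' \<in> \<T>" "q \<in> E''" using \<open>q \<in> \<Omega>\<close> \<Omega>(3) by blast
      then show ?thesis using that(1,2) unfolding R_def by metis
    qed
    show "\<exists>T. openin (top_of_set \<Omega>) T \<and> p \<in> T \<and> (\<forall>q\<in>T. R p q)" if p: "p \<in> \<Omega>" for p
    proof -
      obtain e where e: "e > 0" "ball p e \<subseteq> \<Omega>" using \<Omega>(1) p open_contains_ball by blast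
      have "R p q" if q: "q \<in> ball p e" for q
        unfolding R_def
      proof (intro ballI impI)
        fix E E' assume *: "E \<in> \<T>" "E' \<in> \<T>" "p \<in> E" "q \<in> E'"
        show "b E = b E'"
        proof (rule local_connectivity[where b=b and E=E and E'=E', OF subset_refl open_ball convex_ball])
          show "ball p e \<subseteq> \<Union>\<T>" using e(2) \<Omega>(3) by blast
          show "E \<inter> ball p e \<noteq> {}" using *(3) e(1) by force
          show "E' \<inter> ball p e \<noteq> {}" using *(4) q by blast
          show "b E1 = b E2" if "adjacent E1 a1 E2 a2" for E1 a1 E2 a2 by (rule inv[OF that])
        qed (use *(1,2) in blast)+
      qed
      then show ?thesis
        using e \<Omega>(1) by (intro exI[of _ "ball p e"]) (auto simp: open_subset)
    qed
  qed
  then show ?thesis using x E E' unfolding R_def by blast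
qed

text \<open>A segment in general position that leaves the mesh does so through the relative interior of a
  facet. That facet belongs to one element only, and this is inherited by all points in its relative
  interior, which are therefore boundary points of the mesh.\<close>

lemma boundary_facet_near:
  assumes B: "open B" "convex B" and E0: "E0 \<in> \<T>" "E0 \<inter> B \<noteq> {}" and out: "B - \<Union>\<T> \<noteq> {}"
  obtains E a where "E \<in> \<T>" "a \<in> vert E" "convex hull (vert E - {a}) \<inter> B \<noteq> {}"
    "convex hull (vert E - {a}) \<subseteq> frontier (\<Union>\<T>)"
proof -
  have cl: "closed (\<Union>\<T>)" by (rule closed_Union_elements) simp
  obtain x where x: "x \<in> interior E0" "x \<in> B" using element_meets_open[OF E0(1) B(1) E0(2)] by blast
  define \<K> where "\<K> = {K. \<exists>E\<in>\<T>. K \<subseteq> vert E \<and> card K < CARD('d)}"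
  have "\<K> \<subseteq> (\<Union>E\<in>\<T>. Pow (vert E))" unfolding \<K>_def by auto
  then have fin: "finite \<K>" by (rule finite_subset) auto
  have x_notin: "x \<notin> convex hull K" if K: "K \<in> \<K>" for K
  proof
    assume xK: "x \<in> convex hull K"
    obtain E1 where E1: "E1 \<in> \<T>" "K \<subseteq> vert E1" "card K < CARD('d)" using K unfolding \<K>_def by blast
    then have "x \<in> E1" using xK hull_mono[of K "vert E1" convex] hull_vert by blast
    then have "E0 = E1" using interior_disjoint[OF E0(1) E1(1) x(1)] by simp
    interpret full_simplex "vert E0" by (rule vert_simplex[OF E0(1)])
    have "K \<noteq> vert E0" using E1(3) card_vert[OF E0(1)] by auto
    then obtain c where c: "c \<in> vert E0" "c \<notin> K" using E1(2) \<open>E0 = E1\<close> by blast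
    then have "bary (vert E0) c x = 0"
      using convex_hull_subset_bary[of K] xK E1(2) \<open>E0 = E1\<close> by blast
    moreover have "bary (vert E0) c x > 0"
      using x(1) c(1) interior_convex_hull_bary hull_vert[OF E0(1)] by auto
    ultimately show False by simp
  qed
  have W: "open (B - \<Union>\<T>)" using B(1) cl by (rule open_Diff)
  obtain y where y: "y \<in> B - \<Union>\<T>" "\<And>K. K \<in> \<K> \<Longrightarrow> closed_segment x y \<inter> convex hull K = {}"
  proof (rule generic_segment_endpoint[OF fin _ x_notin W out])
    show "finite K \<and> card K < CARD('d)" if "K \<in> \<K>" for K
      using that finite_subset[OF _ finite_vert] unfolding \<K>_def by blast
  qed blast+
  have "closed_segment x y \<inter> frontier (\<Union>\<T>) \<noteq> {}"
  proof (rule connected_Int_frontier)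
    show "closed_segment x y \<inter> \<Union>\<T> \<noteq> {}" using x(1) interior_subset E0(1) by auto
    show "closed_segment x y - \<Union>\<T> \<noteq> {}" using y(1) by auto
  qed simp
  then obtain w where w: "w \<in> closed_segment x y" "w \<in> frontier (\<Union>\<T>)" by blast
  then have wB: "w \<in> B" using x(2) y(1) B(2) closed_segment_subset[of x B y] by blast
  have w_in: "w \<in> \<Union>\<T>" "w \<notin> interior (\<Union>\<T>)" using w(2) cl by (auto simp: frontier_def)
  then obtain E where E: "E \<in> \<T>" "w \<in> E" by blast
  interpret full_simplex "vert E" by (rule vert_simplex[OF E(1)])
  note hE = hull_vert[OF E(1)]
  have int_sub: "interior E \<subseteq> interior (\<Union>\<T>)" using E(1) by (intro interior_mono) blast
  have nn: "0 \<le> bary (vert E) c w" if "c \<in> vert E" for c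
    using convex_hull_bary hE E(2) that by auto
  have "w \<notin> interior E" using w_in(2) int_sub by blast
  then obtain a where a: "a \<in> vert E" "\<not> 0 < bary (vert E) a w"
    using interior_convex_hull_bary hE by auto
  with nn have wa: "bary (vert E) a w = 0" by force
  have wpos: "0 < bary (vert E) c w" if c: "c \<in> vert E - {a}" for c
  proof (rule ccontr)
    assume "\<not> 0 < bary (vert E) c w"
    then have wc: "bary (vert E) c w = 0" using nn[of c] c by simp
    have "w \<in> convex hull (vert E - {a, c})"
      using wa wc E(2) hE by (subst convex_hull_subset_bary) auto
    moreover have "card (vert E - {a, c}) < CARD('d)"
      using a(1) c card_vert[OF E(1)] by (subst card_Diff_subset) auto
    then have "vert E - {a, c} \<in> \<K>" unfolding \<K>_def using E(1) by blast
    ultimately show False using y(2) w(1) by blast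
  qed
  have wF: "w \<in> convex hull (vert E - {a})"
    using wa E(2) hE by (subst convex_hull_subset_bary) auto
  \<comment> \<open>A second element containing the facet would make \<open>w\<close> an interior point of the mesh.\<close>
  have single: "E' = E" if E': "E' \<in> \<T>" "vert E - {a} \<subseteq> vert E'" for E'
  proof (rule ccontr)
    assume ne: "E' \<noteq> E"
    have "CARD('d) \<le> card (vert E - {a})" using a(1) card_vert[OF E(1)] by simp
    also have "\<dots> \<le> card (vert E \<inter> vert E')" using that by (intro card_mono) auto
    finally obtain b b' where bb: "adjacent E b E' b'" using adjacentI[OF E(1) E'(1)] ne by metis
    note an = adjacent_apex_notin[OF bb]
    have "b = a" using an(1,3) E'(2) a(1) bb by (auto simp: adjacent_def)
    interpret P: facet_pair "vert E" "vert E'" a b' using adjacent_facet_pair[OF bb] by (simp add: \<open>b = a\<close>)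
    have "convex hull (vert E) \<inter> convex hull (vert E') = convex hull (vert E - {a})"
      using Int_elements[OF E(1) E'(1)] an(3) by (simp add: hE hull_vert[OF E'(1)] \<open>b = a\<close>)
    from P.interior_union[OF this wa wpos] have "w \<in> interior (E \<union> E')"
      by (simp add: hE hull_vert[OF E'(1)])
    then have "w \<in> interior (\<Union>\<T>)"
      using E(1) E'(1) by (elim subsetD[rotated]) (intro interior_mono, blast)
    with w_in(2) show False by simp
  qed
  have "convex hull (vert E - {a}) \<subseteq> frontier (\<Union>\<T>)"
  proof
    fix p assume p: "p \<in> convex hull (vert E - {a})"
    have pE: "p \<in> E" using p hull_mono[of "vert E - {a}" "vert E" convex] hE by blast
    have pa: "bary (vert E) a p = 0" using p a(1) convex_hull_subset_bary[of "vert E - {a}"] by blast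
    define q where "q n = (1 - inverse (real (Suc n))) *\<^sub>R p + inverse (real (Suc n)) *\<^sub>R w" for n
    have q_front: "q n \<in> frontier (\<Union>\<T>)" for n
    proof -
      define e where "e = inverse (real (Suc n))"
      have e: "0 < e" "e \<le> 1" by (auto simp: e_def inverse_le_1_iff)
      have qn: "q n = (1 - e) *\<^sub>R p + e *\<^sub>R w" by (simp add: q_def e_def)
      have qa: "bary (vert E) a (q n) = 0" by (simp add: qn bary_combo pa wa)
      have qpos: "0 < bary (vert E) c (q n)" if c: "c \<in> vert E - {a}" for c
        using c e wpos[OF c] pE convex_hull_bary hE
        by (auto simp: qn bary_combo intro!: add_nonneg_pos mult_nonneg_nonneg mult_pos_pos)
      have qE: "q n \<in> E"
        unfolding qn using convex_element[OF E(1)] pE E(2) e by (intro convexD_alt) auto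
      have "q n \<notin> interior (\<Union>\<T>)"
      proof
        assume "q n \<in> interior (\<Union>\<T>)"
        moreover have "q n \<notin> E'" if E': "E' \<in> \<T> - {E}" for E'
        proof
          assume "q n \<in> E'"
          then have "q n \<in> convex hull (vert E \<inter> vert E')" using qE Int_elements[of E E'] E(1) E' by blast
          then have "\<forall>c\<in>vert E - vert E'. bary (vert E) c (q n) = 0"
            using convex_hull_subset_bary[of "vert E \<inter> vert E'"] by blast
          then have "vert E - {a} \<subseteq> vert E'" using qpos by (metis DiffD1 DiffI less_irrefl subsetI)
          then show False using single[of E'] E' by blast
        qed
        then have "q n \<notin> \<Union>(\<T> - {E})" by blast
        moreover have "open (interior (\<Union>\<T>) - \<Union>(\<T> - {E}))"
          by (intro open_Diff closed_Union_elements) auto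
        moreover have "interior (\<Union>\<T>) - \<Union>(\<T> - {E}) \<subseteq> E"
          using interior_subset by blast
        ultimately have "q n \<in> interior E" by (meson DiffI interiorI)
        then show False using qa a(1) interior_convex_hull_bary hE by fastforce
      qed
      then show ?thesis using qE E(1) by (auto simp: frontier_def closure_closed[OF cl])
    qed
    have "q \<longlonglongrightarrow> (1 - 0) *\<^sub>R p + 0 *\<^sub>R w"
      unfolding q_def by (intro tendsto_intros LIMSEQ_inverse_real_of_nat)
    then have "q \<longlonglongrightarrow> p" by simp
    with q_front show "p \<in> frontier (\<Union>\<T>)"
      using closed_sequentially[OF frontier_closed, of q] by blast
  qed
  with that E(1) a(1) wF wB show ?thesis by blast
qed

end

section \<open>Stars of interior edges\<close>

lemma ex_orthogonal_not_in_span: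
  fixes n e :: "real^'d"
  assumes "CARD('d) \<ge> 3"
  obtains u where "n \<bullet> u = 0" "u \<notin> span {e}"
proof -
  have "\<not> {u. n \<bullet> u = 0} \<subseteq> span {e}"
  proof
    assume sub: "{u. n \<bullet> u = 0} \<subseteq> span {e}"
    have "dim {u. n \<bullet> u = 0} \<ge> CARD('d) - 1"
      by (cases "n = 0") (simp_all add: dim_hyperplane)
    moreover have "dim {u. n \<bullet> u = 0} \<le> dim {e}" using sub dim_subset[of _ "span {e}"] by simp
    moreover have "dim {e} \<le> 1" using dim_le_card'[of "{e}"] by simp
    ultimately show False using assms by linarith
  qed
  with that show ?thesis by blast
qed

context simplicial_mesh
begin

definition edge_star :: "real^'d \<Rightarrow> real^'d \<Rightarrow> (real^'d) set set" where
  "edge_star r r' = {E \<in> \<T>. r \<in> vert E \<and> r' \<in> vert E}"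

text \<open>Near its end \<open>r\<close> the edge runs in the interior of the mesh, and the elements that contain a relative
  interior point of an edge are those that contain the whole edge.\<close>

lemma edge_star_neighbourhood:
  assumes "r \<noteq> r'" "edge_star r r' \<noteq> {}" and r: "r \<in> interior (\<Union>\<T>)"
  obtains t e where "0 < t" "t < 1" "0 < e" "ball (r + t *\<^sub>R (r' - r)) e \<subseteq> \<Union>(edge_star r r')"
proof -
  obtain E0 where E0: "E0 \<in> \<T>" "r \<in> vert E0" "r' \<in> vert E0" using assms(2) by (auto simp: edge_star_def)
  obtain t where t: "0 < t" "t < 1" "r + t *\<^sub>R (r' - r) \<in> interior (\<Union>\<T>)"
    by (rule small_step_in_open[OF open_interior r])
  define p where "p = r + t *\<^sub>R (r' - r)"
  interpret full_simplex "vert E0" by (rule vert_simplex[OF E0(1)])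
  have bp: "bary (vert E0) r p = 1 - t" "bary (vert E0) r' p = t"
    unfolding p_def using edge_point[OF E0(2,3) assms(1)] E0 assms(1) by auto
  have bpc: "0 \<le> bary (vert E0) c p" if "c \<in> vert E0" for c
    unfolding p_def using edge_point[OF E0(2,3) assms(1) that] t by auto
  have pE0: "p \<in> E0" using bpc convex_hull_bary hull_vert[OF E0(1)] by auto
  have star: "E \<in> edge_star r r'" if E: "E \<in> \<T>" "p \<in> E" for E
  proof -
    have "p \<in> convex hull (vert E0 \<inter> vert E)" using Int_elements[OF E0(1) E(1)] pE0 E(2) by blast
    then have "\<forall>c\<in>vert E0 - vert E. bary (vert E0) c p = 0"
      using convex_hull_subset_bary[of "vert E0 \<inter> vert E"] by blast
    then have "r \<in> vert E" "r' \<in> vert E" using bp t E0 by force+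
    then show ?thesis using E by (simp add: edge_star_def)
  qed
  let ?U = "interior (\<Union>\<T>) - \<Union>{E \<in> \<T>. p \<notin> E}"
  have "open ?U" by (intro open_Diff closed_Union_elements) auto
  moreover have "p \<in> ?U" using t(3) by (auto simp: p_def)
  ultimately obtain e where e: "e > 0" "ball p e \<subseteq> ?U" using open_contains_ball by blast
  have "?U \<subseteq> \<Union>(edge_star r r')"
  proof
    fix x assume x: "x \<in> ?U"
    then obtain E where "E \<in> \<T>" "x \<in> E" using interior_subset by blast
    with x have "p \<in> E" by blast
    with star \<open>E \<in> \<T>\<close> \<open>x \<in> E\<close> show "x \<in> \<Union>(edge_star r r')" by blast
  qed
  with e that[OF t(1,2)] show ?thesis unfolding p_def by blast
qed

lemma edge_star_contains:
  assumes "r \<noteq> r'" "E \<in> edge_star r r'" "0 < t" "t < 1"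
  shows "r + t *\<^sub>R (r' - r) \<in> E"
proof -
  have E: "E \<in> \<T>" "r \<in> vert E" "r' \<in> vert E" using assms(2) by (auto simp: edge_star_def)
  interpret full_simplex "vert E" by (rule vert_simplex[OF E(1)])
  have "0 \<le> bary (vert E) c (r + t *\<^sub>R (r' - r))" if "c \<in> vert E" for c
    using edge_point[OF E(2,3) assms(1) that] assms(3,4) by auto
  then show ?thesis using convex_hull_bary hull_vert[OF E(1)] by auto
qed

lemma edge_star_connectivity:
  assumes rr: "r \<noteq> r'" and r: "r \<in> interior (\<Union>\<T>)"
    and inv: "\<And>E a E' a'. E \<in> edge_star r r' \<Longrightarrow> E' \<in> edge_star r r' \<Longrightarrow> adjacent E a E' a' \<Longrightarrow> b E = b E'"
    and E: "E \<in> edge_star r r'" "E' \<in> edge_star r r'"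
  shows "b E = b E'"
proof -
  have "edge_star r r' \<noteq> {}" using E by blast
  then obtain t e where t: "0 < t" "t < 1" "0 < e" "ball (r + t *\<^sub>R (r' - r)) e \<subseteq> \<Union>(edge_star r r')"
    using edge_star_neighbourhood[OF rr _ r] by metis
  have meets: "S \<inter> ball (r + t *\<^sub>R (r' - r)) e \<noteq> {}" if "S \<in> edge_star r r'" for S
    using edge_star_contains[OF rr that t(1,2)] t(3) centre_in_ball[of "r + t *\<^sub>R (r' - r)" e] by blast
  show ?thesis
  proof (rule local_connectivity[where b=b and E=E and E'=E' and \<S>="edge_star r r'", OF _ open_ball convex_ball t(4)])
    show "edge_star r r' \<subseteq> \<T>" by (auto simp: edge_star_def)
    show "b E1 = b E2" if "E1 \<in> edge_star r r'" "E2 \<in> edge_star r r'" "adjacent E1 a1 E2 a2" for E1 a1 E2 a2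
      by (rule inv[OF that])
  qed (use E meets in blast)+
qed

text \<open>In two dimensions a star element has a single vertex off the edge, which cannot be on both sides of
  the line \<open>f = 0\<close>. In three dimensions the hypothesis says that, seen along the edge, the link is a
  closed polygon whose vertices alternate between two levels of \<open>f\<close>, one positive and one negative.
  Near the edge, each element then contains one of the two half planes of \<open>f = 0\<close> bounded by the edge
  in its interior, so there are at most two elements, too few to surround the edge.\<close>

lemma no_two_level_link:
  assumes d: "CARD('d) \<in> {2, 3}"
    and rr: "r \<noteq> r'" and star: "edge_star r r' \<noteq> {}" and r: "r \<in> interior (\<Union>\<T>)"
    and \<nu>: "\<nu> \<noteq> 0" "\<nu> \<bullet> (r' - r) = 0"
    and level: "\<And>E a E' a'. E \<in> edge_star r r' \<Longrightarrow> E' \<in> edge_star r r' \<Longrightarrow> adjacent E a E' a' \<Longrightarrow> \<nu> \<bullet> a = \<nu> \<bullet> a'"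
  shows False
proof -
  let ?S = "edge_star r r'"
  have ST: "E \<in> \<T>" "r \<in> vert E" "r' \<in> vert E" if "E \<in> ?S" for E
    using that by (auto simp: edge_star_def)
  define f where "f x = \<nu> \<bullet> (x - r)" for x
  have f_rr: "f r = 0" "f r' = 0" using \<nu>(2) by (simp_all add: f_def)
  have f_const: "f ` vert E = f ` vert E'" if "E \<in> ?S" "E' \<in> ?S" for E E'
  proof (rule edge_star_connectivity[OF rr r _ that, of "\<lambda>E. f ` vert E"])
    fix E a E' a' assume *: "E \<in> ?S" "E' \<in> ?S" "adjacent E a E' a'"
    have "f a = f a'" using level[OF *] by (simp add: f_def inner_diff_right)
    moreover have "vert E = insert a (vert E - {a})" "vert E' = insert a' (vert E - {a})"
      using *(3) by (auto simp: adjacent_def)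
    ultimately show "f ` vert E = f ` vert E'" by (metis image_insert)
  qed
  obtain t e where t: "0 < t" "t < 1" "0 < e" "ball (r + t *\<^sub>R (r' - r)) e \<subseteq> \<Union>?S"
    using edge_star_neighbourhood[OF rr star r] by metis
  define p where "p = r + t *\<^sub>R (r' - r)"
  have fp: "f p = 0" using \<nu>(2) by (simp add: f_def p_def)
  have bary_p: "bary (vert E) c p = (if c = r then 1 - t else if c = r' then t else 0)"
    if "E \<in> ?S" "c \<in> vert E" for E c
    unfolding p_def
    by (rule full_simplex.edge_point[OF vert_simplex[OF ST(1)[OF that(1)]] ST(2)[OF that(1)] ST(3)[OF that(1)] rr that(2)])
  \<comment> \<open>Every direction at the point \<open>p\<close> of the edge points into some element of the star.\<close>
  have covered: "\<exists>E\<in>?S. \<exists>\<epsilon>>0. p + \<epsilon> *\<^sub>R z \<in> E" for z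
  proof -
    obtain \<epsilon> where "0 < \<epsilon>" "p + \<epsilon> *\<^sub>R z \<in> ball p e"
      using small_step_in_open[of "ball p e" p z] t(3) by auto
    with t(4) show ?thesis unfolding p_def by blast
  qed
  have grad_nonneg: "0 \<le> bary_grad (vert E) c \<bullet> z"
    if "E \<in> ?S" "\<epsilon> > 0" "p + \<epsilon> *\<^sub>R z \<in> E" "c \<in> vert E - {r, r'}" for E \<epsilon> z c
  proof -
    have "0 \<le> bary (vert E) c (p + \<epsilon> *\<^sub>R z)"
      using full_simplex.convex_hull_bary[OF vert_simplex[OF ST(1)[OF that(1)]]] hull_vert[OF ST(1)[OF that(1)]] that by auto
    also have "\<dots> = \<epsilon> * (bary_grad (vert E) c \<bullet> z)"
      using bary_p[OF that(1), of c] that(4) by (simp add: bary_add)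
    finally show ?thesis using that(2) by (simp add: zero_le_mult_iff)
  qed
  have f_dir: "\<nu> \<bullet> z = (\<Sum>c\<in>vert E. (bary_grad (vert E) c \<bullet> z) * f c)" if "E \<in> ?S" for E z
  proof -
    interpret full_simplex "vert E" by (rule vert_simplex[OF ST(1)[OF that]])
    have "\<nu> \<bullet> z = \<nu> \<bullet> (\<Sum>c\<in>vert E. (bary_grad (vert E) c \<bullet> z) *\<^sub>R c)" by (simp only: sum_bary_grad_scaleR)
    also have "\<dots> = (\<Sum>c\<in>vert E. (bary_grad (vert E) c \<bullet> z) * (\<nu> \<bullet> c))" by (simp add: inner_sum_right)
    also have "\<dots> = (\<Sum>c\<in>vert E. (bary_grad (vert E) c \<bullet> z) * f c) + (\<Sum>c\<in>vert E. bary_grad (vert E) c \<bullet> z) * (\<nu> \<bullet> r)"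
      by (simp add: f_def inner_diff_right right_diff_distrib sum_subtractf sum_distrib_right)
    finally show ?thesis by (simp add: sum_bary_grad)
  qed
  \<comment> \<open>The star covers a neighbourhood of \<open>p\<close>, so that both signs of \<open>f\<close> occur, hence occur in each element.\<close>
  have ex_sign: "\<exists>E\<in>?S. \<exists>c\<in>vert E. 0 < s * f c" if s: "s = 1 \<or> s = -1" for s :: real
  proof -
    obtain E \<epsilon> where E: "E \<in> ?S" "\<epsilon> > 0" "p + \<epsilon> *\<^sub>R (s *\<^sub>R \<nu>) \<in> E" using covered by blast
    show ?thesis
    proof (rule ccontr)
      assume "\<not> ?thesis"
      then have neg: "s * f c \<le> 0" if "c \<in> vert E" for c using E(1) that by force
      have "(bary_grad (vert E) c \<bullet> (s *\<^sub>R \<nu>)) * (s * f c) \<le> 0" if c: "c \<in> vert E" for c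
      proof (cases "c \<in> {r, r'}")
        case False
        then have "0 \<le> bary_grad (vert E) c \<bullet> (s *\<^sub>R \<nu>)" using c by (intro grad_nonneg[OF E]) simp
        then show ?thesis using neg[OF c] by (rule mult_nonneg_nonpos)
      qed (use f_rr in auto)
      then have "(\<Sum>c\<in>vert E. (bary_grad (vert E) c \<bullet> (s *\<^sub>R \<nu>)) * (s * f c)) \<le> 0"
        by (rule sum_nonpos)
      moreover have "(\<Sum>c\<in>vert E. (bary_grad (vert E) c \<bullet> (s *\<^sub>R \<nu>)) * (s * f c)) = s * (\<nu> \<bullet> (s *\<^sub>R \<nu>))"
        unfolding f_dir[OF E(1), of "s *\<^sub>R \<nu>"] sum_distrib_left by (intro sum.cong) auto
      moreover have "s * (\<nu> \<bullet> (s *\<^sub>R \<nu>)) = \<nu> \<bullet> \<nu>" using s by auto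
      ultimately have "\<nu> \<bullet> \<nu> \<le> 0" by linarith
      then show False using \<nu>(1) by (metis inner_gt_zero_iff not_less)
    qed
  qed
  have both: "\<exists>c\<in>vert E. \<exists>c'\<in>vert E. 0 < f c \<and> f c' < 0" if E: "E \<in> ?S" for E
  proof -
    obtain E1 c1 where 1: "E1 \<in> ?S" "c1 \<in> vert E1" "0 < f c1" using ex_sign[of 1] by auto
    obtain E2 c2 where 2: "E2 \<in> ?S" "c2 \<in> vert E2" "f c2 < 0" using ex_sign[of "-1"] by auto
    have "f c1 \<in> f ` vert E" using 1 f_const[OF E 1(1)] by simp
    moreover have "f c2 \<in> f ` vert E" using 2 f_const[OF E 2(1)] by simp
    ultimately show ?thesis using 1(3) 2(3) by (metis imageE)
  qed
  then obtain P N where PN: "\<And>E. E \<in> ?S \<Longrightarrow> P E \<in> vert E" "\<And>E. E \<in> ?S \<Longrightarrow> N E \<in> vert E"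
    "\<And>E. E \<in> ?S \<Longrightarrow> 0 < f (P E)" "\<And>E. E \<in> ?S \<Longrightarrow> f (N E) < 0" by metis
  have distinct: "P E \<noteq> r" "P E \<noteq> r'" "N E \<noteq> r" "N E \<noteq> r'" "P E \<noteq> N E" if "E \<in> ?S" for E
    using PN(3,4)[OF that] f_rr by auto
  have sub4: "{r, r', P E, N E} \<subseteq> vert E" "card {r, r', P E, N E} = 4" if "E \<in> ?S" for E
    using ST[OF that] PN(1,2)[OF that] distinct[OF that] rr by auto
  obtain Es where Es: "Es \<in> ?S" using star by blast
  have "4 \<le> CARD('d) + 1"
    using card_mono[OF finite_vert sub4(1)[OF Es]] sub4(2)[OF Es] card_vert ST(1)[OF Es] by simp
  then have d3: "CARD('d) = 3" using d by auto
  have vertE: "vert E = {r, r', P E, N E}" if E: "E \<in> ?S" for E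
    using card_subset_eq[OF finite_vert[OF ST(1)[OF E]] sub4(1)[OF E]] sub4(2)[OF E] card_vert[OF ST(1)[OF E]] d3 by simp
  have parallel: "z \<in> span {r' - r}"
    if "E \<in> ?S" "bary_grad (vert E) (P E) \<bullet> z = 0" "bary_grad (vert E) (N E) \<bullet> z = 0" for E z
    using that full_simplex.parallel_to_edge[OF vert_simplex[OF ST(1)[OF that(1)]] ST(2,3)[OF that(1)] rr, of z]
      vertE[OF that(1)] by auto
  \<comment> \<open>A direction \<open>z\<close> inside the plane \<open>f = 0\<close>, transverse to the edge, is interior to each element up to sign.\<close>
  obtain z where z: "\<nu> \<bullet> z = 0" "z \<notin> span {r' - r}" using ex_orthogonal_not_in_span[of \<nu> "r' - r"] d3 by auto
  define g where "g E = bary_grad (vert E) (P E) \<bullet> z" for E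
  define h where "h E = bary_grad (vert E) (N E) \<bullet> z" for E
  have gh: "g E * f (P E) + h E * f (N E) = 0" if E: "E \<in> ?S" for E
  proof -
    have "(\<Sum>c\<in>vert E. (bary_grad (vert E) c \<bullet> z) * f c) = g E * f (P E) + h E * f (N E)"
      by (subst (2) vertE[OF E]) (use distinct[OF E] rr f_rr in \<open>simp add: g_def h_def\<close>)
    then show ?thesis using f_dir[OF E, of z] z(1) by simp
  qed
  have sgn: "(0 < g E \<and> 0 < h E) \<or> (g E < 0 \<and> h E < 0)" if E: "E \<in> ?S" for E
  proof -
    have "\<not> (g E = 0 \<and> h E = 0)" using parallel[OF E, of z] z(2) by (auto simp: g_def h_def)
    moreover have "g E * f (P E) = h E * (- f (N E))" using gh[OF E] by simp
    ultimately show ?thesis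
      using PN(3,4)[OF E]
      by (smt (verit) mult_eq_0_iff mult_neg_pos mult_pos_pos)
  qed
  have unique: "E = E'" if E: "E \<in> ?S" and E': "E' \<in> ?S"
    and sE: "0 < s * g E" "0 < s * h E" and sE': "0 < s * g E'" "0 < s * h E'" for E E' and s :: real
  proof -
    define W where "W = (\<Inter>S\<in>{E, E'}. \<Inter>c\<in>{r, r'}. {x. 0 < bary (vert S) c x})"
    have "open W" unfolding W_def by (intro open_INT ballI open_Collect_less continuous_intros) auto
    moreover have "p \<in> W" unfolding W_def using bary_p[OF E] bary_p[OF E'] ST[OF E] ST[OF E'] t(1,2) by auto
    ultimately obtain \<epsilon> where \<epsilon>: "0 < \<epsilon>" "p + \<epsilon> *\<^sub>R (s *\<^sub>R z) \<in> W" using small_step_in_open by metis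
    have "p + \<epsilon> *\<^sub>R (s *\<^sub>R z) \<in> interior S" if S: "S \<in> {E, E'}" for S
    proof -
      have SS: "S \<in> ?S" "0 < s * g S" "0 < s * h S" using S E E' sE sE' by auto
      have "0 < bary (vert S) c (p + \<epsilon> *\<^sub>R (s *\<^sub>R z))" if c: "c \<in> vert S" for c
      proof (cases "c \<in> {r, r'}")
        case True
        then show ?thesis using \<epsilon>(2) S unfolding W_def by blast
      next
        case False
        then have "bary (vert S) c (p + \<epsilon> *\<^sub>R (s *\<^sub>R z)) = \<epsilon> * (s * (bary_grad (vert S) c \<bullet> z))"
          using bary_p[OF SS(1) c] by (simp add: bary_add)
        moreover have "c = P S \<or> c = N S" using False c vertE[OF SS(1)] by auto
        then have "0 < s * (bary_grad (vert S) c \<bullet> z)" using SS(2,3) by (auto simp: g_def h_def)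
        ultimately show ?thesis using \<epsilon>(1) by simp
      qed
      then show ?thesis
        using full_simplex.interior_convex_hull_bary[OF vert_simplex[OF ST(1)[OF SS(1)]]]
          hull_vert[OF ST(1)[OF SS(1)]] by auto
    qed
    from this[of E] this[of E'] have "p + \<epsilon> *\<^sub>R (s *\<^sub>R z) \<in> interior E" "p + \<epsilon> *\<^sub>R (s *\<^sub>R z) \<in> interior E'"
      by simp_all
    then show ?thesis
      by (intro interior_disjoint[OF ST(1)[OF E] ST(1)[OF E']]) (auto intro: subsetD[OF interior_subset])
  qed
  \<comment> \<open>So the star has at most two elements, one for each sign, and two wedges cannot surround the edge.\<close>
  obtain E1 E2 where E12: "E1 \<in> ?S" "E2 \<in> ?S" "?S \<subseteq> {E1, E2}"
  proof -
    have uniq1: "E = E'" if "E \<in> ?S" "E' \<in> ?S" "0 < g E" "0 < g E'" for E E'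
      using unique[of E E' 1] sgn[OF that(1)] sgn[OF that(2)] that by auto
    have uniq2: "E = E'" if "E \<in> ?S" "E' \<in> ?S" "\<not> 0 < g E" "\<not> 0 < g E'" for E E'
      using unique[of E E' "-1"] sgn[OF that(1)] sgn[OF that(2)] that by auto
    show ?thesis
    proof (cases "\<exists>E'\<in>?S. (0 < g E') \<noteq> (0 < g Es)")
      case True
      then obtain E' where E': "E' \<in> ?S" "(0 < g E') \<noteq> (0 < g Es)" by blast
      have "?S \<subseteq> {Es, E'}" using uniq1 uniq2 Es E' by blast
      with Es E'(1) that show ?thesis by blast
    next
      case False
      have "?S \<subseteq> {Es, Es}" using uniq1 uniq2 Es False by blast
      with Es that show ?thesis by blast
    qed
  qed
  define n where "n E = bary_grad (vert E) (P E) + bary_grad (vert E) (N E)" for E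
  obtain u0 where u0: "n E1 \<bullet> u0 = 0" "u0 \<notin> span {r' - r}" using ex_orthogonal_not_in_span[of "n E1" "r' - r"] d3 by auto
  define u where "u = (if n E2 \<bullet> u0 \<le> 0 then u0 else - u0)"
  have u: "n E1 \<bullet> u \<le> 0" "n E2 \<bullet> u \<le> 0" "u \<notin> span {r' - r}"
    using u0 span_neg[of "- u0" "{r' - r}"] by (auto simp: u_def)
  obtain E \<epsilon> where E: "E \<in> ?S" "\<epsilon> > 0" "p + \<epsilon> *\<^sub>R u \<in> E" using covered by blast
  have "n E \<bullet> u \<le> 0" using E12(3) E(1) u(1,2) by blast
  moreover have "0 \<le> bary_grad (vert E) (P E) \<bullet> u" "0 \<le> bary_grad (vert E) (N E) \<bullet> u"
    using grad_nonneg[OF E] PN(1,2)[OF E(1)] distinct[OF E(1)] by auto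
  ultimately have "u \<in> span {r' - r}"
    by (intro parallel[OF E(1)]) (auto simp: n_def inner_add_left)
  with u(3) show False by simp
qed

end

section \<open>Discrete rigid displacements\<close>

lemma matrix_vector_minus_left: "(- A) *v x = - (A *v x)" for A :: "real^'n^'m"
  using matrix_vector_mult_diff_rdistrib[of 0 A x] by simp

lemma skew_inner:
  fixes \<Gamma> :: "real^'n^'n"
  assumes "transpose \<Gamma> = - \<Gamma>"
  shows "(\<Gamma> *v x) \<bullet> y = - (x \<bullet> (\<Gamma> *v y))"
proof -
  have "x \<bullet> (\<Gamma> *v y) = (transpose \<Gamma> *v x) \<bullet> y"
    by (metis dot_lmul_matrix transpose_matrix_vector)
  then show ?thesis by (simp only: assms matrix_vector_minus_left inner_minus_left minus_minus)
qed

text \<open>A skew matrix has even rank, so it cannot have rank one.\<close>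

lemma skew_kills_hyperplane_imp_zero:
  fixes G :: "real^'n^'n"
  assumes skew: "transpose G = - G" and "n \<noteq> 0" and kill: "\<And>z. n \<bullet> z = 0 \<Longrightarrow> G *v z = 0"
  shows "G = 0"
proof -
  have "(G *v n) \<bullet> n = 0" using skew_inner[OF skew, of n n] by (simp add: inner_commute)
  then have "G *v (G *v n) = 0" by (intro kill) (simp add: inner_commute)
  then have "(G *v n) \<bullet> (G *v n) = 0" using skew_inner[OF skew, of n "G *v n"] by simp
  then have Gn: "G *v n = 0" by simp
  have "G *v x = 0" for x
  proof -
    define t where "t = (n \<bullet> x) / (n \<bullet> n)"
    have "n \<bullet> (x - t *\<^sub>R n) = 0" using \<open>n \<noteq> 0\<close> by (simp add: t_def inner_diff_right)
    then have "G *v (x - t *\<^sub>R n) = 0" by (rule kill)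
    then show ?thesis by (simp add: matrix_vector_mult_diff_distrib matrix_vector_mult_scaleR Gn)
  qed
  then show ?thesis by (simp add: matrix_eq)
qed

lemma (in full_simplex) linear_constant_on_facet_imp_zero:
  fixes G :: "'a \<Rightarrow> 'b::real_vector"
  assumes a: "a \<in> C" and G: "linear G" and const: "\<And>r r'. r \<in> C - {a} \<Longrightarrow> r' \<in> C - {a} \<Longrightarrow> G r = G r'"
    and z: "bary_grad C a \<bullet> z = 0"
  shows "G z = 0"
proof -
  define k where "k c = bary_grad C c \<bullet> z" for c
  have "(\<Sum>c\<in>C. k c *\<^sub>R c) = z" "(\<Sum>c\<in>C. k c) = 0"
    by (simp_all add: k_def sum_bary_grad sum_bary_grad_scaleR)
  then have z_eq: "(\<Sum>c\<in>C - {a}. k c *\<^sub>R c) = z" and k0: "(\<Sum>c\<in>C - {a}. k c) = 0"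
    using a z by (simp_all add: sum.remove[of C a] k_def)
  have "G z = (\<Sum>c\<in>C - {a}. k c *\<^sub>R G c)"
    unfolding z_eq[symmetric] by (simp add: linear_sum[OF G] linear_scale[OF G])
  also have "\<dots> = 0"
  proof (cases "C - {a} = {}")
    case False
    then obtain r where r: "r \<in> C - {a}" by blast
    have "(\<Sum>c\<in>C - {a}. k c *\<^sub>R G c) = (\<Sum>c\<in>C - {a}. k c *\<^sub>R G r)"
      using const[OF _ r] by (intro sum.cong) auto
    then show ?thesis by (simp only: scaleR_left.sum[symmetric] k0 scaleR_zero_left)
  qed (simp only: sum.empty)
  finally show ?thesis .
qed

context simplicial_mesh
begin

lemma facet_nonempty:
  assumes "E \<in> \<T>" "a \<in> vert E"
  obtains r where "r \<in> vert E - {a}"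
proof -
  have "card (vert E - {a}) = CARD('d)" using assms card_vert[OF assms(1)] by simp
  then have "vert E - {a} \<noteq> {}" by (metis card.empty zero_less_card_finite less_irrefl)
  with that show ?thesis by blast
qed

text \<open>If the difference \<open>\<Gamma>\<close> of the two end values is nonzero, then the jump relations put the differences
  \<open>a - a'\<close> of opposite vertices around the edge into the kernel of \<open>\<Gamma>\<close>, and a vector in the range of \<open>\<Gamma>\<close>
  gives a linear functional that does not distinguish \<open>a\<close> from \<open>a'\<close>.\<close>

lemma rotation_constant_along_interior_edge:
  fixes \<gamma> :: "(real^'d) set \<Rightarrow> real^'d \<Rightarrow> real^'d^'d" and u :: "(real^'d) set \<Rightarrow> real^'d"
  assumes d: "CARD('d) \<in> {2, 3}"
    and skew: "\<And>E x. E \<in> \<T> \<Longrightarrow> transpose (\<gamma> E x) = - \<gamma> E x"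
    and cont: "\<And>E a E' a' r. adjacent E a E' a' \<Longrightarrow> r \<in> vert E - {a} \<Longrightarrow> \<gamma> E r = \<gamma> E' r"
    and jump: "\<And>E a E' a' r. adjacent E a E' a' \<Longrightarrow> r \<in> vert E - {a} \<Longrightarrow>
        u E - u E' = (1 / real (CARD('d) + 1)) *\<^sub>R (\<gamma> E r *v (a - a'))"
    and E0: "E0 \<in> \<T>" "r \<in> vert E0" "r' \<in> vert E0" and r: "r \<in> interior (\<Union>\<T>)"
  shows "\<gamma> E0 r = \<gamma> E0 r'"
proof (rule ccontr)
  assume ne: "\<gamma> E0 r \<noteq> \<gamma> E0 r'"
  then have rr: "r \<noteq> r'" by auto
  define \<Gamma> where "\<Gamma> = \<gamma> E0 r' - \<gamma> E0 r"
  have skew\<Gamma>: "transpose \<Gamma> = - \<Gamma>" by (simp add: \<Gamma>_def transpose_diff skew[OF E0(1)])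
  have E0_star: "E0 \<in> edge_star r r'" using E0 by (simp add: edge_star_def)
  have shared: "r \<in> vert E - {a}" "r' \<in> vert E - {a}"
    if "E \<in> edge_star r r'" "E' \<in> edge_star r r'" "adjacent E a E' a'" for E a E' a'
    using that adjacent_apex_notin[OF that(3)] by (auto simp: edge_star_def)
  have const: "(\<gamma> E r, \<gamma> E r') = (\<gamma> E0 r, \<gamma> E0 r')" if E: "E \<in> edge_star r r'" for E
  proof (rule edge_star_connectivity[OF rr r _ E E0_star, where b="\<lambda>E. (\<gamma> E r, \<gamma> E r')"])
    show "(\<gamma> E r, \<gamma> E r') = (\<gamma> E' r, \<gamma> E' r')"
      if "E \<in> edge_star r r'" "E' \<in> edge_star r r'" "adjacent E a E' a'" for E a E' a'
      using cont[OF that(3)] shared[OF that] by simp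
  qed
  have kernel: "\<Gamma> *v (a - a') = 0"
    if "E \<in> edge_star r r'" "E' \<in> edge_star r r'" "adjacent E a E' a'" for E a E' a'
  proof -
    have "(1 / real (CARD('d) + 1)) *\<^sub>R (\<gamma> E r *v (a - a')) = (1 / real (CARD('d) + 1)) *\<^sub>R (\<gamma> E r' *v (a - a'))"
      by (rule trans[OF sym[OF jump[OF that(3) shared(1)[OF that]]] jump[OF that(3) shared(2)[OF that]]])
    then have "\<gamma> E r *v (a - a') = \<gamma> E r' *v (a - a')" by (subst (asm) scaleR_cancel_left) auto
    then show ?thesis using const[OF that(1)] by (simp add: \<Gamma>_def matrix_vector_mult_diff_rdistrib)
  qed
  \<comment> \<open>A vector in the range of \<open>\<Gamma>\<close> is orthogonal to the kernel; skew-symmetry lets it also be chosen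
    orthogonal to the edge.\<close>
  obtain \<nu> \<eta> where \<nu>: "\<nu> = \<Gamma> *v \<eta>" "\<nu> \<noteq> 0" "\<nu> \<bullet> (r' - r) = 0"
  proof (cases "\<Gamma> *v (r' - r) = 0")
    case True
    obtain \<eta> where "\<Gamma> *v \<eta> \<noteq> 0"
      using ne matrix_eq[of \<Gamma> 0] by (auto simp: \<Gamma>_def)
    moreover have "(\<Gamma> *v \<eta>) \<bullet> (r' - r) = 0" using True by (simp add: skew_inner[OF skew\<Gamma>])
    ultimately show ?thesis using that by blast
  next
    case False
    moreover have "(\<Gamma> *v (r' - r)) \<bullet> (r' - r) = 0"
      using skew_inner[OF skew\<Gamma>, of "r' - r" "r' - r"] inner_commute[of "\<Gamma> *v (r' - r)" "r' - r"] by linarith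
    ultimately show ?thesis using that by blast
  qed
  show False
  proof (rule no_two_level_link[OF d rr _ r \<nu>(2,3)])
    show "edge_star r r' \<noteq> {}" using E0_star by blast
    show "\<nu> \<bullet> a = \<nu> \<bullet> a'"
      if "E \<in> edge_star r r'" "E' \<in> edge_star r r'" "adjacent E a E' a'" for E a E' a'
    proof -
      have "\<nu> \<bullet> (a - a') = 0"
        unfolding \<nu>(1) skew_inner[OF skew\<Gamma>] kernel[OF that] by simp
      then show ?thesis by (simp add: inner_diff_right)
    qed
  qed
qed

text \<open>Once the rotation is a constant \<open>G\<close>, the jump relation says that \<open>u - G c\<close> with the centroid \<open>c\<close> does
  not change across facets. The relations at the vertices of the facet of \<open>E1\<close> opposite to \<open>a1\<close> make
  \<open>G\<close> annihilate the directions of that facet, which leaves a skew matrix of rank at most one.\<close>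

lemma discrete_rigid_displacement_zero:
  fixes \<gamma> :: "(real^'d) set \<Rightarrow> real^'d \<Rightarrow> real^'d^'d" and u :: "(real^'d) set \<Rightarrow> real^'d"
  assumes d: "CARD('d) \<in> {2, 3}"
    and \<Omega>: "open \<Omega>" "connected \<Omega>" "\<Omega> \<subseteq> \<Union>\<T>" and int_vert: "\<And>E. E \<in> \<T> \<Longrightarrow> vert E \<inter> \<Omega> \<noteq> {}"
    and affine: "\<And>E. E \<in> \<T> \<Longrightarrow> \<exists>k L. linear L \<and> (\<forall>x. \<gamma> E x = k + L x)"
    and skew: "\<And>E x. E \<in> \<T> \<Longrightarrow> transpose (\<gamma> E x) = - \<gamma> E x"
    and cont: "\<And>E a E' a' r. adjacent E a E' a' \<Longrightarrow> r \<in> vert E - {a} \<Longrightarrow> \<gamma> E r = \<gamma> E' r"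
    and jump: "\<And>E a E' a' r. adjacent E a E' a' \<Longrightarrow> r \<in> vert E - {a} \<Longrightarrow>
        u E - u E' = (1 / real (CARD('d) + 1)) *\<^sub>R (\<gamma> E r *v (a - a'))"
    and bd: "E1 \<in> \<T>" "a1 \<in> vert E1"
      "\<And>r. r \<in> vert E1 - {a1} \<Longrightarrow> u E1 + (1 / real (CARD('d) + 1)) *\<^sub>R (\<gamma> E1 r *v (r - a1)) = 0"
    and E: "E \<in> \<T>"
  shows "u E = 0 \<and> \<gamma> E x = 0"
proof -
  have const: "\<gamma> E x = \<gamma> E y" if ET: "E \<in> \<T>" for E x y
  proof -
    obtain r where r: "r \<in> vert E" "r \<in> \<Omega>" using int_vert[OF ET] by blast
    have r_int: "r \<in> interior (\<Union>\<T>)" using r(2) \<Omega> interior_maximal by blast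
    have vert_const: "\<gamma> E r = \<gamma> E r'" if "r' \<in> vert E" for r'
    proof (rule rotation_constant_along_interior_edge[where \<gamma>=\<gamma> and u=u, OF d])
      show "\<gamma> E r = \<gamma> E' r" if "adjacent E a E' a'" "r \<in> vert E - {a}" for E a E' a' r
        by (rule cont[OF that])
      show "u E - u E' = (1 / real (CARD('d) + 1)) *\<^sub>R (\<gamma> E r *v (a - a'))"
        if "adjacent E a E' a'" "r \<in> vert E - {a}" for E a E' a' r
        by (rule jump[OF that])
    qed (use skew ET r(1) r_int that in auto)
    obtain k L where kL: "linear L" "\<And>x. \<gamma> E x = k + L x" using affine[OF ET] by blast
    interpret full_simplex "vert E" by (rule vert_simplex[OF ET])
    have "\<gamma> E x = \<gamma> E r" for x
    proof -
      have "\<gamma> E x = (\<Sum>c\<in>vert E. bary (vert E) c x *\<^sub>R \<gamma> E c)"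
        unfolding kL(2) by (rule affine_eq_sum_bary[OF kL(1)])
      also have "\<dots> = (\<Sum>c\<in>vert E. bary (vert E) c x *\<^sub>R \<gamma> E r)"
        using vert_const by (intro sum.cong) auto
      finally show ?thesis by (simp add: sum_bary flip: scaleR_left.sum)
    qed
    from this[of x] this[of y] show ?thesis by simp
  qed
  define s where "s = real (CARD('d) + 1)"
  define m where "m E = (1 / s) *\<^sub>R (\<Sum>c\<in>vert E. c)" for E :: "(real^'d) set"
  define b where "b E = (\<gamma> E 0, u E - \<gamma> E 0 *v m E)" for E
  have b_inv: "b E = b E'" if adj: "adjacent E a E' a'" for E a E' a'
  proof -
    have E: "E \<in> \<T>" "E' \<in> \<T>" "a \<in> vert E" "a' \<in> vert E'" "vert E - {a} = vert E' - {a'}"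
      using adj by (auto simp: adjacent_def)
    obtain r where r: "r \<in> vert E - {a}" by (rule facet_nonempty[OF E(1,3)])
    have \<gamma>: "\<gamma> E 0 = \<gamma> E' 0" using cont[OF adj r] const[OF E(1), of r 0] const[OF E(2), of r 0] by simp
    have m_diff: "m E - m E' = (1 / s) *\<^sub>R (a - a')"
      using sum.remove[OF finite_vert[OF E(1)] E(3), of "\<lambda>c. c"] sum.remove[OF finite_vert[OF E(2)] E(4), of "\<lambda>c. c"] E(5)
      by (simp add: m_def flip: scaleR_diff_right)
    have "u E - u E' = (1 / s) *\<^sub>R (\<gamma> E 0 *v (a - a'))"
      using jump[OF adj r] const[OF E(1), of r 0] by (simp add: s_def)
    also have "\<dots> = \<gamma> E 0 *v (m E - m E')" by (simp add: m_diff matrix_vector_mult_scaleR)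
    finally show ?thesis using \<gamma> by (simp add: b_def matrix_vector_mult_diff_distrib algebra_simps)
  qed
  have b_const: "b E = b E1" if "E \<in> \<T>" for E
  proof (rule global_connectivity[where b=b, OF \<Omega> _ that _ bd(1)])
    show "b E = b E'" if "adjacent E a E' a'" for E a E' a' by (rule b_inv[OF that])
    show "E \<inter> \<Omega> \<noteq> {}" using int_vert[OF that] vert_subset[OF that] by blast
    show "E1 \<inter> \<Omega> \<noteq> {}" using int_vert[OF bd(1)] vert_subset[OF bd(1)] by blast
  qed
  define G where "G = \<gamma> E1 0"
  have skewG: "transpose G = - G" unfolding G_def by (rule skew[OF bd(1)])
  have bdG: "u E1 + (1 / s) *\<^sub>R (G *v (r - a1)) = 0" if "r \<in> vert E1 - {a1}" for r
    using bd(3)[OF that] const[OF bd(1), of r 0] by (simp add: G_def s_def)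
  interpret E1: full_simplex "vert E1" by (rule vert_simplex[OF bd(1)])
  have "G = 0"
  proof (rule skew_kills_hyperplane_imp_zero[OF skewG, of "bary_grad (vert E1) a1"])
    obtain r where r: "r \<in> vert E1 - {a1}" by (rule facet_nonempty[OF bd(1,2)])
    show "bary_grad (vert E1) a1 \<noteq> 0" using E1.bary_grad_vertex[OF bd(2), of r] r by auto
    show "G *v z = 0" if "bary_grad (vert E1) a1 \<bullet> z = 0" for z
    proof (rule E1.linear_constant_on_facet_imp_zero[OF bd(2) matrix_vector_mul_linear _ that])
      fix r r' assume rr: "r \<in> vert E1 - {a1}" "r' \<in> vert E1 - {a1}"
      have "(1 / s) *\<^sub>R (G *v (r - a1)) = (1 / s) *\<^sub>R (G *v (r' - a1))"
        by (rule add_left_imp_eq[of "u E1", OF trans[OF bdG[OF rr(1)] sym[OF bdG[OF rr(2)]]]])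
      then have "G *v (r - a1) = G *v (r' - a1)" by (subst (asm) scaleR_cancel_left) (auto simp: s_def)
      then show "G *v r = G *v r'" by (simp add: matrix_vector_mult_diff_distrib)
    qed
  qed
  obtain r where r: "r \<in> vert E1 - {a1}" by (rule facet_nonempty[OF bd(1,2)])
  have "u E1 = 0" using bdG[OF r] by (simp add: \<open>G = 0\<close>)
  have "\<gamma> E 0 = 0" "u E - \<gamma> E 0 *v m E = 0"
    using b_const[OF E] \<open>G = 0\<close> \<open>u E1 = 0\<close> by (auto simp: b_def G_def)
  then show ?thesis using const[OF E, of x 0] by simp
qed

end

section \<open>Square integrable fields and the weak divergence\<close>

lemma integrable_inner_L2_on:
  fixes f g :: "real^'d \<Rightarrow> 'b::euclidean_space"
  assumes "L2_on \<Omega> f" "L2_on \<Omega> g"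
  shows "integrable (lebesgue_on \<Omega>) (\<lambda>x. f x \<bullet> g x)"
proof (rule Bochner_Integration.integrable_bound)
  show "integrable (lebesgue_on \<Omega>) (\<lambda>x. (norm (f x))\<^sup>2 + (norm (g x))\<^sup>2)"
    using assms by (auto simp: L2_on_def)
  show "(\<lambda>x. f x \<bullet> g x) \<in> borel_measurable (lebesgue_on \<Omega>)"
    using assms by (auto simp: L2_on_def)
  show "AE x in lebesgue_on \<Omega>. norm (f x \<bullet> g x) \<le> norm ((norm (f x))\<^sup>2 + (norm (g x))\<^sup>2)"
  proof (rule AE_I2)
    fix x
    have "2 * (norm (f x) * norm (g x)) \<le> (norm (f x))\<^sup>2 + (norm (g x))\<^sup>2"
      using sum_squares_bound[of "norm (f x)" "norm (g x)"] by (simp add: mult.assoc)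
    moreover have "\<bar>f x \<bullet> g x\<bar> \<le> norm (f x) * norm (g x)" by (rule Cauchy_Schwarz_ineq2)
    moreover have "0 \<le> norm (f x) * norm (g x)" by simp
    ultimately have "\<bar>f x \<bullet> g x\<bar> \<le> (norm (f x))\<^sup>2 + (norm (g x))\<^sup>2" by linarith
    then show "norm (f x \<bullet> g x) \<le> norm ((norm (f x))\<^sup>2 + (norm (g x))\<^sup>2)" by simp
  qed
qed

lemma L2_on_bounded_by:
  fixes f :: "real^'d \<Rightarrow> 'b::euclidean_space" and g :: "real^'d \<Rightarrow> 'c::euclidean_space"
  assumes f: "f \<in> borel_measurable (lebesgue_on \<Omega>)" and g: "L2_on \<Omega> g" and le: "\<And>x. norm (f x) \<le> norm (g x)"
  shows "L2_on \<Omega> f"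
proof -
  have "integrable (lebesgue_on \<Omega>) (\<lambda>x. (norm (f x))\<^sup>2)"
  proof (rule Bochner_Integration.integrable_bound)
  show "integrable (lebesgue_on \<Omega>) (\<lambda>x. (norm (g x))\<^sup>2)" using g by (simp add: L2_on_def)
  show "(\<lambda>x. (norm (f x))\<^sup>2) \<in> borel_measurable (lebesgue_on \<Omega>)"
    by (intro borel_measurable_power measurable_compose[OF f borel_measurable_norm])
  show "AE x in lebesgue_on \<Omega>. norm ((norm (f x))\<^sup>2) \<le> norm ((norm (g x))\<^sup>2)"
  proof (rule AE_I2)
    fix x
    have "(norm (f x))\<^sup>2 \<le> (norm (g x))\<^sup>2" by (rule power_mono[OF le norm_ge_zero])
    then show "norm ((norm (f x))\<^sup>2) \<le> norm ((norm (g x))\<^sup>2)" by simp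
  qed
  qed
  with f show ?thesis by (simp add: L2_on_def)
qed

lemma L2_on_scaleR:
  fixes f :: "real^'d \<Rightarrow> 'b::euclidean_space"
  shows "L2_on \<Omega> f \<Longrightarrow> L2_on \<Omega> (\<lambda>x. c *\<^sub>R f x)"
  by (auto simp: L2_on_def power_mult_distrib)

lemma L2_on_add:
  fixes f g :: "real^'d \<Rightarrow> 'b::euclidean_space"
  assumes "L2_on \<Omega> f" "L2_on \<Omega> g"
  shows "L2_on \<Omega> (\<lambda>x. f x + g x)"
proof -
  have "(norm (f x + g x))\<^sup>2 = (norm (f x))\<^sup>2 + (norm (g x))\<^sup>2 + 2 * (f x \<bullet> g x)" for x
    by (simp add: power2_norm_eq_inner inner_add_left inner_add_right inner_commute)
  then show ?thesis
    using assms integrable_inner_L2_on[OF assms] by (simp add: L2_on_def borel_measurable_add)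
qed

lemma L2_on_zero: "L2_on \<Omega> (\<lambda>x. 0)"
  by (simp add: L2_on_def)

lemma L2_on_sum:
  fixes f :: "'i \<Rightarrow> real^'d \<Rightarrow> 'b::euclidean_space"
  assumes "finite I" "\<And>i. i \<in> I \<Longrightarrow> L2_on \<Omega> (f i)"
  shows "L2_on \<Omega> (\<lambda>x. \<Sum>i\<in>I. f i x)"
  using assms by (induction I) (auto simp: L2_on_zero intro: L2_on_add)

lemma L2_on_component:
  fixes g :: "real^'d \<Rightarrow> real^'n"
  assumes "L2_on \<Omega> g"
  shows "L2_on \<Omega> (\<lambda>x. g x $ i)"
proof (rule L2_on_bounded_by[OF _ assms])
  have [measurable]: "g \<in> borel_measurable (lebesgue_on \<Omega>)" using assms by (simp add: L2_on_def)
  have "(\<lambda>x. g x \<bullet> axis i 1) \<in> borel_measurable (lebesgue_on \<Omega>)" by measurable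
  then show "(\<lambda>x. g x $ i) \<in> borel_measurable (lebesgue_on \<Omega>)" by (simp add: inner_axis)
  show "norm (g x $ i) \<le> norm (g x)" for x by (rule Finite_Cartesian_Product.norm_nth_le)
qed

lemma L2_on_row:
  fixes \<tau> :: "real^'d \<Rightarrow> real^'n^'m"
  assumes "L2_on \<Omega> \<tau>"
  shows "L2_on \<Omega> (\<lambda>x. row i (\<tau> x))"
proof (rule L2_on_bounded_by[OF _ assms])
  have m: "\<tau> \<in> borel_measurable (lebesgue_on \<Omega>)" using assms by (simp add: L2_on_def)
  have "continuous_on UNIV (\<lambda>A::real^'n^'m. A $ i)" by (intro continuous_intros)
  then show "(\<lambda>x. row i (\<tau> x)) \<in> borel_measurable (lebesgue_on \<Omega>)"
    using borel_measurable_continuous_on[OF _ m] by (simp add: row_def vec_lambda_eta)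
  show "norm (row i (\<tau> x)) \<le> norm (\<tau> x)" for x
    by (simp add: row_def vec_lambda_eta Finite_Cartesian_Product.norm_nth_le)
qed

lemma L2_on_continuous:
  fixes f :: "real^'d \<Rightarrow> 'b::euclidean_space"
  assumes "open \<Omega>" "bounded \<Omega>" "continuous_on UNIV f"
  shows "L2_on \<Omega> f"
proof -
  have \<Omega>: "\<Omega> \<in> lmeasurable" "\<Omega> \<in> sets lebesgue" using assms by (auto simp: lmeasurable_open)
  interpret finite_measure "lebesgue_on \<Omega>" by (rule finite_measure_lebesgue_on[OF \<Omega>(1)])
  have f[measurable]: "f \<in> borel_measurable (lebesgue_on \<Omega>)"
    by (intro continuous_imp_measurable_on_sets_lebesgue \<Omega> continuous_on_subset[OF assms(3)]) auto
  have "compact (f ` closure \<Omega>)"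
    using assms by (intro compact_continuous_image continuous_on_subset[OF assms(3)]) auto
  then obtain B where "\<And>y. y \<in> f ` closure \<Omega> \<Longrightarrow> norm y \<le> B"
    using compact_imp_bounded bounded_iff by metis
  then have B: "norm (f x) \<le> B" if "x \<in> \<Omega>" for x using that closure_subset by fastforce
  have "integrable (lebesgue_on \<Omega>) (\<lambda>x. (norm (f x))\<^sup>2)"
  proof (rule integrable_const_bound[where B="B\<^sup>2"])
    show "AE x in lebesgue_on \<Omega>. norm ((norm (f x))\<^sup>2) \<le> B\<^sup>2"
    proof (rule AE_I2)
      fix x assume "x \<in> space (lebesgue_on \<Omega>)"
      then have "(norm (f x))\<^sup>2 \<le> B\<^sup>2" using B[of x] by (intro power_mono) auto
      then show "norm ((norm (f x))\<^sup>2) \<le> B\<^sup>2" by simp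
    qed
  qed (intro borel_measurable_power measurable_compose[OF f borel_measurable_norm])
  then show ?thesis by (simp add: L2_on_def f)
qed

lemma L2_on_test_function:
  assumes "open \<Omega>" "bounded \<Omega>" "test_function U \<phi> D\<phi>"
  shows "L2_on \<Omega> \<phi>" "L2_on \<Omega> D\<phi>"
  using assms test_function_imp_continuous[OF assms(3)] by (auto intro: L2_on_continuous)

lemma integrable_L2_on:
  fixes f :: "real^'d \<Rightarrow> real"
  assumes "open \<Omega>" "bounded \<Omega>" "L2_on \<Omega> f"
  shows "integrable (lebesgue_on \<Omega>) f"
  using integrable_inner_L2_on[OF assms(3) L2_on_continuous[OF assms(1,2) continuous_on_const[of _ 1]]] by simp

lemma L2_inner_cong_AE:
  fixes f f' g :: "real^'d \<Rightarrow> 'b::euclidean_space"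
  assumes "L2_on \<Omega> f" "L2_on \<Omega> f'" "L2_on \<Omega> g" and ae: "AE x in lebesgue_on \<Omega>. f x = f' x"
  shows "L2_inner \<Omega> f g = L2_inner \<Omega> f' g"
  unfolding L2_inner_def
proof (rule integral_cong_AE)
  show "AE x in lebesgue_on \<Omega>. f x \<bullet> g x = f' x \<bullet> g x" using ae by eventually_elim simp
qed (use assms in \<open>auto simp: L2_on_def\<close>)

lemma L2_inner_sum_left:
  fixes f :: "'i \<Rightarrow> real^'d \<Rightarrow> 'b::euclidean_space"
  assumes "\<And>i. i \<in> I \<Longrightarrow> L2_on \<Omega> (f i)" "L2_on \<Omega> g"
  shows "L2_inner \<Omega> (\<lambda>x. \<Sum>i\<in>I. c i *\<^sub>R f i x) g = (\<Sum>i\<in>I. c i * L2_inner \<Omega> (f i) g)"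
  unfolding L2_inner_def inner_sum_left inner_scaleR_left
  using assms by (subst Bochner_Integration.integral_sum) (auto intro!: integrable_inner_L2_on)

lemma L2_inner_commute: "L2_inner \<Omega> f g = L2_inner \<Omega> g f"
  by (simp add: L2_inner_def inner_commute)

text \<open>The defining choice of \<open>weak_div\<close> can thus be replaced by any explicit divergence, almost everywhere.\<close>

lemma weak_div_unique:
  fixes \<tau> :: "real^'d \<Rightarrow> real^'d^'d"
  assumes \<Omega>: "open \<Omega>" "bounded \<Omega>"
    and g: "L2_on \<Omega> g" "has_weak_div \<Omega> \<tau> g" and h: "L2_on \<Omega> h" "has_weak_div \<Omega> \<tau> h"
  shows "AE x in lebesgue_on \<Omega>. g x = h x"
proof -
  have "AE x in lebesgue_on \<Omega>. g x $ i - h x $ i = 0" for i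
  proof (rule fundamental_lemma[OF \<Omega>])
    show "integrable (lebesgue_on \<Omega>) (\<lambda>x. g x $ i - h x $ i)"
      by (intro Bochner_Integration.integrable_diff integrable_L2_on \<Omega> L2_on_component g h)
    fix \<phi> D\<phi> assume \<phi>: "test_function \<Omega> \<phi> D\<phi>"
    have "L2_inner \<Omega> (\<lambda>x. g x $ i) \<phi> = L2_inner \<Omega> (\<lambda>x. h x $ i) \<phi>"
      using g(2) h(2) \<phi> unfolding has_weak_div_def by (metis neg_equal_iff_equal)
    moreover have "integrable (lebesgue_on \<Omega>) (\<lambda>x. g x $ i * \<phi> x)" "integrable (lebesgue_on \<Omega>) (\<lambda>x. h x $ i * \<phi> x)"
      using integrable_inner_L2_on[OF L2_on_component L2_on_test_function(1)[OF \<Omega> \<phi>]] g h by force+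
    ultimately show "integral\<^sup>L (lebesgue_on \<Omega>) (\<lambda>x. (g x $ i - h x $ i) * \<phi> x) = 0"
      by (simp add: left_diff_distrib L2_inner_def)
  qed
  then have "AE x in lebesgue_on \<Omega>. \<forall>i\<in>UNIV. g x $ i - h x $ i = 0"
    by (intro AE_finite_allI) auto
  then show ?thesis by eventually_elim (simp add: vec_eq_iff)
qed

lemma weak_div:
  assumes "\<tau> \<in> X_space \<Omega> \<Gamma>N"
  shows "L2_on \<Omega> (weak_div \<Omega> \<tau>)" "has_weak_div \<Omega> \<tau> (weak_div \<Omega> \<tau>)"
proof -
  have "\<exists>g. L2_on \<Omega> g \<and> has_weak_div \<Omega> \<tau> g" using assms by (simp add: X_space_def)
  from someI_ex[OF this] show "L2_on \<Omega> (weak_div \<Omega> \<tau>)" "has_weak_div \<Omega> \<tau> (weak_div \<Omega> \<tau>)"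
    by (simp_all add: weak_div_def)
qed

lemma weak_div_AE_eq:
  fixes \<tau> :: "real^'d \<Rightarrow> real^'d^'d"
  assumes \<Omega>: "open \<Omega>" "bounded \<Omega>" and g: "L2_on \<Omega> g" "has_weak_div \<Omega> \<tau> g"
  shows "L2_on \<Omega> (weak_div \<Omega> \<tau>)" "AE x in lebesgue_on \<Omega>. weak_div \<Omega> \<tau> x = g x"
proof -
  have "\<exists>g. L2_on \<Omega> g \<and> has_weak_div \<Omega> \<tau> g" using g by blast
  from someI_ex[OF this] have "L2_on \<Omega> (weak_div \<Omega> \<tau>)" "has_weak_div \<Omega> \<tau> (weak_div \<Omega> \<tau>)"
    by (simp_all add: weak_div_def)
  then show "L2_on \<Omega> (weak_div \<Omega> \<tau>)" "AE x in lebesgue_on \<Omega>. weak_div \<Omega> \<tau> x = g x"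
    using weak_div_unique[OF \<Omega> _ _ g] by blast+
qed

text \<open>The normal trace is defined through the chosen weak divergence; uniqueness allows to test it with \<open>g\<close>.\<close>

lemma X_spaceI:
  fixes \<tau> :: "real^'d \<Rightarrow> real^'d^'d"
  assumes \<Omega>: "open \<Omega>" "bounded \<Omega>" and \<tau>: "L2_on \<Omega> \<tau>" and g: "L2_on \<Omega> g"
    and green: "\<And>i \<phi> D\<phi>. test_function \<Omega> \<phi> D\<phi> \<Longrightarrow>
      L2_inner \<Omega> (\<lambda>x. row i (\<tau> x)) D\<phi> + L2_inner \<Omega> (\<lambda>x. g x $ i) \<phi> = 0"
    and green_N: "\<And>i \<phi> D\<phi>. test_function (- closure (frontier \<Omega> - \<Gamma>N)) \<phi> D\<phi> \<Longrightarrow>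
      L2_inner \<Omega> (\<lambda>x. row i (\<tau> x)) D\<phi> + L2_inner \<Omega> (\<lambda>x. g x $ i) \<phi> = 0"
  shows "\<tau> \<in> X_space \<Omega> \<Gamma>N" "has_weak_div \<Omega> \<tau> g"
proof -
  show wd: "has_weak_div \<Omega> \<tau> g"
    unfolding has_weak_div_def using green by (simp add: eq_neg_iff_add_eq_0)
  note w = weak_div_AE_eq[OF \<Omega> g wd]
  have "L2_inner \<Omega> (\<lambda>x. weak_div \<Omega> \<tau> x $ i) \<phi> = L2_inner \<Omega> (\<lambda>x. g x $ i) \<phi>"
    if "test_function U \<phi> D\<phi>" for i U \<phi> D\<phi>
  proof (rule L2_inner_cong_AE)
    show "AE x in lebesgue_on \<Omega>. weak_div \<Omega> \<tau> x $ i = g x $ i" using w(2) by eventually_elim simp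
  qed (use L2_on_component[OF w(1)] L2_on_component[OF g] L2_on_test_function(1)[OF \<Omega> that] in auto)
  then have "normal_trace_zero_on \<Omega> \<Gamma>N \<tau>"
    unfolding normal_trace_zero_on_def using green_N by metis
  with \<tau> g wd show "\<tau> \<in> X_space \<Omega> \<Gamma>N" unfolding X_space_def by blast
qed

lemma L2_inner_weak_div_combination:
  fixes \<tau> :: "'p::finite \<Rightarrow> real^'d \<Rightarrow> real^'d^'d"
  assumes \<Omega>: "open \<Omega>" "bounded \<Omega>" and \<tau>: "\<And>j. \<tau> j \<in> X_space \<Omega> \<Gamma>N" and \<psi>: "L2_on \<Omega> \<psi>"
    and ae: "AE x in lebesgue_on \<Omega>. \<psi> x = (\<Sum>j\<in>UNIV. c j *\<^sub>R \<tau> j x)" and u: "L2_on \<Omega> u"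
  shows "L2_inner \<Omega> (weak_div \<Omega> \<psi>) u = (\<Sum>j\<in>UNIV. c j * L2_inner \<Omega> (weak_div \<Omega> (\<tau> j)) u)"
proof -
  note w = weak_div[OF \<tau>]
  have L2\<tau>: "L2_on \<Omega> (\<tau> j)" for j using \<tau>[of j] by (simp add: X_space_def)
  define g where "g x = (\<Sum>j\<in>UNIV. c j *\<^sub>R weak_div \<Omega> (\<tau> j) x)" for x
  have L2g: "L2_on \<Omega> g" unfolding g_def[abs_def] by (intro L2_on_sum L2_on_scaleR w) auto
  have "has_weak_div \<Omega> \<psi> g"
    unfolding has_weak_div_def
  proof (intro allI impI)
    fix i \<phi> D\<phi> assume \<phi>: "test_function \<Omega> \<phi> D\<phi>"
    have comb: "L2_on \<Omega> (\<lambda>x. \<Sum>j\<in>UNIV. c j *\<^sub>R row i (\<tau> j x))"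
      by (intro L2_on_sum L2_on_scaleR L2_on_row L2\<tau>) auto
    have "L2_inner \<Omega> (\<lambda>x. row i (\<psi> x)) D\<phi> = L2_inner \<Omega> (\<lambda>x. \<Sum>j\<in>UNIV. c j *\<^sub>R row i (\<tau> j x)) D\<phi>"
    proof (rule L2_inner_cong_AE[OF L2_on_row[OF \<psi>] comb L2_on_test_function(2)[OF \<Omega> \<phi>]])
      show "AE x in lebesgue_on \<Omega>. row i (\<psi> x) = (\<Sum>j\<in>UNIV. c j *\<^sub>R row i (\<tau> j x))"
        using ae by eventually_elim (simp add: row_def vec_eq_iff)
    qed
    also have "\<dots> = (\<Sum>j\<in>UNIV. c j * L2_inner \<Omega> (\<lambda>x. row i (\<tau> j x)) D\<phi>)"
      by (intro L2_inner_sum_left L2_on_row L2\<tau> L2_on_test_function(2)[OF \<Omega> \<phi>])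
    also have "\<dots> = - (\<Sum>j\<in>UNIV. c j * L2_inner \<Omega> (\<lambda>x. weak_div \<Omega> (\<tau> j) x $ i) \<phi>)"
      using w(2) \<phi> by (simp add: has_weak_div_def sum_negf)
    also have "(\<Sum>j\<in>UNIV. c j * L2_inner \<Omega> (\<lambda>x. weak_div \<Omega> (\<tau> j) x $ i) \<phi>) =
        L2_inner \<Omega> (\<lambda>x. \<Sum>j\<in>UNIV. c j *\<^sub>R (weak_div \<Omega> (\<tau> j) x $ i)) \<phi>"
      by (intro L2_inner_sum_left[symmetric] L2_on_component w L2_on_test_function(1)[OF \<Omega> \<phi>])
    also have "\<dots> = L2_inner \<Omega> (\<lambda>x. g x $ i) \<phi>" by (simp add: g_def)
    finally show "L2_inner \<Omega> (\<lambda>x. row i (\<psi> x)) D\<phi> = - L2_inner \<Omega> (\<lambda>x. g x $ i) \<phi>" .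
  qed
  from weak_div_AE_eq[OF \<Omega> L2g this] have "L2_inner \<Omega> (weak_div \<Omega> \<psi>) u = L2_inner \<Omega> g u"
    by (intro L2_inner_cong_AE L2g u) auto
  also have "\<dots> = (\<Sum>j\<in>UNIV. c j * L2_inner \<Omega> (weak_div \<Omega> (\<tau> j)) u)"
    unfolding g_def by (intro L2_inner_sum_left w u)
  finally show ?thesis .
qed

section \<open>Piecewise affine fields\<close>

definition affine_fun :: "('a::real_vector \<Rightarrow> 'b::real_vector) \<Rightarrow> bool" where
  "affine_fun p \<longleftrightarrow> (\<exists>c L. linear L \<and> p = (\<lambda>x. c + L x))"

lemma affine_funI: "linear L \<Longrightarrow> affine_fun (\<lambda>x. c + L x)"
  by (auto simp: affine_fun_def)

lemma affine_fun_const: "affine_fun (\<lambda>x. c)"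
  using affine_funI[OF linear_zero, of c] by simp

lemma affine_fun_sum:
  assumes "finite I" "\<And>i. i \<in> I \<Longrightarrow> affine_fun (p i)"
  shows "affine_fun (\<lambda>x. \<Sum>i\<in>I. k i *\<^sub>R p i x)"
proof -
  obtain c L where L: "\<And>i. i \<in> I \<Longrightarrow> linear (L i)" "\<And>i. i \<in> I \<Longrightarrow> p i = (\<lambda>x. c i + L i x)"
    using assms(2) unfolding affine_fun_def by metis
  have "(\<Sum>i\<in>I. k i *\<^sub>R p i x) = (\<Sum>i\<in>I. k i *\<^sub>R c i) + (\<Sum>i\<in>I. k i *\<^sub>R L i x)" for x
    using L(2) by (simp add: scaleR_add_right flip: sum.distrib)
  moreover have "linear (\<lambda>x. \<Sum>i\<in>I. k i *\<^sub>R L i x)"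
    using L(1) by (intro linear_compose_sum ballI linear_compose_scale_right)
  ultimately show ?thesis by (simp add: affine_funI)
qed

lemma affine_fun_combo:
  assumes "affine_fun p"
  shows "p ((1 - t) *\<^sub>R x + t *\<^sub>R y) = (1 - t) *\<^sub>R p x + t *\<^sub>R p y"
proof -
  obtain c L where L: "linear L" "p = (\<lambda>x. c + L x)" using assms by (auto simp: affine_fun_def)
  show ?thesis
    unfolding L(2) linear_add[OF L(1)] linear_scale[OF L(1)] by (simp add: algebra_simps)
qed

lemma continuous_on_affine_fun:
  fixes p :: "'a::euclidean_space \<Rightarrow> 'b::real_normed_vector"
  assumes "affine_fun p"
  shows "continuous_on S p"
proof -
  obtain c L where L: "linear L" "p = (\<lambda>x. c + L x)" using assms by (auto simp: affine_fun_def)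
  show ?thesis unfolding L(2) using L(1) by (intro continuous_intros linear_continuous_on linear_conv_bounded_linear[THEN iffD1])
qed

lemma affine_fun_eqI:
  fixes p q :: "'a::euclidean_space \<Rightarrow> 'b::real_vector"
  assumes p: "affine_fun p" and q: "affine_fun q" and W: "open W" "W \<noteq> {}" and eq: "\<And>x. x \<in> W \<Longrightarrow> p x = q x"
  shows "p = q"
proof
  fix y
  obtain x where x: "x \<in> W" using W by blast
  obtain t where "0 < t" "t < 1" "x + t *\<^sub>R (y - x) \<in> W" by (rule small_step_in_open[OF W(1) x])
  moreover have "x + t *\<^sub>R (y - x) = (1 - t) *\<^sub>R x + t *\<^sub>R y" by (simp add: algebra_simps)
  ultimately have t: "(1 - t) *\<^sub>R x + t *\<^sub>R y \<in> W" "0 < t" by simp_all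
  from eq[OF t(1)] have "t *\<^sub>R p y = t *\<^sub>R q y"
    unfolding affine_fun_combo[OF p] affine_fun_combo[OF q] eq[OF x] by simp
  then show "p y = q y" using t(2) by simp
qed

text \<open>The affine function on the whole space that agrees with \<open>f\<close> in the interior of the element; its
  values at the vertices are the limits from within.\<close>

definition poly_ext :: "(real^'d) set \<Rightarrow> (real^'d \<Rightarrow> 'b::real_vector) \<Rightarrow> real^'d \<Rightarrow> 'b" where
  "poly_ext E f = (SOME p. affine_fun p \<and> (\<forall>x\<in>interior E. f x = p x))"

lemma poly_ext:
  assumes "P1_on E f"
  shows "affine_fun (poly_ext E f)" "\<And>x. x \<in> interior E \<Longrightarrow> f x = poly_ext E f x"
proof -
  have "\<exists>p. affine_fun p \<and> (\<forall>x\<in>interior E. f x = p x)"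
    using assms unfolding P1_on_def affine_fun_def by blast
  from someI_ex[OF this, folded poly_ext_def]
  show "affine_fun (poly_ext E f)" "\<And>x. x \<in> interior E \<Longrightarrow> f x = poly_ext E f x" by blast+
qed

lemma P1_onI: "affine_fun p \<Longrightarrow> (\<And>x. x \<in> interior E \<Longrightarrow> f x = p x) \<Longrightarrow> P1_on E f"
  unfolding P1_on_def affine_fun_def by blast

context simplicial_mesh
begin

lemma interior_nonempty: "E \<in> \<T> \<Longrightarrow> interior E \<noteq> {}"
  using full_simplex.centroid_in_interior[OF vert_simplex] by (auto simp: hull_vert)

lemma poly_ext_eqI:
  assumes "E \<in> \<T>" "affine_fun p" "\<And>x. x \<in> interior E \<Longrightarrow> f x = p x"
  shows "poly_ext E f = p"
proof (rule affine_fun_eqI[OF _ assms(2) open_interior interior_nonempty[OF assms(1)]])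
  have P1: "P1_on E f" using assms(2,3) by (rule P1_onI)
  show "affine_fun (poly_ext E f)" by (rule poly_ext(1)[OF P1])
  show "poly_ext E f x = p x" if "x \<in> interior E" for x using poly_ext(2)[OF P1 that] assms(3)[OF that] by simp
qed

lemma poly_ext_sum:
  assumes E: "E \<in> \<T>" and f: "\<And>i. i \<in> I \<Longrightarrow> P1_on E (f i)" and "finite I"
  shows "P1_on E (\<lambda>x. \<Sum>i\<in>I. k i *\<^sub>R f i x)"
    and "poly_ext E (\<lambda>x. \<Sum>i\<in>I. k i *\<^sub>R f i x) = (\<lambda>x. \<Sum>i\<in>I. k i *\<^sub>R poly_ext E (f i) x)"
proof -
  have aff: "affine_fun (\<lambda>x. \<Sum>i\<in>I. k i *\<^sub>R poly_ext E (f i) x)"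
    using assms by (intro affine_fun_sum poly_ext(1))
  have eq: "(\<Sum>i\<in>I. k i *\<^sub>R f i x) = (\<Sum>i\<in>I. k i *\<^sub>R poly_ext E (f i) x)" if "x \<in> interior E" for x
    using poly_ext(2)[OF f _] that by (intro sum.cong) auto
  show "P1_on E (\<lambda>x. \<Sum>i\<in>I. k i *\<^sub>R f i x)" using aff eq by (rule P1_onI)
  show "poly_ext E (\<lambda>x. \<Sum>i\<in>I. k i *\<^sub>R f i x) = (\<lambda>x. \<Sum>i\<in>I. k i *\<^sub>R poly_ext E (f i) x)"
    by (rule poly_ext_eqI[OF E aff eq])
qed

lemma at_within_interior_nontrivial:
  assumes "E \<in> \<T>" "r \<in> E"
  shows "at r within interior E \<noteq> bot"
proof -
  have "r \<in> closure (interior E)" using closure_interior_element[OF assms(1)] assms(2) by simp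
  then have "r islimpt interior E"
    using open_interior[of E] interior_limit_point[of r "interior E"] by (auto simp: closure_def)
  then show ?thesis by (simp add: trivial_limit_within)
qed

lemma from_within_eqI:
  fixes f :: "real^'d \<Rightarrow> 'b::t2_space"
  assumes "E \<in> \<T>" "r \<in> E" "(f \<longlongrightarrow> l) (at r within interior E)"
  shows "from_within E f r = l"
  unfolding from_within_def using at_within_interior_nontrivial[OF assms(1,2)] assms(3) by (rule tendsto_Lim)

lemma poly_ext_tendsto:
  fixes f :: "real^'d \<Rightarrow> 'b::real_normed_vector"
  assumes "P1_on E f"
  shows "(f \<longlongrightarrow> poly_ext E f r) (at r within interior E)"
proof -
  have "continuous_on UNIV (poly_ext E f)" by (rule continuous_on_affine_fun[OF poly_ext(1)[OF assms]])
  then have "(poly_ext E f \<longlongrightarrow> poly_ext E f r) (at r within interior E)"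
    by (meson UNIV_I continuous_on_def subset_UNIV tendsto_within_subset)
  moreover have "\<forall>\<^sub>F x in at r within interior E. poly_ext E f x = f x"
    using poly_ext(2)[OF assms] by (simp add: eventually_at_filter)
  ultimately show ?thesis by (rule Lim_transform_eventually)
qed

lemma from_within_P1:
  fixes f :: "real^'d \<Rightarrow> 'b::real_normed_vector"
  assumes "E \<in> \<T>" "r \<in> E" "P1_on E f"
  shows "from_within E f r = poly_ext E f r"
  by (rule from_within_eqI[OF assms(1,2) poly_ext_tendsto[OF assms(3)]])

lemma quad_P1:
  assumes "\<And>E. E \<in> \<T> \<Longrightarrow> P1_on E f" "\<And>E. E \<in> \<T> \<Longrightarrow> P1_on E g"
  shows "quad \<T> f g = (\<Sum>E\<in>\<T>. measure lebesgue E / real (CARD('d) + 1) *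
      (\<Sum>r\<in>vert E. poly_ext E f r \<bullet> poly_ext E g r))"
  unfolding quad_def
proof (rule sum.cong[OF refl])
  fix E assume E: "E \<in> \<T>"
  have "from_within E f r \<bullet> from_within E g r = poly_ext E f r \<bullet> poly_ext E g r" if "r \<in> vert E" for r
    using from_within_P1[OF E subsetD[OF vert_subset[OF E] that] assms(1)[OF E]]
      from_within_P1[OF E subsetD[OF vert_subset[OF E] that] assms(2)[OF E]] by simp
  then have "(\<Sum>r\<in>vert E. from_within E f r \<bullet> from_within E g r) = (\<Sum>r\<in>vert E. poly_ext E f r \<bullet> poly_ext E g r)"
    by (rule sum.cong[OF refl])
  then show "quad_elem E f g = measure lebesgue E / real (CARD('d) + 1) *
      (\<Sum>r\<in>vert E. poly_ext E f r \<bullet> poly_ext E g r)"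
    by (simp only: quad_elem_def vert_def)
qed

lemma quad_sum_left:
  assumes "finite I" "\<And>E i. E \<in> \<T> \<Longrightarrow> i \<in> I \<Longrightarrow> P1_on E (f i)" "\<And>E. E \<in> \<T> \<Longrightarrow> P1_on E g"
  shows "quad \<T> (\<lambda>x. \<Sum>i\<in>I. k i *\<^sub>R f i x) g = (\<Sum>i\<in>I. k i * quad \<T> (f i) g)"
proof -
  define w where "w E = measure lebesgue E / real (CARD('d) + 1)" for E :: "(real^'d) set"
  have "quad \<T> (\<lambda>x. \<Sum>i\<in>I. k i *\<^sub>R f i x) g =
      (\<Sum>E\<in>\<T>. w E * (\<Sum>r\<in>vert E. poly_ext E (\<lambda>x. \<Sum>i\<in>I. k i *\<^sub>R f i x) r \<bullet> poly_ext E g r))"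
    unfolding w_def by (rule quad_P1[OF poly_ext_sum(1)[OF _ assms(2) assms(1)] assms(3)])
  also have "\<dots> = (\<Sum>E\<in>\<T>. \<Sum>i\<in>I. k i * (w E * (\<Sum>r\<in>vert E. poly_ext E (f i) r \<bullet> poly_ext E g r)))"
  proof (rule sum.cong[OF refl])
    fix E assume E: "E \<in> \<T>"
    have "(\<Sum>r\<in>vert E. poly_ext E (\<lambda>x. \<Sum>i\<in>I. k i *\<^sub>R f i x) r \<bullet> poly_ext E g r) =
        (\<Sum>r\<in>vert E. \<Sum>i\<in>I. k i * (poly_ext E (f i) r \<bullet> poly_ext E g r))"
      by (simp only: poly_ext_sum(2)[OF E assms(2)[OF E] assms(1)] inner_sum_left inner_scaleR_left)
    also have "\<dots> = (\<Sum>i\<in>I. k i * (\<Sum>r\<in>vert E. poly_ext E (f i) r \<bullet> poly_ext E g r))"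
      by (subst sum.swap) (simp add: sum_distrib_left)
    finally show "w E * (\<Sum>r\<in>vert E. poly_ext E (\<lambda>x. \<Sum>i\<in>I. k i *\<^sub>R f i x) r \<bullet> poly_ext E g r) =
        (\<Sum>i\<in>I. k i * (w E * (\<Sum>r\<in>vert E. poly_ext E (f i) r \<bullet> poly_ext E g r)))"
      by (simp add: sum_distrib_left mult.left_commute)
  qed
  also have "\<dots> = (\<Sum>i\<in>I. k i * (\<Sum>E\<in>\<T>. w E * (\<Sum>r\<in>vert E. poly_ext E (f i) r \<bullet> poly_ext E g r)))"
    by (subst sum.swap) (simp add: sum_distrib_left)
  also have "\<dots> = (\<Sum>i\<in>I. k i * quad \<T> (f i) g)"
    using quad_P1[of "f i" g for i] assms by (simp add: w_def)
  finally show ?thesis .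
qed

lemma quad_commute: "quad \<T> f g = quad \<T> g f"
  by (simp add: quad_def quad_elem_def inner_commute)

end

section \<open>Local test stresses\<close>

locale polyhedral_mesh = simplicial_mesh \<T> for \<T> :: "(real^'d) set set" +
  fixes \<Omega> :: "(real^'d) set"
  assumes domain: "polyhedral_domain \<Omega>" and covers: "\<Union>\<T> = closure \<Omega>"
begin

lemma open_\<Omega>: "open \<Omega>" and bounded_\<Omega>: "bounded \<Omega>" and connected_\<Omega>: "connected \<Omega>"
  and interior_mesh: "interior (\<Union>\<T>) = \<Omega>"
  using domain by (simp_all add: polyhedral_domain_def covers)

lemma \<Omega>_subset: "\<Omega> \<subseteq> \<Union>\<T>"
  using closure_subset by (simp add: covers)

lemma interior_element_subset: "E \<in> \<T> \<Longrightarrow> interior E \<subseteq> \<Omega>"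
  using interior_mono[of E "\<Union>\<T>"] interior_mesh by blast

lemma AE_off_element_frontier:
  assumes "E \<in> \<T>"
  shows "AE x in lborel. x \<notin> frontier E"
  using full_simplex.AE_off_frontier[OF vert_simplex[OF assms]] by (simp add: hull_vert[OF assms])

lemma AE_in_interior: "AE x in lebesgue_on \<Omega>. \<exists>E\<in>\<T>. x \<in> interior E"
proof -
  have "AE x in lborel. \<forall>E\<in>\<T>. x \<notin> frontier E"
    using AE_off_element_frontier by (intro AE_finite_allI) auto
  then have "AE x in lebesgue. \<forall>E\<in>\<T>. x \<notin> frontier E" by (rule AE_completion)
  then have "AE x in lebesgue. x \<in> \<Omega> \<longrightarrow> (\<exists>E\<in>\<T>. x \<in> interior E)"
  proof eventually_elim
    case (elim x)
    show ?case
    proof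
      assume "x \<in> \<Omega>"
      then obtain E where E: "E \<in> \<T>" "x \<in> E" using \<Omega>_subset by blast
      then have "x \<in> interior E" using elim closed_element[OF E(1)] by (auto simp: frontier_def)
      with E(1) show "\<exists>E\<in>\<T>. x \<in> interior E" by blast
    qed
  qed
  then show ?thesis using open_\<Omega> by (simp add: AE_restrict_space_iff)
qed

lemma poly_ext_cong_AE:
  fixes f g :: "real^'d \<Rightarrow> 'b::real_normed_vector"
  assumes E: "E \<in> \<T>" and fg: "P1_on E f" "P1_on E g" and ae: "AE x in lebesgue_on \<Omega>. f x = g x"
  shows "poly_ext E f = poly_ext E g"
proof -
  let ?W = "interior E \<inter> {x. poly_ext E f x \<noteq> poly_ext E g x}"
  note cont = continuous_on_affine_fun[OF poly_ext(1)]
  have "open {x. poly_ext E f x \<noteq> poly_ext E g x}"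
    by (intro open_Collect_neq cont fg)
  then have W: "open ?W" by (intro open_Int open_interior)
  have "AE x in lebesgue. x \<in> \<Omega> \<longrightarrow> f x = g x"
    using ae open_\<Omega> by (simp add: AE_restrict_space_iff)
  then have "AE x in lebesgue. x \<notin> ?W"
    by eventually_elim (use poly_ext(2)[OF fg(1)] poly_ext(2)[OF fg(2)] interior_element_subset[OF E] in auto)
  then have "?W \<in> null_sets lebesgue"
    using W by (subst AE_iff_null_sets) auto
  then have "negligible ?W" by (simp add: negligible_iff_null_sets)
  then have "?W = {}" using open_not_negligible[OF W] by blast
  then show ?thesis
    by (intro affine_fun_eqI[OF poly_ext(1)[OF fg(1)] poly_ext(1)[OF fg(2)] open_interior interior_nonempty[OF E]]) blast
qed

lemma L2_on_indicator:
  fixes f :: "real^'d \<Rightarrow> 'b::euclidean_space"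
  assumes "S \<in> sets lebesgue" "L2_on \<Omega> f"
  shows "L2_on \<Omega> (\<lambda>x. indicator S x *\<^sub>R f x)"
proof (rule L2_on_bounded_by[OF _ assms(2)])
  have "indicator S \<in> borel_measurable (lebesgue_on \<Omega>)"
    using assms(1) open_\<Omega> by (intro borel_measurable_indicator') (auto simp: sets_restrict_space vimage_def Int_def)
  then show "(\<lambda>x. indicator S x *\<^sub>R f x) \<in> borel_measurable (lebesgue_on \<Omega>)"
    using assms(2) by (intro borel_measurable_scaleR) (auto simp: L2_on_def)
  show "norm (indicator S x *\<^sub>R f x) \<le> norm (f x)" for x by (simp add: indicator_def)
qed

lemma integral_element:
  fixes f :: "real^'d \<Rightarrow> real"
  assumes E: "E \<in> \<T>" and f: "continuous_on UNIV f"
  shows "integral\<^sup>L (lebesgue_on \<Omega>) (\<lambda>x. indicator (interior E) x * f x) = (\<integral>x. indicator E x * f x \<partial>lborel)"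
proof -
  have [measurable]: "f \<in> borel_measurable borel" by (rule borel_measurable_continuous_onI[OF f])
  have [measurable]: "E \<in> sets borel" using closed_element[OF E] by (rule borel_closed)
  have "integral\<^sup>L (lebesgue_on \<Omega>) (\<lambda>x. indicator (interior E) x * f x) =
      (\<integral>x. indicator \<Omega> x *\<^sub>R (indicator (interior E) x * f x) \<partial>lebesgue)"
    using open_\<Omega> by (intro integral_restrict_space) auto
  also have "\<dots> = (\<integral>x. indicator (interior E) x * f x \<partial>lebesgue)"
    using interior_element_subset[OF E] by (intro Bochner_Integration.integral_cong) (auto simp: indicator_def)
  also have "\<dots> = (\<integral>x. indicator (interior E) x * f x \<partial>lborel)"
    by (rule integral_completion) measurable
  also have "\<dots> = (\<integral>x. indicator E x * f x \<partial>lborel)"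
  proof (rule integral_cong_AE)
    show "AE x in lborel. indicator (interior E) x * f x = indicator E x * f x"
      using AE_off_element_frontier[OF E]
    proof eventually_elim
      case (elim x)
      then have "x \<in> interior E \<longleftrightarrow> x \<in> E"
        using closed_element[OF E] interior_subset by (auto simp: frontier_def)
      then show ?case by (simp add: indicator_def)
    qed
  qed measurable
  finally show ?thesis .
qed

definition row_matrix :: "'d \<Rightarrow> real^'d \<Rightarrow> real^'d^'d" where
  "row_matrix i z = (\<chi> k. if k = i then z else 0)"

lemma row_row_matrix: "row k (row_matrix i z) = (if k = i then z else 0)"
  by (simp add: row_matrix_def row_def vec_lambda_eta)

lemma row_matrix_inner: "row_matrix i z \<bullet> A = (A *v z) $ i"
proof -
  have "row_matrix i z \<bullet> A = (\<Sum>k\<in>UNIV. (if k = i then z else 0) \<bullet> A $ k)"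
    by (simp add: inner_vec_def row_matrix_def)
  also have "\<dots> = (\<Sum>k\<in>UNIV. if k = i then z \<bullet> A $ k else 0)" by (intro sum.cong) auto
  also have "\<dots> = z \<bullet> A $ i" by simp
  finally show ?thesis by (simp add: matrix_vector_mul_component inner_commute)
qed

text \<open>The part in \<open>E\<close> of the test stress for the facet opposite to \<open>a\<close> and its vertex \<open>r\<close>,
  placed in row \<open>i\<close>. At \<open>r\<close> it is directed along the edge from \<open>a\<close>, which lies in all facets through \<open>r\<close>
  but that one, and it vanishes on the facet opposite to \<open>r\<close>. So it has a normal component on the facet
  opposite to \<open>a\<close> only.\<close>

definition half_field :: "(real^'d) set \<Rightarrow> real^'d \<Rightarrow> real^'d \<Rightarrow> 'd \<Rightarrow> real^'d \<Rightarrow> real^'d^'d" where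
  "half_field E a r i x = indicator (interior E) x *\<^sub>R ((bary (vert E) r x / measure lborel E) *\<^sub>R row_matrix i (r - a))"

text \<open>The derivative of \<open>\<lambda>\<^sub>r\<close> along \<open>r - a\<close> is 1.\<close>

definition half_div :: "(real^'d) set \<Rightarrow> 'd \<Rightarrow> real^'d \<Rightarrow> real^'d" where
  "half_div E i x = indicator (interior E) x *\<^sub>R ((1 / measure lborel E) *\<^sub>R axis i 1)"

text \<open>By Green's formula this is a multiple of the integral of \<open>\<lambda>\<^sub>r \<phi>\<close> over the facet of \<open>E\<close> opposite to \<open>a\<close>.
  As a volume integral it can be handled by translations and affine changes of variables.\<close>

definition flux :: "(real^'d) set \<Rightarrow> real^'d \<Rightarrow> real^'d \<Rightarrow> (real^'d \<Rightarrow> real) \<Rightarrow> (real^'d \<Rightarrow> real^'d) \<Rightarrow> real" where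
  "flux E a r \<phi> D\<phi> = (1 / measure lborel E) *
     (\<integral>x. indicator E x * (bary (vert E) r x * (D\<phi> x \<bullet> (r - a)) + \<phi> x) \<partial>lborel)"

lemma measure_element_pos: "E \<in> \<T> \<Longrightarrow> measure lborel E > 0"
  using full_simplex.measure_hull_pos[OF vert_simplex] by (simp add: hull_vert)

lemma L2_on_half_field: "E \<in> \<T> \<Longrightarrow> L2_on \<Omega> (half_field E a r i)"
  unfolding half_field_def[abs_def]
  by (intro L2_on_indicator L2_on_continuous open_\<Omega> bounded_\<Omega> continuous_intros)
    (auto simp: measure_element_pos less_imp_neq[THEN not_sym])

lemma L2_on_half_div: "L2_on \<Omega> (half_div E i)"
  unfolding half_div_def[abs_def]
  by (intro L2_on_indicator L2_on_continuous open_\<Omega> bounded_\<Omega> continuous_intros) auto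

lemma poly_ext_half_field:
  assumes "E \<in> \<T>" "S \<in> \<T>"
  shows "P1_on S (half_field E a r i)"
    and "poly_ext S (half_field E a r i) =
      (\<lambda>x. (if S = E then bary (vert E) r x / measure lborel E else 0) *\<^sub>R row_matrix i (r - a))"
proof -
  let ?p = "\<lambda>x. (if S = E then bary (vert E) r x / measure lborel E else 0) *\<^sub>R row_matrix i (r - a)"
  have aff: "affine_fun ?p"
  proof (cases "S = E")
    case True
    have "linear (\<lambda>x. ((bary_grad (vert E) r \<bullet> x) / measure lborel E) *\<^sub>R row_matrix i (r - a))"
      by (intro linearI) (auto simp: inner_add_right add_divide_distrib scaleR_add_left)
    from affine_funI[OF this, of "((1 - bary_grad (vert E) r \<bullet> r) / measure lborel E) *\<^sub>R row_matrix i (r - a)"]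
    show ?thesis using True
      by (simp add: bary_def inner_diff_right diff_divide_distrib add_divide_distrib flip: scaleR_add_left)
        (simp add: add_diff_eq diff_add_eq)
  qed (simp add: affine_fun_const)
  have eq: "half_field E a r i x = ?p x" if "x \<in> interior S" for x
    using that interior_disjoint[OF assms(2,1) that] interior_subset[of E] by (auto simp: half_field_def indicator_def)
  show "P1_on S (half_field E a r i)" using aff eq by (rule P1_onI)
  show "poly_ext S (half_field E a r i) = ?p" by (rule poly_ext_eqI[OF assms(2) aff eq])
qed

text \<open>The residual of Green's formula for a half field comes from one facet only; two half fields are glued
  to an admissible stress as soon as their fluxes cancel.\<close>

lemma half_field_green:
  assumes E: "E \<in> \<T>" and \<phi>: "test_function U \<phi> D\<phi>"
  shows "L2_inner \<Omega> (\<lambda>x. row k (half_field E a r i x)) D\<phi> + L2_inner \<Omega> (\<lambda>x. half_div E i x $ k) \<phi> =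
    (if k = i then flux E a r \<phi> D\<phi> else 0)"
proof (cases "k = i")
  case False
  then have "row k (half_field E a r i x) = 0" "half_div E i x $ k = 0" for x
    by (simp_all add: half_field_def half_div_def row_row_matrix axis_def row_def row_matrix_def vec_eq_iff)
  then show ?thesis using False by (simp add: L2_inner_def)
next
  case True
  define m where "m = measure lborel E"
  have cont: "continuous_on UNIV \<phi>" "continuous_on UNIV D\<phi>"
    by (rule test_function_imp_continuous[OF \<phi>])+
  have c1: "continuous_on UNIV (\<lambda>x. bary (vert E) r x / m * ((r - a) \<bullet> D\<phi> x))"
    using measure_element_pos[OF E] by (intro continuous_intros cont) (auto simp: m_def)
  have c2: "continuous_on UNIV (\<lambda>x. 1 / m * \<phi> x)"
    by (intro continuous_intros cont)
  have "L2_inner \<Omega> (\<lambda>x. row k (half_field E a r i x)) D\<phi> =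
      integral\<^sup>L (lebesgue_on \<Omega>) (\<lambda>x. indicator (interior E) x * (bary (vert E) r x / m * ((r - a) \<bullet> D\<phi> x)))"
  proof -
    have "row k (half_field E a r i x) = (indicator (interior E) x * (bary (vert E) r x / m)) *\<^sub>R (r - a)" for x
      using True by (simp add: half_field_def row_def row_matrix_def vec_eq_iff m_def)
    then show ?thesis by (simp add: L2_inner_def mult.assoc)
  qed
  also have "\<dots> = (\<integral>x. indicator E x * (bary (vert E) r x / m * ((r - a) \<bullet> D\<phi> x)) \<partial>lborel)"
    by (rule integral_element[OF E c1])
  finally have 1: "L2_inner \<Omega> (\<lambda>x. row k (half_field E a r i x)) D\<phi> =
      (\<integral>x. indicator E x * (bary (vert E) r x / m * ((r - a) \<bullet> D\<phi> x)) \<partial>lborel)" .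
  have "L2_inner \<Omega> (\<lambda>x. half_div E i x $ k) \<phi> =
      integral\<^sup>L (lebesgue_on \<Omega>) (\<lambda>x. indicator (interior E) x * (1 / m * \<phi> x))"
    using True by (simp add: half_div_def L2_inner_def m_def axis_def mult.assoc)
  also have "\<dots> = (\<integral>x. indicator E x * (1 / m * \<phi> x) \<partial>lborel)"
    by (rule integral_element[OF E c2])
  finally have 2: "L2_inner \<Omega> (\<lambda>x. half_div E i x $ k) \<phi> = (\<integral>x. indicator E x * (1 / m * \<phi> x) \<partial>lborel)" .
  have int: "integrable lborel (\<lambda>x. indicator E x * h x)" if "continuous_on UNIV h" for h :: "real^'d \<Rightarrow> real"
    using full_simplex.integrable_on_hull[OF vert_simplex[OF E] that] by (simp add: hull_vert[OF E])
  have "L2_inner \<Omega> (\<lambda>x. row k (half_field E a r i x)) D\<phi> + L2_inner \<Omega> (\<lambda>x. half_div E i x $ k) \<phi> =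
      (\<integral>x. indicator E x * (bary (vert E) r x / m * ((r - a) \<bullet> D\<phi> x)) + indicator E x * (1 / m * \<phi> x) \<partial>lborel)"
    unfolding 1 2 by (rule Bochner_Integration.integral_add[symmetric, OF int[OF c1] int[OF c2]])
  also have "\<dots> = (\<integral>x. (1 / m) * (indicator E x * (bary (vert E) r x * (D\<phi> x \<bullet> (r - a)) + \<phi> x)) \<partial>lborel)"
    by (intro Bochner_Integration.integral_cong refl) (simp add: inner_commute field_simps add_divide_distrib)
  also have "\<dots> = flux E a r \<phi> D\<phi>" by (simp add: flux_def m_def)
  finally show ?thesis using True by simp
qed

lemma L2_inner_half_div:
  assumes E: "E \<in> \<T>" and u: "\<And>x. x \<in> interior E \<Longrightarrow> u x = c"
  shows "L2_inner \<Omega> (half_div E i) u = c $ i"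
proof -
  have pw: "half_div E i x \<bullet> u x = indicator (interior E) x * (c $ i / measure lborel E)" for x
    using u[of x] by (simp add: half_div_def indicator_def inner_axis inner_commute)
  have "L2_inner \<Omega> (half_div E i) u = (\<integral>x. indicator E x * (c $ i / measure lborel E) \<partial>lborel)"
    unfolding L2_inner_def pw by (rule integral_element[OF E continuous_on_const])
  also have "\<dots> = c $ i" using measure_element_pos[OF E] by simp
  finally show ?thesis .
qed

text \<open>Of all quadrature points only \<open>r\<close> contributes, as \<open>\<lambda>\<^sub>r\<close> vanishes at the other vertices.\<close>

lemma quad_half_field:
  assumes E: "E \<in> \<T>" and r: "r \<in> vert E" and \<gamma>: "\<And>S. S \<in> \<T> \<Longrightarrow> P1_on S \<gamma>"
  shows "quad \<T> (half_field E a r i) \<gamma> = ((1 / real (CARD('d) + 1)) *\<^sub>R (poly_ext E \<gamma> r *v (r - a))) $ i"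
proof -
  define s where "s = real (CARD('d) + 1)"
  have m: "measure lebesgue E = measure lborel E" "measure lborel E > 0"
    using closed_element[OF E] measure_element_pos[OF E] by (simp_all add: borel_closed)
  have "quad \<T> (half_field E a r i) \<gamma> = (\<Sum>S\<in>\<T>. measure lebesgue S / s *
      (\<Sum>q\<in>vert S. poly_ext S (half_field E a r i) q \<bullet> poly_ext S \<gamma> q))"
    unfolding s_def by (rule quad_P1[OF poly_ext_half_field(1)[OF E] \<gamma>])
  also have "\<dots> = (\<Sum>S\<in>\<T>. if S = E then measure lebesgue E / s *
      (\<Sum>q\<in>vert E. (bary (vert E) r q / measure lborel E) * (row_matrix i (r - a) \<bullet> poly_ext E \<gamma> q)) else 0)"
    using poly_ext_half_field(2)[OF E] by (intro sum.cong) auto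
  also have "\<dots> = measure lborel E / s *
      (\<Sum>q\<in>vert E. (bary (vert E) r q / measure lborel E) * (row_matrix i (r - a) \<bullet> poly_ext E \<gamma> q))"
    using E m by simp
  also have "(\<Sum>q\<in>vert E. (bary (vert E) r q / measure lborel E) * (row_matrix i (r - a) \<bullet> poly_ext E \<gamma> q)) =
      (\<Sum>q\<in>vert E. if q = r then (1 / measure lborel E) * (row_matrix i (r - a) \<bullet> poly_ext E \<gamma> r) else 0)"
    using full_simplex.bary_vertex[OF vert_simplex[OF E] r] by (intro sum.cong) auto
  also have "\<dots> = (1 / measure lborel E) * (row_matrix i (r - a) \<bullet> poly_ext E \<gamma> r)"
    using r E by simp
  finally show ?thesis using m(2) by (simp add: s_def row_matrix_inner)
qed

text \<open>The stress tested with consists of two half fields. The weight \<open>k\<close> is \<open>-1\<close> for a facet between two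
  elements and \<open>0\<close> for a facet in the Dirichlet part.\<close>

lemma test_field_equation:
  assumes E: "E \<in> \<T>" "r \<in> vert E" and E': "E' \<in> \<T>" "r \<in> vert E'"
    and balance: "\<And>\<phi> D\<phi>. test_function \<Omega> \<phi> D\<phi> \<or> test_function (- closure (frontier \<Omega> - \<Gamma>N)) \<phi> D\<phi> \<Longrightarrow>
       flux E a r \<phi> D\<phi> + k * flux E' a' r \<phi> D\<phi> = 0"
    and orth: "\<And>\<psi>. \<psi> \<in> X_h \<Omega> \<Gamma>N \<T> \<Longrightarrow> L2_inner \<Omega> (weak_div \<Omega> \<psi>) u + quad \<T> \<psi> \<gamma> = 0"
    and u: "L2_on \<Omega> u" "\<And>S x. S \<in> \<T> \<Longrightarrow> x \<in> interior S \<Longrightarrow> u x = c S"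
    and \<gamma>: "\<And>S. S \<in> \<T> \<Longrightarrow> P1_on S \<gamma>"
  shows "(c E + (1 / real (CARD('d) + 1)) *\<^sub>R (poly_ext E \<gamma> r *v (r - a))) +
    k *\<^sub>R (c E' + (1 / real (CARD('d) + 1)) *\<^sub>R (poly_ext E' \<gamma> r *v (r - a'))) = 0"
proof -
  have "(c E + (1 / real (CARD('d) + 1)) *\<^sub>R (poly_ext E \<gamma> r *v (r - a))) $ i +
    k * (c E' + (1 / real (CARD('d) + 1)) *\<^sub>R (poly_ext E' \<gamma> r *v (r - a'))) $ i = 0" for i
  proof -
    \<comment> \<open>The two half fields are indexed by the booleans, to use the lemmas on linear combinations.\<close>
    define f where "f b = (if b then half_field E a r i else half_field E' a' r i)" for b
    define d where "d b = (if b then half_div E i else half_div E' i)" for b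
    define w where "w b = (if b then 1 else k)" for b
    define \<psi> where "\<psi> x = (\<Sum>b\<in>UNIV. w b *\<^sub>R f b x)" for x
    define g where "g x = (\<Sum>b\<in>UNIV. w b *\<^sub>R d b x)" for x
    have f: "L2_on \<Omega> (f b)" for b using L2_on_half_field E E' by (auto simp: f_def)
    have d: "L2_on \<Omega> (d b)" for b using L2_on_half_div by (auto simp: d_def)
    have L2: "L2_on \<Omega> \<psi>" "L2_on \<Omega> g"
      unfolding \<psi>_def[abs_def] g_def[abs_def] by (intro L2_on_sum L2_on_scaleR f d finite)+
    have P1f: "P1_on S (f b)" if "S \<in> \<T>" for S b
      using poly_ext_half_field(1) E E' that by (auto simp: f_def)
    have P1: "P1_on S \<psi>" if "S \<in> \<T>" for S
      unfolding \<psi>_def[abs_def] by (rule poly_ext_sum(1)[OF that P1f[OF that] finite])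
    have green: "L2_inner \<Omega> (\<lambda>x. row j (\<psi> x)) D\<phi> + L2_inner \<Omega> (\<lambda>x. g x $ j) \<phi> = 0"
      if \<phi>: "test_function \<Omega> \<phi> D\<phi> \<or> test_function (- closure (frontier \<Omega> - \<Gamma>N)) \<phi> D\<phi>" for j \<phi> D\<phi>
    proof -
      obtain U where U: "test_function U \<phi> D\<phi>" using \<phi> by blast
      note L2\<phi> = L2_on_test_function[OF open_\<Omega> bounded_\<Omega> U]
      have 1: "L2_inner \<Omega> (\<lambda>x. row j (\<psi> x)) D\<phi> = (\<Sum>b\<in>UNIV. w b * L2_inner \<Omega> (\<lambda>x. row j (f b x)) D\<phi>)"
      proof -
        have "(\<lambda>x. row j (\<psi> x)) = (\<lambda>x. \<Sum>b\<in>UNIV. w b *\<^sub>R row j (f b x))"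
          by (simp add: \<psi>_def row_def vec_eq_iff fun_eq_iff)
        then show ?thesis using L2_inner_sum_left[OF L2_on_row[OF f] L2\<phi>(2)] by simp
      qed
      have 2: "L2_inner \<Omega> (\<lambda>x. g x $ j) \<phi> = (\<Sum>b\<in>UNIV. w b * L2_inner \<Omega> (\<lambda>x. d b x $ j) \<phi>)"
      proof -
        have "(\<lambda>x. g x $ j) = (\<lambda>x. \<Sum>b\<in>UNIV. w b *\<^sub>R (d b x $ j))" by (simp add: g_def)
        then show ?thesis using L2_inner_sum_left[OF L2_on_component[OF d] L2\<phi>(1)] by simp
      qed
      have 3: "L2_inner \<Omega> (\<lambda>x. row j (f True x)) D\<phi> + L2_inner \<Omega> (\<lambda>x. d True x $ j) \<phi> =
          (if j = i then flux E a r \<phi> D\<phi> else 0)"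
        using half_field_green[OF E(1) U] by (simp add: f_def d_def)
      have 4: "L2_inner \<Omega> (\<lambda>x. row j (f False x)) D\<phi> + L2_inner \<Omega> (\<lambda>x. d False x $ j) \<phi> =
          (if j = i then flux E' a' r \<phi> D\<phi> else 0)"
        using half_field_green[OF E'(1) U] by (simp add: f_def d_def)
      have "L2_inner \<Omega> (\<lambda>x. row j (\<psi> x)) D\<phi> + L2_inner \<Omega> (\<lambda>x. g x $ j) \<phi> =
          (L2_inner \<Omega> (\<lambda>x. row j (f True x)) D\<phi> + L2_inner \<Omega> (\<lambda>x. d True x $ j) \<phi>) +
          k * (L2_inner \<Omega> (\<lambda>x. row j (f False x)) D\<phi> + L2_inner \<Omega> (\<lambda>x. d False x $ j) \<phi>)"
        unfolding 1 2 by (simp add: UNIV_bool w_def distrib_left)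
      also have "\<dots> = 0"
        unfolding 3 4 using balance[OF \<phi>] by simp
      finally show ?thesis .
    qed
    note X_rules = X_spaceI[OF open_\<Omega> bounded_\<Omega> L2 green[OF disjI1] green[OF disjI2]]
    have X: "\<psi> \<in> X_space \<Omega> \<Gamma>N" "has_weak_div \<Omega> \<psi> g"
      using X_rules by blast+
    have "L2_inner \<Omega> (weak_div \<Omega> \<psi>) u = L2_inner \<Omega> g u"
      using weak_div_AE_eq[OF open_\<Omega> bounded_\<Omega> L2(2) X(2)] by (intro L2_inner_cong_AE L2(2) u(1)) auto
    also have "\<dots> = (\<Sum>b\<in>UNIV. w b * L2_inner \<Omega> (d b) u)"
      unfolding g_def by (intro L2_inner_sum_left d u(1))
    also have "\<dots> = c E $ i + k * c E' $ i"
      using L2_inner_half_div[OF E(1) u(2)[OF E(1)]] L2_inner_half_div[OF E'(1) u(2)[OF E'(1)]]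
      by (simp add: UNIV_bool w_def d_def)
    finally have 1: "L2_inner \<Omega> (weak_div \<Omega> \<psi>) u = c E $ i + k * c E' $ i" .
    have "quad \<T> \<psi> \<gamma> = (\<Sum>b\<in>UNIV. w b * quad \<T> (f b) \<gamma>)"
      unfolding \<psi>_def by (rule quad_sum_left[OF finite P1f \<gamma>])
    also have "\<dots> = ((1 / real (CARD('d) + 1)) *\<^sub>R (poly_ext E \<gamma> r *v (r - a))) $ i +
        k * ((1 / real (CARD('d) + 1)) *\<^sub>R (poly_ext E' \<gamma> r *v (r - a'))) $ i"
      using quad_half_field[OF E \<gamma>] quad_half_field[OF E' \<gamma>] by (simp add: UNIV_bool w_def f_def)
    finally show ?thesis
      using orth[of \<psi>] X(1) P1 1 by (simp add: X_h_def algebra_simps)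
  qed
  then show ?thesis by (simp add: vec_eq_iff)
qed

end

section \<open>Vanishing of displacement and rotation\<close>

context polyhedral_mesh
begin

lemma flux_adjacent:
  assumes adj: "adjacent E a E' a'" and r: "r \<in> vert E - {a}" and \<phi>: "test_function U \<phi> D\<phi>"
  shows "flux E a r \<phi> D\<phi> = flux E' a' r \<phi> D\<phi>"
proof -
  have E: "E \<in> \<T>" "E' \<in> \<T>" using adj by (auto simp: adjacent_def)
  interpret facet_pair "vert E" "vert E'" a a' by (rule adjacent_facet_pair[OF adj])
  have g: "\<And>x. GDERIV \<phi> x :> D\<phi> x" "continuous_on UNIV D\<phi>" using \<phi> by (auto simp: test_function_def)
  have "measure lborel E' * (\<integral>x. indicator E x * (bary (vert E) r x * (D\<phi> x \<bullet> (r - a)) + \<phi> x) \<partial>lborel) =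
    measure lborel E * (\<integral>x. indicator E' x * (bary (vert E') r x * (D\<phi> x \<bullet> (r - a')) + \<phi> x) \<partial>lborel)"
    using flux_match[OF r g] by (simp only: hull_vert[OF E(1)] hull_vert[OF E(2)])
  then show ?thesis
    using measure_element_pos[OF E(1)] measure_element_pos[OF E(2)] by (simp add: flux_def field_simps)
qed

lemma flux_zero:
  assumes E: "E \<in> \<T>" "a \<in> vert E" "r \<in> vert E - {a}" and \<phi>: "test_function U \<phi> D\<phi>"
    and zero: "\<And>x. x \<in> convex hull (vert E - {a}) \<Longrightarrow> \<phi> x = 0"
  shows "flux E a r \<phi> D\<phi> = 0"
proof -
  interpret full_simplex "vert E" by (rule vert_simplex[OF E(1)])
  have g: "\<And>x. GDERIV \<phi> x :> D\<phi> x" "continuous_on UNIV D\<phi>" using \<phi> by (auto simp: test_function_def)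
  show ?thesis
    using integral_flux_zero[OF E(2,3) g zero] by (simp add: flux_def hull_vert[OF E(1)])
qed

lemma facet_interior_in_domain:
  assumes adj: "adjacent E a E' a'" and w: "bary (vert E) a w = 0" "\<And>c. c \<in> vert E - {a} \<Longrightarrow> 0 < bary (vert E) c w"
  shows "w \<in> \<Omega>" "w \<in> E" "w \<in> E'"
proof -
  have E: "E \<in> \<T>" "E' \<in> \<T>" "a \<in> vert E" using adj by (auto simp: adjacent_def)
  note h = hull_vert[OF E(1)] hull_vert[OF E(2)]
  interpret facet_pair "vert E" "vert E'" a a' by (rule adjacent_facet_pair[OF adj])
  have inter: "convex hull (vert E) \<inter> convex hull (vert E') = convex hull (vert E - {a})"
    using Int_elements[OF E(1,2)] adjacent_apex_notin(3)[OF adj] by (simp add: h)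
  from interior_union[OF inter w] have "w \<in> interior (E \<union> E')" by (simp add: h)
  moreover have "interior (E \<union> E') \<subseteq> interior (\<Union>\<T>)" using E by (intro interior_mono) blast
  ultimately show "w \<in> \<Omega>" using interior_mesh by blast
  have "0 \<le> bary (vert E) c w" if "c \<in> vert E" for c
    using w that by (cases "c = a") (auto intro: less_imp_le)
  then have wE: "w \<in> convex hull (vert E)" by (simp add: S.convex_hull_bary)
  then have "w \<in> convex hull (vert E - {a})"
    using w(1) E(3) by (subst S.convex_hull_subset_bary) auto
  with inter wE show "w \<in> E" "w \<in> E'" using h by blast+
qed

lemma poly_ext_continuous_eq:
  fixes \<gamma> :: "real^'d \<Rightarrow> 'b::real_normed_vector"
  assumes "continuous_on \<Omega> \<gamma>" "E \<in> \<T>" "P1_on E \<gamma>" "w \<in> \<Omega>" "w \<in> E"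
  shows "poly_ext E \<gamma> w = \<gamma> w"
proof -
  have "(\<gamma> \<longlongrightarrow> \<gamma> w) (at w within \<Omega>)" using assms(1,4) by (simp add: continuous_on_def)
  then have "(\<gamma> \<longlongrightarrow> \<gamma> w) (at w within interior E)"
    using interior_element_subset[OF assms(2)] by (rule tendsto_within_subset)
  then show ?thesis
    using tendsto_unique[OF at_within_interior_nontrivial[OF assms(2,5)] poly_ext_tendsto[OF assms(3)]] by blast
qed

text \<open>A rotation is continuous in the open domain only, and the vertex \<open>r\<close> may lie on its boundary.
  Agreement at two points of the relative interior of the facet that are in line with \<open>r\<close> extends to \<open>r\<close>.\<close>

lemma poly_ext_continuous_across_facet:
  fixes \<gamma> :: "real^'d \<Rightarrow> 'b::real_normed_vector"
  assumes \<gamma>: "continuous_on \<Omega> \<gamma>" "\<And>S. S \<in> \<T> \<Longrightarrow> P1_on S \<gamma>"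
    and adj: "adjacent E a E' a'" and r: "r \<in> vert E - {a}"
  shows "poly_ext E \<gamma> r = poly_ext E' \<gamma> r"
proof -
  have E: "E \<in> \<T>" "E' \<in> \<T>" "a \<in> vert E" using adj by (auto simp: adjacent_def)
  interpret full_simplex "vert E" by (rule vert_simplex[OF E(1)])
  have agree: "poly_ext E \<gamma> w = poly_ext E' \<gamma> w"
    if w: "bary (vert E) a w = 0" "\<And>c. c \<in> vert E - {a} \<Longrightarrow> 0 < bary (vert E) c w" for w
    using poly_ext_continuous_eq[OF \<gamma>(1) E(1) \<gamma>(2)[OF E(1)]] poly_ext_continuous_eq[OF \<gamma>(1) E(2) \<gamma>(2)[OF E(2)]]
      facet_interior_in_domain[OF adj w] by metis
  define n where "n = card (vert E - {a})"
  have n: "n > 0" using r by (auto simp: n_def card_gt_0_iff)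
  define k where "k c = (if c = a then 0 else 1 / real n)" for c
  define m where "m = (\<Sum>c\<in>vert E. k c *\<^sub>R c)"
  have "sum k (vert E) = k a + sum k (vert E - {a})" by (rule sum.remove[OF finite_C E(3)])
  also have "sum k (vert E - {a}) = (\<Sum>c\<in>vert E - {a}. 1 / real n)" by (intro sum.cong) (auto simp: k_def)
  also have "k a + \<dots> = 1" using n by (simp add: k_def flip: n_def)
  finally have m: "bary (vert E) c m = k c" if "c \<in> vert E" for c
    unfolding m_def by (rule bary_affine_combination[OF that])
  have 1: "poly_ext E \<gamma> m = poly_ext E' \<gamma> m"
    using m E(3) n by (intro agree) (auto simp: k_def)
  have ra: "bary (vert E) a r = 0" using bary_vertex[OF E(3), of r] r by auto
  have rc: "0 \<le> bary (vert E) c r" if "c \<in> vert E" for c using bary_vertex[OF that, of r] r by auto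
  have 2: "poly_ext E \<gamma> ((1 - 1/2) *\<^sub>R r + (1/2) *\<^sub>R m) = poly_ext E' \<gamma> ((1 - 1/2) *\<^sub>R r + (1/2) *\<^sub>R m)"
  proof (rule agree)
    show "bary (vert E) a ((1 - 1/2) *\<^sub>R r + (1/2) *\<^sub>R m) = 0"
      unfolding bary_combo using m[OF E(3)] ra by (simp add: k_def)
    show "0 < bary (vert E) c ((1 - 1/2) *\<^sub>R r + (1/2) *\<^sub>R m)" if "c \<in> vert E - {a}" for c
      unfolding bary_combo using m[of c] rc[of c] that n by (simp add: k_def add_nonneg_pos)
  qed
  have "(1 - 1/2) *\<^sub>R poly_ext E \<gamma> r = (1 - 1/2) *\<^sub>R poly_ext E' \<gamma> r"
    using 2 unfolding affine_fun_combo[OF poly_ext(1)[OF \<gamma>(2)[OF E(1)]]] affine_fun_combo[OF poly_ext(1)[OF \<gamma>(2)[OF E(2)]]]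
    by (simp add: 1)
  then show ?thesis by simp
qed

lemma poly_ext_skew:
  fixes \<gamma> :: "real^'d \<Rightarrow> real^'d^'d"
  assumes skew: "\<And>x. x \<in> \<Omega> \<Longrightarrow> transpose (\<gamma> x) = - \<gamma> x" and E: "E \<in> \<T>" and P1: "P1_on E \<gamma>"
  shows "transpose (poly_ext E \<gamma> x) = - poly_ext E \<gamma> x"
proof -
  obtain c L where L: "linear L" "poly_ext E \<gamma> = (\<lambda>x. c + L x)"
    using poly_ext(1)[OF P1] by (auto simp: affine_fun_def)
  have tadd: "transpose (A + B) = transpose A + transpose B" for A B :: "real^'d^'d"
    by (simp add: transpose_def vec_eq_iff)
  have tscale: "transpose (k *\<^sub>R A) = k *\<^sub>R transpose A" for A :: "real^'d^'d" and k
    by (simp add: transpose_def vec_eq_iff)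
  have "linear (\<lambda>x. transpose (L x))"
    by (intro linearI) (simp_all add: linear_add[OF L(1)] linear_scale[OF L(1)] tadd tscale)
  from affine_funI[OF this, of "transpose c"] have 1: "affine_fun (\<lambda>x. transpose (poly_ext E \<gamma> x))"
    by (simp add: L(2) tadd)
  have "linear (\<lambda>x. - L x)" by (rule linear_compose_neg[OF L(1)])
  from affine_funI[OF this, of "- c"] have 2: "affine_fun (\<lambda>x. - poly_ext E \<gamma> x)"
    by (simp add: L(2))
  have "(\<lambda>x. transpose (poly_ext E \<gamma> x)) = (\<lambda>x. - poly_ext E \<gamma> x)"
  proof (rule affine_fun_eqI[OF 1 2 open_interior interior_nonempty[OF E]])
    show "transpose (poly_ext E \<gamma> x) = - poly_ext E \<gamma> x" if "x \<in> interior E" for x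
      using skew[of x] interior_element_subset[OF E] that poly_ext(2)[OF P1 that] by auto
  qed
  then show ?thesis by (rule fun_cong)
qed

text \<open>A small ball around a relative interior point of the Dirichlet part meets the mesh and its
  complement, hence a boundary facet, and this facet meets the ball, hence cannot be in the
  closure of the Neumann part.\<close>

lemma dirichlet_facet:
  assumes bp: "boundary_partition \<Omega> \<Gamma>D \<Gamma>N"
    and split: "\<And>E F. E \<in> \<T> \<Longrightarrow> F facet_of E \<Longrightarrow> F \<subseteq> frontier \<Omega> \<Longrightarrow> F \<subseteq> closure \<Gamma>D \<or> F \<subseteq> closure \<Gamma>N"
  obtains E a where "E \<in> \<T>" "a \<in> vert E" "convex hull (vert E - {a}) \<subseteq> frontier \<Omega>"
    "convex hull (vert E - {a}) \<subseteq> closure \<Gamma>D"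
proof -
  have bp': "\<Gamma>D \<union> \<Gamma>N = frontier \<Omega>" "\<Gamma>D \<inter> \<Gamma>N = {}" "(top_of_set (frontier \<Omega>)) interior_of \<Gamma>D \<noteq> {}"
    using bp by (simp_all add: boundary_partition_def)
  obtain z T where "openin (top_of_set (frontier \<Omega>)) T" "z \<in> T" "T \<subseteq> \<Gamma>D"
    using bp'(3) by (auto simp: interior_of_def)
  then obtain W where W: "open W" "z \<in> W" "z \<in> frontier \<Omega>" "frontier \<Omega> \<inter> W \<subseteq> \<Gamma>D"
    by (auto simp: openin_open)
  obtain e where e: "e > 0" "ball z e \<subseteq> W" using W(1,2) open_contains_ball by blast
  have z: "z \<in> closure \<Omega>" "z \<notin> interior (\<Union>\<T>)"
    using W(3) open_\<Omega> interior_mesh by (auto simp: frontier_def interior_open)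
  then obtain E0 where E0: "E0 \<in> \<T>" "z \<in> E0" using covers by blast
  have meets: "E0 \<inter> ball z e \<noteq> {}" using E0(2) e(1) centre_in_ball by blast
  have out: "ball z e - \<Union>\<T> \<noteq> {}"
  proof
    assume "ball z e - \<Union>\<T> = {}"
    then have "z \<in> interior (\<Union>\<T>)" using e(1) by (intro interiorI[of "ball z e"]) auto
    with z(2) show False by simp
  qed
  obtain E a where E: "E \<in> \<T>" "a \<in> vert E" "convex hull (vert E - {a}) \<inter> ball z e \<noteq> {}"
      "convex hull (vert E - {a}) \<subseteq> frontier (\<Union>\<T>)"
    by (rule boundary_facet_near[OF open_ball convex_ball E0(1) meets out])
  have fr: "convex hull (vert E - {a}) \<subseteq> frontier \<Omega>"
    using E(4) open_\<Omega> interior_mesh by (simp add: frontier_def covers interior_open)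
  interpret full_simplex "vert E" by (rule vert_simplex[OF E(1)])
  have "convex hull (vert E - {a}) facet_of convex hull (vert E)"
    unfolding facet_of_convex_hull_affine_independent[OF indep] using E(2,3) by blast
  then have "convex hull (vert E - {a}) facet_of E" by (simp add: hull_vert[OF E(1)])
  from split[OF E(1) this fr] have "convex hull (vert E - {a}) \<subseteq> closure \<Gamma>D"
  proof
    assume N: "convex hull (vert E - {a}) \<subseteq> closure \<Gamma>N"
    then have "ball z e \<inter> closure \<Gamma>N \<noteq> {}" using E(3) by blast
    then have "ball z e \<inter> \<Gamma>N \<noteq> {}" using open_Int_closure_eq_empty[OF open_ball, of z e \<Gamma>N] by blast
    then show ?thesis using e(2) W(4) bp'(1,2) by blast
  qed
  with that E(1,2) fr show ?thesis by blast
qed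

text \<open>On a Dirichlet facet the admissible test functions vanish: those of the weak divergence are supported
  in the open domain, those of the trace condition keep off the closure of the Dirichlet part.\<close>

lemma rotation_displacement_zero:
  fixes u :: "real^'d \<Rightarrow> real^'d" and \<gamma> :: "real^'d \<Rightarrow> real^'d^'d"
  assumes d: "CARD('d) \<in> {2, 3}" and bp: "boundary_partition \<Omega> \<Gamma>D \<Gamma>N"
    and split: "\<And>E F. E \<in> \<T> \<Longrightarrow> F facet_of E \<Longrightarrow> F \<subseteq> frontier \<Omega> \<Longrightarrow> F \<subseteq> closure \<Gamma>D \<or> F \<subseteq> closure \<Gamma>N"
    and int_vert: "\<And>E. E \<in> \<T> \<Longrightarrow> vert E \<inter> \<Omega> \<noteq> {}"
    and u: "L2_on \<Omega> u" "\<And>E. E \<in> \<T> \<Longrightarrow> P0_on E u"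
    and \<gamma>: "continuous_on \<Omega> \<gamma>" "\<And>x. x \<in> \<Omega> \<Longrightarrow> transpose (\<gamma> x) = - \<gamma> x" "\<And>E. E \<in> \<T> \<Longrightarrow> P1_on E \<gamma>"
    and orth: "\<And>\<psi>. \<psi> \<in> X_h \<Omega> \<Gamma>N \<T> \<Longrightarrow> L2_inner \<Omega> (weak_div \<Omega> \<psi>) u + quad \<T> \<psi> \<gamma> = 0"
    and E: "E \<in> \<T>" "x \<in> interior E"
  shows "u x = 0 \<and> \<gamma> x = 0"
proof -
  obtain c where c: "\<And>E x. E \<in> \<T> \<Longrightarrow> x \<in> interior E \<Longrightarrow> u x = c E"
    using u(2) unfolding P0_on_def by metis
  define s where "s = real (CARD('d) + 1)"
  note eqn = test_field_equation[OF _ _ _ _ _ orth u(1) c \<gamma>(3)]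
  have cont: "poly_ext E \<gamma> r = poly_ext E' \<gamma> r" if "adjacent E a E' a'" "r \<in> vert E - {a}" for E a E' a' r
    by (rule poly_ext_continuous_across_facet[OF \<gamma>(1,3) that])
  have jump: "c E - c E' = (1 / real (CARD('d) + 1)) *\<^sub>R (poly_ext E \<gamma> r *v (a - a'))"
    if adj: "adjacent E a E' a'" and r: "r \<in> vert E - {a}" for E a E' a' r
  proof -
    have E: "E \<in> \<T>" "r \<in> vert E" "E' \<in> \<T>" "r \<in> vert E'" using adj r by (auto simp: adjacent_def)
    have "(c E + (1 / s) *\<^sub>R (poly_ext E \<gamma> r *v (r - a))) + (-1) *\<^sub>R (c E' + (1 / s) *\<^sub>R (poly_ext E' \<gamma> r *v (r - a'))) = 0"
      unfolding s_def
    proof (rule eqn[OF E])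
      fix \<phi> :: "real^'d \<Rightarrow> real" and D\<phi>
      assume "test_function \<Omega> \<phi> D\<phi> \<or> test_function (- closure (frontier \<Omega> - \<Gamma>N)) \<phi> D\<phi>"
      then obtain U where "test_function U \<phi> D\<phi>" by blast
      from flux_adjacent[OF adj r this] show "flux E a r \<phi> D\<phi> + (-1) * flux E' a' r \<phi> D\<phi> = 0" by simp
    qed
    then have "c E - c E' = (1 / s) *\<^sub>R (poly_ext E \<gamma> r *v (r - a')) - (1 / s) *\<^sub>R (poly_ext E \<gamma> r *v (r - a))"
      using cont[OF adj r] by (simp add: algebra_simps)
    also have "\<dots> = (1 / s) *\<^sub>R (poly_ext E \<gamma> r *v (a - a'))"
      by (simp add: matrix_vector_mult_diff_distrib scaleR_diff_right)
    finally show ?thesis by (simp only: s_def)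
  qed
  obtain E1 a1 where E1: "E1 \<in> \<T>" "a1 \<in> vert E1" "convex hull (vert E1 - {a1}) \<subseteq> frontier \<Omega>"
      "convex hull (vert E1 - {a1}) \<subseteq> closure \<Gamma>D"
    by (rule dirichlet_facet[OF bp split])
  have bd: "c E1 + (1 / real (CARD('d) + 1)) *\<^sub>R (poly_ext E1 \<gamma> r *v (r - a1)) = 0"
    if r: "r \<in> vert E1 - {a1}" for r
  proof -
    have rE: "r \<in> vert E1" using r by simp
    have "(c E1 + (1 / real (CARD('d) + 1)) *\<^sub>R (poly_ext E1 \<gamma> r *v (r - a1))) +
      0 *\<^sub>R (c E1 + (1 / real (CARD('d) + 1)) *\<^sub>R (poly_ext E1 \<gamma> r *v (r - a1))) = 0"
    proof (rule eqn[OF E1(1) rE E1(1) rE])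
      fix \<phi> :: "real^'d \<Rightarrow> real" and D\<phi>
      assume \<phi>: "test_function \<Omega> \<phi> D\<phi> \<or> test_function (- closure (frontier \<Omega> - \<Gamma>N)) \<phi> D\<phi>"
      then obtain U where U: "test_function U \<phi> D\<phi>" "U = \<Omega> \<or> U = - closure (frontier \<Omega> - \<Gamma>N)" by blast
      have "frontier \<Omega> - \<Gamma>N = \<Gamma>D" using bp by (auto simp: boundary_partition_def)
      moreover have "frontier \<Omega> \<inter> \<Omega> = {}" using open_\<Omega> by (auto simp: frontier_def interior_open)
      ultimately have disj: "convex hull (vert E1 - {a1}) \<inter> U = {}" using U(2) E1(3,4) by auto
      have "\<phi> x = 0" if "x \<in> convex hull (vert E1 - {a1})" for x
      proof (rule ccontr)
        assume "\<phi> x \<noteq> 0"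
        then have "x \<in> closure {x. \<phi> x \<noteq> 0}" by (intro subsetD[OF closure_subset]) simp
        moreover have "closure {x. \<phi> x \<noteq> 0} \<subseteq> U" using U(1) unfolding test_function_def by blast
        ultimately have "x \<in> U" by blast
        with disj that show False by blast
      qed
      from flux_zero[OF E1(1,2) r U(1) this] show "flux E1 a1 r \<phi> D\<phi> + 0 * flux E1 a1 r \<phi> D\<phi> = 0" by simp
    qed
    then show ?thesis by simp
  qed
  have "c E = 0 \<and> poly_ext E \<gamma> x = 0"
  proof (rule discrete_rigid_displacement_zero[where \<gamma>="\<lambda>E. poly_ext E \<gamma>" and u=c,
        OF d open_\<Omega> connected_\<Omega> \<Omega>_subset int_vert _ _ cont jump E1(1,2) bd E(1)])
    show "\<exists>k L. linear L \<and> (\<forall>x. poly_ext E \<gamma> x = k + L x)" if "E \<in> \<T>" for E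
      using poly_ext(1)[OF \<gamma>(3)[OF that]] unfolding affine_fun_def by metis
    show "transpose (poly_ext E \<gamma> x) = - poly_ext E \<gamma> x" if "E \<in> \<T>" for E x
      by (rule poly_ext_skew[OF \<gamma>(2) that \<gamma>(3)[OF that]])
  qed
  then show ?thesis using c[OF E] poly_ext(2)[OF \<gamma>(3)[OF E(1)] E(2)] by simp
qed

end

section \<open>The matrices\<close>

text \<open>Otherwise a basis function would have two representations.\<close>

lemma basis_of_independent:
  fixes b :: "'k::finite \<Rightarrow> real^'d \<Rightarrow> 'b::real_vector"
  assumes "basis_of \<Omega> S b" and zero: "AE x in lebesgue_on \<Omega>. (\<Sum>k\<in>UNIV. c k *\<^sub>R b k x) = 0"
  shows "c = (\<lambda>k. 0)"
proof
  fix k0 :: 'k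
  let ?e = "\<lambda>k. if k = k0 then 1 else 0 :: real"
  have "b k0 \<in> S" using assms(1) by (simp add: basis_of_def)
  then have "\<exists>!c'. AE x in lebesgue_on \<Omega>. b k0 x = (\<Sum>k\<in>UNIV. c' k *\<^sub>R b k x)"
    using assms(1) unfolding basis_of_def by blast
  then obtain c0 where uniq:
      "\<And>c'. (AE x in lebesgue_on \<Omega>. b k0 x = (\<Sum>k\<in>UNIV. c' k *\<^sub>R b k x)) \<Longrightarrow> c' = c0"
    by (elim ex1E) blast
  have e: "b k0 x = (\<Sum>k\<in>UNIV. ?e k *\<^sub>R b k x)" for x
    by (simp add: if_distrib[of "\<lambda>t. t *\<^sub>R _"] cong: if_cong)
  have "AE x in lebesgue_on \<Omega>. b k0 x = (\<Sum>k\<in>UNIV. ?e k *\<^sub>R b k x)" using e by simp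
  then have "?e = c0" by (rule uniq)
  have "AE x in lebesgue_on \<Omega>. b k0 x = (\<Sum>k\<in>UNIV. (?e k + c k) *\<^sub>R b k x)"
    using zero
  proof eventually_elim
    case (elim x)
    have "(\<Sum>k\<in>UNIV. (?e k + c k) *\<^sub>R b k x) = (\<Sum>k\<in>UNIV. ?e k *\<^sub>R b k x) + (\<Sum>k\<in>UNIV. c k *\<^sub>R b k x)"
      by (simp only: scaleR_add_left sum.distrib)
    then show ?case using elim e[of x] by simp
  qed
  then have "(\<lambda>k. ?e k + c k) = c0" by (rule uniq)
  with \<open>?e = c0\<close> have "?e = (\<lambda>k. ?e k + c k)" by simp
  from fun_cong[OF this, of k0] show "c k0 = 0" by simp
qed

lemma quadratic_form_sum: "x \<bullet> (M *v x) = (\<Sum>i\<in>UNIV. \<Sum>j\<in>UNIV. x $ i * x $ j * M $ i $ j)"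
  for M :: "real^'n^'n"
  by (simp add: inner_vec_def matrix_vector_mult_def sum_distrib_left mult_ac)

lemma sum_swap3: "(\<Sum>i\<in>I. \<Sum>j\<in>J. \<Sum>e\<in>K. g e i j) = (\<Sum>e\<in>K. \<Sum>i\<in>I. \<Sum>j\<in>J. g e i j)"
proof -
  have "(\<Sum>i\<in>I. \<Sum>j\<in>J. \<Sum>e\<in>K. g e i j) = (\<Sum>i\<in>I. \<Sum>e\<in>K. \<Sum>j\<in>J. g e i j)"
    by (intro sum.cong refl sum.swap)
  also have "\<dots> = (\<Sum>e\<in>K. \<Sum>i\<in>I. \<Sum>j\<in>J. g e i j)" by (rule sum.swap)
  finally show ?thesis .
qed

context polyhedral_mesh
begin

text \<open>The quadrature form is a sum over elements and vertices of the limits of the coefficient from within,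
  which inherit symmetry and coercivity. An affine field that vanishes at all vertices of an element
  vanishes there.\<close>

lemma A_sigma_sigma_spd:
  fixes A :: "real^'d \<Rightarrow> real^'d^'d \<Rightarrow> real^'d^'d" and \<tau> :: "'p::finite \<Rightarrow> real^'d \<Rightarrow> real^'d^'d"
  assumes A: "admissible_coefficient \<Omega> A" and vals: "has_vertex_values \<T> A"
    and P1: "\<And>E j. E \<in> \<T> \<Longrightarrow> P1_on E (\<tau> j)"
    and indep: "\<And>c. (AE x in lebesgue_on \<Omega>. (\<Sum>k\<in>UNIV. c k *\<^sub>R \<tau> k x) = 0) \<Longrightarrow> c = (\<lambda>k. 0)"
  shows "transpose (A_sigma_sigma \<T> A \<tau>) = A_sigma_sigma \<T> A \<tau>"
    and "x \<noteq> 0 \<Longrightarrow> 0 < x \<bullet> (A_sigma_sigma \<T> A \<tau> *v x)"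
proof -
  have A_lin: "\<And>y. y \<in> \<Omega> \<Longrightarrow> linear (A y)" and A_sym: "\<And>y \<sigma> \<rho>. y \<in> \<Omega> \<Longrightarrow> A y \<sigma> \<bullet> \<rho> = \<sigma> \<bullet> A y \<rho>"
    using A by (simp_all add: admissible_coefficient_def)
  obtain a1 where a1: "\<And>y \<sigma>. y \<in> \<Omega> \<Longrightarrow> norm (A y \<sigma>) \<le> a1 * norm \<sigma>"
    using A unfolding admissible_coefficient_def by blast
  obtain a0 where a0: "a0 > 0" "\<And>y \<sigma>. y \<in> \<Omega> \<Longrightarrow> a0 * (\<sigma> \<bullet> \<sigma>) \<le> A y \<sigma> \<bullet> \<sigma>"
    using A unfolding admissible_coefficient_def by blast
  define a where "a E r \<sigma> = from_within E (\<lambda>y. A y \<sigma>) r" for E r \<sigma>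
  have vE: "r \<in> E" if "E \<in> \<T>" "r \<in> vert E" for E r using vert_subset that by blast
  have ev_\<Omega>: "\<forall>\<^sub>F y in at r within interior E. y \<in> \<Omega>" if "E \<in> \<T>" for E r
    using interior_element_subset[OF that] by (auto simp: eventually_at_filter intro!: always_eventually)
  have a_lim: "((\<lambda>y. A y \<sigma>) \<longlongrightarrow> a E r \<sigma>) (at r within interior E)" if E: "E \<in> \<T>" "r \<in> vert E" for E r \<sigma>
  proof -
    obtain l where l: "((\<lambda>y. A y \<sigma>) \<longlongrightarrow> l) (at r within interior E)"
      using vals E unfolding has_vertex_values_def vert_def by blast
    from from_within_eqI[OF E(1) vE[OF E] l] l show ?thesis by (simp add: a_def)
  qed
  note nontriv = at_within_interior_nontrivial
  have a_sym: "a E r \<sigma> \<bullet> \<rho> = \<sigma> \<bullet> a E r \<rho>" if E: "E \<in> \<T>" "r \<in> vert E" for E r \<sigma> \<rho>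
  proof -
    have 1: "((\<lambda>y. A y \<sigma> \<bullet> \<rho>) \<longlongrightarrow> a E r \<sigma> \<bullet> \<rho>) (at r within interior E)"
      by (intro tendsto_inner a_lim[OF E] tendsto_const)
    have "((\<lambda>y. \<sigma> \<bullet> A y \<rho>) \<longlongrightarrow> \<sigma> \<bullet> a E r \<rho>) (at r within interior E)"
      by (intro tendsto_inner a_lim[OF E] tendsto_const)
    moreover have "\<forall>\<^sub>F y in at r within interior E. \<sigma> \<bullet> A y \<rho> = A y \<sigma> \<bullet> \<rho>"
      using ev_\<Omega>[OF E(1)] by eventually_elim (simp add: A_sym)
    ultimately have "((\<lambda>y. A y \<sigma> \<bullet> \<rho>) \<longlongrightarrow> \<sigma> \<bullet> a E r \<rho>) (at r within interior E)"
      by (rule Lim_transform_eventually)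
    from tendsto_unique[OF nontriv[OF E(1) vE[OF E]] 1 this] show ?thesis .
  qed
  have a_pos: "a0 * (\<sigma> \<bullet> \<sigma>) \<le> a E r \<sigma> \<bullet> \<sigma>" if E: "E \<in> \<T>" "r \<in> vert E" for E r \<sigma>
  proof (rule tendsto_lowerbound[OF _ _ nontriv[OF E(1) vE[OF E]]])
    show "((\<lambda>y. A y \<sigma> \<bullet> \<sigma>) \<longlongrightarrow> a E r \<sigma> \<bullet> \<sigma>) (at r within interior E)"
      by (intro tendsto_inner a_lim[OF E] tendsto_const)
    show "\<forall>\<^sub>F y in at r within interior E. a0 * (\<sigma> \<bullet> \<sigma>) \<le> A y \<sigma> \<bullet> \<sigma>"
      using ev_\<Omega>[OF E(1)] by eventually_elim (rule a0(2))
  qed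
  \<comment> \<open>The coefficient is only known to have limits for a fixed argument; boundedness makes up for the varying one.\<close>
  have a_field: "((\<lambda>y. A y (f y)) \<longlongrightarrow> a E r l) (at r within interior E)"
    if E: "E \<in> \<T>" "r \<in> vert E" and f: "(f \<longlongrightarrow> l) (at r within interior E)" for E r f l
  proof -
    have "((\<lambda>y. A y (f y - l)) \<longlongrightarrow> 0) (at r within interior E)"
    proof (rule Lim_null_comparison)
      show "\<forall>\<^sub>F y in at r within interior E. norm (A y (f y - l)) \<le> a1 * norm (f y - l)"
        using ev_\<Omega>[OF E(1)] by eventually_elim (rule a1)
      have "((\<lambda>y. a1 * norm (f y - l)) \<longlongrightarrow> a1 * norm (l - l)) (at r within interior E)"
        by (intro tendsto_intros f)
      then show "((\<lambda>y. a1 * norm (f y - l)) \<longlongrightarrow> 0) (at r within interior E)" by simp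
    qed
    from tendsto_add[OF this a_lim[OF E, of l]]
    have "((\<lambda>y. A y (f y - l) + A y l) \<longlongrightarrow> a E r l) (at r within interior E)" by simp
    moreover have "\<forall>\<^sub>F y in at r within interior E. A y (f y - l) + A y l = A y (f y)"
      using ev_\<Omega>[OF E(1)] by eventually_elim (simp add: linear_diff[OF A_lin])
    ultimately show ?thesis by (rule Lim_transform_eventually)
  qed
  have a_sum: "a E r (\<Sum>j\<in>UNIV. k j *\<^sub>R \<sigma> j) = (\<Sum>j\<in>UNIV. k j *\<^sub>R a E r (\<sigma> j))"
    if E: "E \<in> \<T>" "r \<in> vert E" for E r k and \<sigma> :: "'p \<Rightarrow> real^'d^'d"
  proof -
    have 1: "((\<lambda>y. \<Sum>j\<in>UNIV. k j *\<^sub>R A y (\<sigma> j)) \<longlongrightarrow> (\<Sum>j\<in>UNIV. k j *\<^sub>R a E r (\<sigma> j))) (at r within interior E)"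
      by (intro tendsto_sum tendsto_scaleR tendsto_const a_lim[OF E])
    moreover have "\<forall>\<^sub>F y in at r within interior E. (\<Sum>j\<in>UNIV. k j *\<^sub>R A y (\<sigma> j)) = A y (\<Sum>j\<in>UNIV. k j *\<^sub>R \<sigma> j)"
      using ev_\<Omega>[OF E(1)] by eventually_elim (simp add: linear_sum[OF A_lin] linear_scale[OF A_lin])
    ultimately have "((\<lambda>y. A y (\<Sum>j\<in>UNIV. k j *\<^sub>R \<sigma> j)) \<longlongrightarrow> (\<Sum>j\<in>UNIV. k j *\<^sub>R a E r (\<sigma> j))) (at r within interior E)"
      by (rule Lim_transform_eventually)
    from tendsto_unique[OF nontriv[OF E(1) vE[OF E]] a_lim[OF E] this] show ?thesis .
  qed
  define w where "w E = measure lebesgue E / real (CARD('d) + 1)" for E :: "(real^'d) set"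
  have w_pos: "w E > 0" if "E \<in> \<T>" for E
    using measure_element_pos[OF that] closed_element[OF that] by (simp add: w_def borel_closed)
  define \<tau>v where "\<tau>v E j r = poly_ext E (\<tau> j) r" for E j r
  have entry: "A_sigma_sigma \<T> A \<tau> $ i $ j = (\<Sum>E\<in>\<T>. w E * (\<Sum>r\<in>vert E. a E r (\<tau>v E j r) \<bullet> \<tau>v E i r))" for i j
  proof -
    have "quad_elem E (\<lambda>x. A x (\<tau> j x)) (\<tau> i) = w E * (\<Sum>r\<in>vert E. a E r (\<tau>v E j r) \<bullet> \<tau>v E i r)"
      if E: "E \<in> \<T>" for E
    proof -
      have "from_within E (\<lambda>x. A x (\<tau> j x)) r \<bullet> from_within E (\<tau> i) r = a E r (\<tau>v E j r) \<bullet> \<tau>v E i r"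
        if r: "r \<in> vert E" for r
        using from_within_eqI[OF E vE[OF E r] a_field[OF E r poly_ext_tendsto[OF P1[OF E]]]]
          from_within_P1[OF E vE[OF E r] P1[OF E]] by (simp add: \<tau>v_def)
      then have "(\<Sum>r\<in>vert E. from_within E (\<lambda>x. A x (\<tau> j x)) r \<bullet> from_within E (\<tau> i) r) =
          (\<Sum>r\<in>vert E. a E r (\<tau>v E j r) \<bullet> \<tau>v E i r)" by (rule sum.cong[OF refl])
      then show ?thesis by (simp only: quad_elem_def vert_def w_def)
    qed
    then show ?thesis by (simp add: A_sigma_sigma_def quad_def)
  qed
  show "transpose (A_sigma_sigma \<T> A \<tau>) = A_sigma_sigma \<T> A \<tau>"
  proof -
    have "A_sigma_sigma \<T> A \<tau> $ j $ i = A_sigma_sigma \<T> A \<tau> $ i $ j" for i j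
      unfolding entry
    proof (intro sum.cong refl arg_cong2[of _ _ _ _ "(*)"])
      fix E r assume Er: "E \<in> \<T>" "r \<in> vert E"
      show "a E r (\<tau>v E i r) \<bullet> \<tau>v E j r = a E r (\<tau>v E j r) \<bullet> \<tau>v E i r"
        by (rule trans[OF a_sym[OF Er] inner_commute])
    qed
    then show ?thesis by (simp add: transpose_def vec_eq_iff)
  qed
  assume x: "x \<noteq> 0"
  define \<sigma> where "\<sigma> E r = (\<Sum>j\<in>UNIV. x $ j *\<^sub>R \<tau>v E j r)" for E r
  have energy: "x \<bullet> (A_sigma_sigma \<T> A \<tau> *v x) = (\<Sum>E\<in>\<T>. w E * (\<Sum>r\<in>vert E. a E r (\<sigma> E r) \<bullet> \<sigma> E r))"
  proof -
    define f where "f E r i j = x $ i * x $ j * (a E r (\<tau>v E j r) \<bullet> \<tau>v E i r)" for E r i j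
    have "x \<bullet> (A_sigma_sigma \<T> A \<tau> *v x) =
        (\<Sum>i\<in>UNIV. \<Sum>j\<in>UNIV. x $ i * x $ j * (\<Sum>E\<in>\<T>. w E * (\<Sum>r\<in>vert E. a E r (\<tau>v E j r) \<bullet> \<tau>v E i r)))"
      by (simp only: quadratic_form_sum entry)
    also have "\<dots> = (\<Sum>i\<in>UNIV. \<Sum>j\<in>UNIV. \<Sum>E\<in>\<T>. w E * (\<Sum>r\<in>vert E. f E r i j))"
      by (simp add: f_def sum_distrib_left mult_ac)
    also have "\<dots> = (\<Sum>E\<in>\<T>. \<Sum>i\<in>UNIV. \<Sum>j\<in>UNIV. w E * (\<Sum>r\<in>vert E. f E r i j))"
      by (rule sum_swap3)
    also have "\<dots> = (\<Sum>E\<in>\<T>. w E * (\<Sum>i\<in>UNIV. \<Sum>j\<in>UNIV. \<Sum>r\<in>vert E. f E r i j))"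
      by (simp only: sum_distrib_left[symmetric])
    also have "\<dots> = (\<Sum>E\<in>\<T>. w E * (\<Sum>r\<in>vert E. \<Sum>i\<in>UNIV. \<Sum>j\<in>UNIV. f E r i j))"
      by (intro sum.cong refl arg_cong2[of _ _ _ _ "(*)"] sum_swap3)
    also have "\<dots> = (\<Sum>E\<in>\<T>. w E * (\<Sum>r\<in>vert E. a E r (\<sigma> E r) \<bullet> \<sigma> E r))"
    proof (intro sum.cong refl arg_cong2[of _ _ _ _ "(*)"])
      fix E r assume Er: "E \<in> \<T>" "r \<in> vert E"
      show "(\<Sum>i\<in>UNIV. \<Sum>j\<in>UNIV. f E r i j) = a E r (\<sigma> E r) \<bullet> \<sigma> E r"
        unfolding \<sigma>_def a_sum[OF Er] f_def
        by (simp add: inner_sum_left inner_sum_right sum_distrib_left mult_ac)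
    qed
    finally show ?thesis .
  qed
  have term_nonneg: "0 \<le> w E * (\<Sum>r\<in>vert E. a E r (\<sigma> E r) \<bullet> \<sigma> E r)" if E: "E \<in> \<T>" for E
  proof (intro mult_nonneg_nonneg sum_nonneg)
    show "0 \<le> a E r (\<sigma> E r) \<bullet> \<sigma> E r" if "r \<in> vert E" for r
    proof -
      have "0 \<le> a0 * (\<sigma> E r \<bullet> \<sigma> E r)" using a0(1) by simp
      also have "\<dots> \<le> a E r (\<sigma> E r) \<bullet> \<sigma> E r" by (rule a_pos[OF E that])
      finally show ?thesis .
    qed
  qed (use w_pos[OF E] in simp)
  show "0 < x \<bullet> (A_sigma_sigma \<T> A \<tau> *v x)"
  proof (rule ccontr)
    assume "\<not> 0 < x \<bullet> (A_sigma_sigma \<T> A \<tau> *v x)"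
    moreover have "0 \<le> x \<bullet> (A_sigma_sigma \<T> A \<tau> *v x)"
      unfolding energy using term_nonneg by (rule sum_nonneg)
    ultimately have "(\<Sum>E\<in>\<T>. w E * (\<Sum>r\<in>vert E. a E r (\<sigma> E r) \<bullet> \<sigma> E r)) = 0"
      by (simp only: energy[symmetric])
    then have "\<forall>E\<in>\<T>. w E * (\<Sum>r\<in>vert E. a E r (\<sigma> E r) \<bullet> \<sigma> E r) = 0"
      by (subst (asm) sum_nonneg_eq_0_iff[OF finite_mesh]) (use term_nonneg in auto)
    then have inner0: "(\<Sum>r\<in>vert E. a E r (\<sigma> E r) \<bullet> \<sigma> E r) = 0" if "E \<in> \<T>" for E
      using w_pos[OF that] that by fastforce
    have \<sigma>0: "\<sigma> E r = 0" if E: "E \<in> \<T>" "r \<in> vert E" for E r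
    proof -
      have "(\<Sum>r\<in>vert E. a0 * (\<sigma> E r \<bullet> \<sigma> E r)) \<le> 0"
        using sum_mono[of "vert E" "\<lambda>r. a0 * (\<sigma> E r \<bullet> \<sigma> E r)" "\<lambda>r. a E r (\<sigma> E r) \<bullet> \<sigma> E r"] a_pos[OF E(1)] inner0[OF E(1)] by simp
      moreover have "0 \<le> a0 * (\<sigma> E r \<bullet> \<sigma> E r)" for r using a0(1) by simp
      ultimately have "a0 * (\<sigma> E r \<bullet> \<sigma> E r) = 0"
        using sum_nonneg_0[of "vert E" "\<lambda>r. a0 * (\<sigma> E r \<bullet> \<sigma> E r)" r] E finite_vert[OF E(1)]
          sum_nonneg[of "vert E" "\<lambda>r. a0 * (\<sigma> E r \<bullet> \<sigma> E r)"] by (metis order_antisym)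
      then show ?thesis using a0(1) by simp
    qed
    have "AE y in lebesgue_on \<Omega>. (\<Sum>k\<in>UNIV. x $ k *\<^sub>R \<tau> k y) = 0"
      using AE_in_interior
    proof eventually_elim
      case (elim y)
      then obtain E where E: "E \<in> \<T>" "y \<in> interior E" by blast
      interpret full_simplex "vert E" by (rule vert_simplex[OF E(1)])
      let ?p = "poly_ext E (\<lambda>y. \<Sum>k\<in>UNIV. x $ k *\<^sub>R \<tau> k y)"
      note ps = poly_ext_sum[where f=\<tau> and I=UNIV and k="\<lambda>k. x $ k", OF E(1) P1[OF E(1)] finite]
      obtain c L where L: "linear L" "?p = (\<lambda>x. c + L x)"
        using poly_ext(1)[OF ps(1)] by (auto simp: affine_fun_def)
      have "?p r = 0" if "r \<in> vert E" for r
        using \<sigma>0[OF E(1) that] unfolding ps(2) by (simp add: \<sigma>_def \<tau>v_def)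
      then have "(\<Sum>r\<in>vert E. bary (vert E) r y *\<^sub>R (c + L r)) = 0"
        by (simp add: L(2))
      then have "?p y = 0" using affine_eq_sum_bary[OF L(1), of c y] by (simp add: L(2))
      then show ?case using poly_ext(2)[OF ps(1) E(2)] by simp
    qed
    from indep[OF this] have "x = 0" by (simp add: vec_eq_iff fun_eq_iff)
    with x show False by simp
  qed
qed

end

theorem lemma4p8:
  fixes \<Omega> \<Gamma>D \<Gamma>N :: "(real^'d) set"
    and \<T> :: "(real^'d) set set"
    and \<M> :: "(real^'d) set set set"
    and A :: "real^'d \<Rightarrow> real^'d^'d \<Rightarrow> real^'d^'d"
    and \<tau> :: "'p::finite \<Rightarrow> real^'d \<Rightarrow> real^'d^'d"
    and v :: "'q::finite \<Rightarrow> real^'d \<Rightarrow> real^'d"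
    and \<xi> :: "'r::finite \<Rightarrow> real^'d \<Rightarrow> real^'d^'d"
    and \<kappa>1 \<kappa>2 :: real
  assumes "CARD('d) \<in> {2, 3}"
    and "polyhedral_domain \<Omega>"
    and "boundary_partition \<Omega> \<Gamma>D \<Gamma>N"
    and "admissible_coefficient \<Omega> A"
    and "conforming_mesh \<Omega> \<Gamma>D \<Gamma>N \<T>"
    and "shape_regular \<kappa>1 \<T>"
    and "quasi_uniform \<kappa>2 \<T>"
    and "has_vertex_values \<T> A"
    and "finite \<M>"
    and "macroelement_partition \<M> \<Omega> \<T>"
    and "basis_of \<Omega> (X_h \<Omega> \<Gamma>N \<T>) \<tau>"
    and "basis_of \<Omega> (V_h \<Omega> \<T>) v"
    and "basis_of \<Omega> (W1_h \<Omega> \<T>) \<xi>"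
  shows "symmetric_positive_definite
    (displacement_matrix (A_sigma_sigma \<T> A \<tau>) (A_sigma_u \<Omega> \<tau> v) (A_sigma_gamma \<T> \<tau> \<xi>))"
proof -
  note d = assms(1) and bp = assms(3) and mesh = assms(5)
  interpret polyhedral_mesh \<T> \<Omega>
    using assms(2) mesh by unfold_locales (auto simp: conforming_mesh_def)
  have split: "F \<subseteq> closure \<Gamma>D \<or> F \<subseteq> closure \<Gamma>N"
    if "E \<in> \<T>" "F facet_of E" "F \<subseteq> frontier \<Omega>" for E F
    using mesh that unfolding conforming_mesh_def by blast
  have int_vert: "vert E \<inter> \<Omega> \<noteq> {}" if E: "E \<in> \<T>" for E
  proof -
    obtain R where R: "R \<subseteq> mesh_vertices \<T> \<inter> \<Omega>" "partition_on \<T> (vertex_star \<T> ` R)"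
      using assms(10) unfolding macroelement_partition_def by blast
    then have "E \<in> \<Union>(vertex_star \<T> ` R)" using E by (simp add: partition_on_def)
    then obtain r where "r \<in> R" "r \<in> vert E" by (auto simp: vertex_star_def vert_def)
    with R(1) show ?thesis by blast
  qed
  have \<tau>: "\<tau> j \<in> X_h \<Omega> \<Gamma>N \<T>" for j using assms(11) by (simp add: basis_of_def)
  have v: "v j \<in> V_h \<Omega> \<T>" for j using assms(12) by (simp add: basis_of_def)
  have \<xi>: "\<xi> j \<in> W1_h \<Omega> \<T>" for j using assms(13) by (simp add: basis_of_def)
  have \<tau>X: "\<tau> j \<in> X_space \<Omega> \<Gamma>N" for j using \<tau>[of j] by (simp add: X_h_def)
  have \<tau>P1: "P1_on E (\<tau> j)" if "E \<in> \<T>" for E j using \<tau>[of j] that by (simp add: X_h_def)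
  have \<xi>P1: "P1_on E (\<xi> j)" if "E \<in> \<T>" for E j using \<xi>[of j] that by (simp add: W1_h_def)
  show ?thesis
  proof (rule displacement_matrix_posdef)
    note spd = A_sigma_sigma_spd[where A=A and \<tau>=\<tau>, OF assms(4,8) \<tau>P1 basis_of_independent[OF assms(11)]]
    show "transpose (A_sigma_sigma \<T> A \<tau>) = A_sigma_sigma \<T> A \<tau>" by (rule spd(1))
    show "0 < x \<bullet> (A_sigma_sigma \<T> A \<tau> *v x)" if "x \<noteq> 0" for x using that by (rule spd(2)[rotated -1])
  next
    fix x :: "real^'q" and y :: "real^'r"
    assume zero: "transpose (A_sigma_u \<Omega> \<tau> v) *v x + transpose (A_sigma_gamma \<T> \<tau> \<xi>) *v y = 0"
    define u where "u z = (\<Sum>i\<in>UNIV. x $ i *\<^sub>R v i z)" for z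
    define \<gamma> where "\<gamma> z = (\<Sum>i\<in>UNIV. y $ i *\<^sub>R \<xi> i z)" for z
    have vL2: "L2_on \<Omega> (v i)" for i using v[of i] by (simp add: V_h_def)
    have uL2: "L2_on \<Omega> u"
      unfolding u_def[abs_def] by (intro L2_on_sum L2_on_scaleR vL2 finite)
    have uP0: "P0_on E u" if E: "E \<in> \<T>" for E
    proof -
      have "\<forall>i. \<exists>c. \<forall>z\<in>interior E. v i z = c" using v E by (simp add: V_h_def P0_on_def)
      then obtain c where "\<And>i z. z \<in> interior E \<Longrightarrow> v i z = c i" by metis
      then show ?thesis unfolding P0_on_def u_def by (intro exI[of _ "\<Sum>i\<in>UNIV. x $ i *\<^sub>R c i"]) simp
    qed
    have \<gamma>P1: "P1_on E \<gamma>" if "E \<in> \<T>" for E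
      unfolding \<gamma>_def[abs_def] by (rule poly_ext_sum(1)[OF that \<xi>P1[OF that] finite])
    have \<gamma>cont: "continuous_on \<Omega> \<gamma>"
      unfolding \<gamma>_def[abs_def] using \<xi> by (intro continuous_intros) (simp add: W1_h_def)
    have \<gamma>skew: "transpose (\<gamma> z) = - \<gamma> z" if "z \<in> \<Omega>" for z
    proof -
      have sk: "transpose (\<xi> i z) = - \<xi> i z" for i using \<xi>[of i] that by (simp add: W1_h_def)
      have entry: "\<xi> i z $ l $ k = - (\<xi> i z $ k $ l)" for i k l
        using arg_cong[OF sk[of i], of "\<lambda>B. B $ k $ l"] by (simp add: transpose_def)
      have anti: "\<gamma> z $ l $ k = - (\<gamma> z $ k $ l)" for k l
      proof -
        have "\<gamma> z $ l $ k = (\<Sum>i\<in>UNIV. y $ i * \<xi> i z $ l $ k)" by (simp add: \<gamma>_def)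
        also have "\<dots> = (\<Sum>i\<in>UNIV. y $ i * - (\<xi> i z $ k $ l))"
          by (intro sum.cong refl arg_cong2[of _ _ _ _ "(*)"] entry)
        also have "\<dots> = - (\<gamma> z $ k $ l)" by (simp add: \<gamma>_def sum_negf)
        finally show ?thesis .
      qed
      have "transpose (\<gamma> z) $ k $ l = (- \<gamma> z) $ k $ l" for k l
        using anti[of l k] by (simp add: transpose_def)
      then show ?thesis unfolding vec_eq_iff by blast
    qed
    have orth_\<tau>: "L2_inner \<Omega> (weak_div \<Omega> (\<tau> j)) u + quad \<T> (\<tau> j) \<gamma> = 0" for j
    proof -
      have "L2_inner \<Omega> (weak_div \<Omega> (\<tau> j)) u = (\<Sum>i\<in>UNIV. x $ i * L2_inner \<Omega> (weak_div \<Omega> (\<tau> j)) (v i))"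
        unfolding u_def using L2_inner_sum_left[where I=UNIV and f=v and c="\<lambda>i. x $ i", OF vL2 weak_div(1)[OF \<tau>X]]
        by (simp only: L2_inner_commute)
      moreover have "quad \<T> (\<tau> j) \<gamma> = (\<Sum>i\<in>UNIV. y $ i * quad \<T> (\<tau> j) (\<xi> i))"
        unfolding \<gamma>_def using quad_sum_left[where I=UNIV and f=\<xi> and g="\<tau> j" and k="\<lambda>i. y $ i", OF finite \<xi>P1 \<tau>P1]
        by (simp only: quad_commute)
      moreover have "(transpose (A_sigma_u \<Omega> \<tau> v) *v x + transpose (A_sigma_gamma \<T> \<tau> \<xi>) *v y) $ j =
          (\<Sum>i\<in>UNIV. x $ i * L2_inner \<Omega> (weak_div \<Omega> (\<tau> j)) (v i)) + (\<Sum>i\<in>UNIV. y $ i * quad \<T> (\<tau> j) (\<xi> i))"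
        by (simp del: transpose_matrix_vector add: matrix_vector_mult_def transpose_def A_sigma_u_def A_sigma_gamma_def mult.commute)
      ultimately show ?thesis using zero by (simp del: transpose_matrix_vector)
    qed
    have orth: "L2_inner \<Omega> (weak_div \<Omega> \<psi>) u + quad \<T> \<psi> \<gamma> = 0" if \<psi>: "\<psi> \<in> X_h \<Omega> \<Gamma>N \<T>" for \<psi>
    proof -
      obtain c where c: "AE x in lebesgue_on \<Omega>. \<psi> x = (\<Sum>k\<in>UNIV. c k *\<^sub>R \<tau> k x)"
        using assms(11) \<psi> unfolding basis_of_def by blast
      have \<psi>': "L2_on \<Omega> \<psi>" "\<And>E. E \<in> \<T> \<Longrightarrow> P1_on E \<psi>" using \<psi> by (auto simp: X_h_def X_space_def)
      have "quad \<T> \<psi> \<gamma> = quad \<T> (\<lambda>x. \<Sum>k\<in>UNIV. c k *\<^sub>R \<tau> k x) \<gamma>"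
      proof -
        have P: "P1_on E (\<lambda>x. \<Sum>k\<in>UNIV. c k *\<^sub>R \<tau> k x)" if "E \<in> \<T>" for E
          by (rule poly_ext_sum(1)[OF that \<tau>P1[OF that] finite])
        have "quad \<T> \<psi> \<gamma> = (\<Sum>E\<in>\<T>. measure lebesgue E / real (CARD('d) + 1) *
            (\<Sum>r\<in>vert E. poly_ext E \<psi> r \<bullet> poly_ext E \<gamma> r))"
          by (rule quad_P1[OF \<psi>'(2) \<gamma>P1])
        also have "\<dots> = (\<Sum>E\<in>\<T>. measure lebesgue E / real (CARD('d) + 1) *
            (\<Sum>r\<in>vert E. poly_ext E (\<lambda>x. \<Sum>k\<in>UNIV. c k *\<^sub>R \<tau> k x) r \<bullet> poly_ext E \<gamma> r))"
          using poly_ext_cong_AE[OF _ \<psi>'(2) P c] by (intro sum.cong refl) simp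
        also have "\<dots> = quad \<T> (\<lambda>x. \<Sum>k\<in>UNIV. c k *\<^sub>R \<tau> k x) \<gamma>"
          by (rule quad_P1[OF P \<gamma>P1, symmetric])
        finally show ?thesis .
      qed
      also have "\<dots> = (\<Sum>k\<in>UNIV. c k * quad \<T> (\<tau> k) \<gamma>)"
        by (rule quad_sum_left[where I=UNIV and f=\<tau>, OF finite \<tau>P1 \<gamma>P1])
      finally have "L2_inner \<Omega> (weak_div \<Omega> \<psi>) u + quad \<T> \<psi> \<gamma> =
          (\<Sum>k\<in>UNIV. c k * (L2_inner \<Omega> (weak_div \<Omega> (\<tau> k)) u + quad \<T> (\<tau> k) \<gamma>))"
        using L2_inner_weak_div_combination[OF open_\<Omega> bounded_\<Omega> \<tau>X \<psi>'(1) c uL2]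
        by (simp add: distrib_left sum.distrib)
      then show ?thesis by (simp add: orth_\<tau>)
    qed
    have "u z = 0 \<and> \<gamma> z = 0" if "E \<in> \<T>" "z \<in> interior E" for E z
      by (rule rotation_displacement_zero[OF d bp split int_vert uL2 uP0 \<gamma>cont \<gamma>skew \<gamma>P1 orth that])
    then have "AE z in lebesgue_on \<Omega>. u z = 0" "AE z in lebesgue_on \<Omega>. \<gamma> z = 0"
      using AE_in_interior by (auto elim!: eventually_mono)
    from basis_of_independent[OF assms(12) this(1)[unfolded u_def]]
      basis_of_independent[OF assms(13) this(2)[unfolded \<gamma>_def]]
    have "(\<lambda>i. x $ i) = (\<lambda>i. 0)" "(\<lambda>i. y $ i) = (\<lambda>i. 0)" .
    then show "x = 0 \<and> y = 0" by (simp add: vec_eq_iff fun_eq_iff)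
  qed
qed

end
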